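(* Let $FH$ be a Frobenius group with cyclic kernel $F$ of order $n$ and complement $H$ of order $q$. Suppose that $FH$ acts by automorphisms on a Lie algebra $L$ (over an arbitrary field) in such a way that $C_L(F)=0$ and $C_L(H)$ is nilpotent of class $c$. Then $L$ is nilpotent of $(c,q)$-bounded class; that is, the nilpotency class of $L$ is at most $\beta(c,q)$ for some function $\beta$ depending only on $c$ and $q$ (and not on $n$, the field, or $L$).
   Context: For a group $A$ of automorphisms of a Lie algebra $L$, $C_L(A)=\{x\in L\mid x^a=x\text{ for all }a\in A\}$ denotes the fixed-point subalgebra. No finiteness of the dimension of $L$ is assumed. A Lie algebra $M$ is nilpotent of class at most $c$ if $\gamma_{c+1}(M)=0$, where $\gamma_1(M)=M$ and $\gamma_{k+1}(M)=[\gamma_k(M),M]$. *)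

theory Defs
  imports "HOL-Algebra.Algebra"
begin

section \<open>Lie algebras over a field\<close>

text \<open>Only the additive group, the scalar multiplication and the bracket are used; the fields
  \<open>mult\<close> and \<open>one\<close> inherited from the module record are irrelevant. No dimension is assumed.\<close>

record ('k, 'l) lie_algebra = "('k, 'l) module" +
  bracket :: "'l \<Rightarrow> 'l \<Rightarrow> 'l"

locale lie_algebra = K?: field K + L?: module K L
  for K :: "('k, 'r) ring_scheme" (structure)
    and L :: "('k, 'l, 's) lie_algebra_scheme" (structure) +
  assumes bracket_closed:
      "\<lbrakk>x \<in> carrier L; y \<in> carrier L\<rbrakk> \<Longrightarrow> bracket L x y \<in> carrier L"
    and bracket_add_left:
      "\<lbrakk>x \<in> carrier L; y \<in> carrier L; z \<in> carrier L\<rbrakk> \<Longrightarrow>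
        bracket L (x \<oplus>\<^bsub>L\<^esub> y) z = bracket L x z \<oplus>\<^bsub>L\<^esub> bracket L y z"
    and bracket_add_right:
      "\<lbrakk>x \<in> carrier L; y \<in> carrier L; z \<in> carrier L\<rbrakk> \<Longrightarrow>
        bracket L x (y \<oplus>\<^bsub>L\<^esub> z) = bracket L x y \<oplus>\<^bsub>L\<^esub> bracket L x z"
    and bracket_smult_left:
      "\<lbrakk>a \<in> carrier K; x \<in> carrier L; y \<in> carrier L\<rbrakk> \<Longrightarrow>
        bracket L (a \<odot>\<^bsub>L\<^esub> x) y = a \<odot>\<^bsub>L\<^esub> bracket L x y"
    and bracket_smult_right:
      "\<lbrakk>a \<in> carrier K; x \<in> carrier L; y \<in> carrier L\<rbrakk> \<Longrightarrow>
        bracket L x (a \<odot>\<^bsub>L\<^esub> y) = a \<odot>\<^bsub>L\<^esub> bracket L x y"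
    and bracket_self:
      "x \<in> carrier L \<Longrightarrow> bracket L x x = \<zero>\<^bsub>L\<^esub>"
    and jacobi:
      "\<lbrakk>x \<in> carrier L; y \<in> carrier L; z \<in> carrier L\<rbrakk> \<Longrightarrow>
        bracket L (bracket L x y) z \<oplus>\<^bsub>L\<^esub> bracket L (bracket L y z) x
          \<oplus>\<^bsub>L\<^esub> bracket L (bracket L z x) y = \<zero>\<^bsub>L\<^esub>"

definition lie_hom ::
  "('k, 'r) ring_scheme \<Rightarrow> ('k, 'l, 's) lie_algebra_scheme \<Rightarrow> ('k, 'm, 't) lie_algebra_scheme
    \<Rightarrow> ('l \<Rightarrow> 'm) set"
  where "lie_hom K L M = {f. f \<in> carrier L \<rightarrow> carrier M
    \<and> (\<forall>x\<in>carrier L. \<forall>y\<in>carrier L. f (x \<oplus>\<^bsub>L\<^esub> y) = f x \<oplus>\<^bsub>M\<^esub> f y)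
    \<and> (\<forall>a\<in>carrier K. \<forall>x\<in>carrier L. f (a \<odot>\<^bsub>L\<^esub> x) = a \<odot>\<^bsub>M\<^esub> f x)
    \<and> (\<forall>x\<in>carrier L. \<forall>y\<in>carrier L. f (bracket L x y) = bracket M (f x) (f y))}"

definition lin_span :: "('k, 'r) ring_scheme \<Rightarrow> ('k, 'l, 's) module_scheme \<Rightarrow> 'l set \<Rightarrow> 'l set"
  where "lin_span K L S = \<Inter>{N. submodule N K L \<and> S \<subseteq> N}"

text \<open>The index is shifted by one: \<open>lower_central K L k\<close> is the term \<open>\<gamma>\<^sub>k\<^sub>+\<^sub>1(L)\<close>, so that
  nilpotency of class at most \<open>c\<close>, i.e. \<open>\<gamma>\<^sub>c\<^sub>+\<^sub>1(L) = 0\<close>, is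
  \<open>lower_central K L c = {\<zero>\<^bsub>L\<^esub>}\<close>.\<close>

primrec lower_central ::
  "('k, 'r) ring_scheme \<Rightarrow> ('k, 'l, 's) lie_algebra_scheme \<Rightarrow> nat \<Rightarrow> 'l set"
  where
    "lower_central K L 0 = carrier L"
  | "lower_central K L (Suc k) =
      lin_span K L {bracket L x y | x y. x \<in> lower_central K L k \<and> y \<in> carrier L}"

definition nilpotent_class_le ::
  "('k, 'r) ring_scheme \<Rightarrow> ('k, 'l, 's) lie_algebra_scheme \<Rightarrow> nat \<Rightarrow> bool"
  where "nilpotent_class_le K L c \<longleftrightarrow> lower_central K L c = {\<zero>\<^bsub>L\<^esub>}"


section \<open>Frobenius groups and their actions on Lie algebras\<close>

text \<open>A finite semidirect product \<open>G = FH\<close> of nontrivial groups, with \<open>F\<close> normal, such that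
  \<open>C\<^sub>F(h) = 1\<close> for every \<open>h \<in> H\<close> with \<open>h \<noteq> 1\<close>.\<close>

definition frobenius_group :: "('g, 'm) monoid_scheme \<Rightarrow> 'g set \<Rightarrow> 'g set \<Rightarrow> bool"
  where "frobenius_group G F H \<longleftrightarrow>
    group G \<and> finite (carrier G)
    \<and> F \<lhd> G \<and> subgroup H G \<and> F \<noteq> {\<one>\<^bsub>G\<^esub>} \<and> H \<noteq> {\<one>\<^bsub>G\<^esub>}
    \<and> F <#>\<^bsub>G\<^esub> H = carrier G \<and> F \<inter> H = {\<one>\<^bsub>G\<^esub>}
    \<and> (\<forall>h\<in>H - {\<one>\<^bsub>G\<^esub>}. \<forall>f\<in>F. f \<otimes>\<^bsub>G\<^esub> h = h \<otimes>\<^bsub>G\<^esub> f \<longrightarrow> f = \<one>\<^bsub>G\<^esub>)"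

text \<open>An action need not be faithful.\<close>

definition acts_by_lie_automorphisms ::
  "('g, 'm) monoid_scheme \<Rightarrow> ('k, 'r) ring_scheme \<Rightarrow> ('k, 'l, 's) lie_algebra_scheme
    \<Rightarrow> ('g \<Rightarrow> 'l \<Rightarrow> 'l) \<Rightarrow> bool"
  where "acts_by_lie_automorphisms G K L \<phi> \<longleftrightarrow>
    group_action G (carrier L) \<phi> \<and> (\<forall>g\<in>carrier G. \<phi> g \<in> lie_hom K L L)"

definition fixed_points ::
  "('l, 's) partial_object_scheme \<Rightarrow> ('g \<Rightarrow> 'l \<Rightarrow> 'l) \<Rightarrow> 'g set \<Rightarrow> 'l set"
  where "fixed_points L \<phi> A = {x \<in> carrier L. \<forall>a\<in>A. \<phi> a x = x}"


section \<open>The bounding function\<close>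

text \<open>A statement \<open>\<exists>\<beta>. \<dots>\<close> about algebras living on type variables would let \<open>\<beta>\<close> vary with the
  types, hence with the cardinality of the field and of the algebra, because HOL has no
  quantification over types inside a formula. The function \<open>\<beta>\<close> is therefore a closed constant of type
  \<open>nat \<Rightarrow> nat \<Rightarrow> nat\<close>, common to all types: some function bounding the class of all countable
  algebras in question (those with field, algebra and group carried by sets of natural
  numbers). That such a function exists, and that it also bounds the class over arbitrary fields
  and in arbitrary cardinality, is not part of the definition. Conversely nothing is lost by
  this choice: a nonzero commutator in \<open>L\<close> lies in a countable invariant subalgebra over the
  prime field, so a function valid for countable algebras is valid for all of them.\<close>

definition nilpotency_bound :: "nat \<Rightarrow> nat \<Rightarrow> nat"
  where "nilpotency_bound = (SOME \<beta>.
    \<forall>(G :: nat monoid) F H (K :: nat ring) (L :: (nat, nat) lie_algebra) \<phi> c q.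
      frobenius_group G F H \<and> cyclic_group (G\<lparr>carrier := F\<rparr>) \<and> card H = q
      \<and> lie_algebra K L \<and> acts_by_lie_automorphisms G K L \<phi>
      \<and> fixed_points L \<phi> F = {\<zero>\<^bsub>L\<^esub>}
      \<and> nilpotent_class_le K (L\<lparr>carrier := fixed_points L \<phi> H\<rparr>) c
      \<longrightarrow> nilpotent_class_le K L (\<beta> c q))"

end

theory Submission
  imports Defs "Jordan_Normal_Form.Determinant" "HOL-Number_Theory.Cong" "HOL-Library.Countable_Set"
begin

text \<open>The kernel \<open>F\<close> is cyclic, say generated by \<open>f\<close>, and a non-trivial element \<open>h\<close> of \<open>H\<close> conjugates \<open>f\<close>
  to a power \<open>f^r(h)\<close> with \<open>r(h) - 1\<close> prime to the order of \<open>f\<close>. If the characteristic \<open>p\<close> of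
  the field divides this order, then already the \<open>p'\<close>-part of \<open>F\<close> has no non-zero fixed
  points, because a unipotent operator on a non-zero space fixes a non-zero vector
  (\<open>unipotent_fixed_point\<close>). So let the order \<open>n\<close> be invertible in the field. With a primitive
  \<open>n\<close>-th root of unity \<open>\<omega>\<close> at hand, \<open>L\<close> is the direct sum of the eigenspaces \<open>L\<^sub>i\<close> of \<open>f\<close>, indexed by
  the integers modulo \<open>n\<close>, with \<open>[L\<^sub>i, L\<^sub>j] \<subseteq> L\<^sub>i\<^sub>+\<^sub>j\<close> and \<open>L\<^sub>0 = 0\<close>, and \<open>h \<in> H\<close> maps \<open>L\<^sub>i\<close> into
  \<open>L\<^sub>r\<^sub>(\<^sub>h\<^sub>)\<^sub>i\<close>. An orbit sum \<open>\<Sum>\<^sub>h x^h\<close> is fixed by \<open>H\<close>, so a commutator of \<open>c + 1\<close> orbit sums of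
  homogeneous elements vanishes, and so does each of its homogeneous components
  (\<open>homogeneous_orbit_identity\<close>). Call weights \<open>a\<^sub>0, \<dots>, a\<^sub>c\<close> independent if
  \<open>\<Sum> r(h\<^sub>i) a\<^sub>i = \<Sum> a\<^sub>i\<close> modulo \<open>n\<close> forces all \<open>h\<^sub>i\<close> to be trivial. For such weights the component of
  weight \<open>\<Sum> a\<^sub>i\<close> is a single commutator: a commutator of \<open>c + 1\<close> elements of independent weights is zero.
  The rest of the argument exploits this selective nilpotency and has three parts.

  \<^item> \<open>L\<close> is soluble of bounded derived length (\<open>selective_solvable\<close>). An independent sequence
    becomes dependent by adding one more weight for boundedly many weights only
    (\<open>card_dependent_extensions\<close>), and a constant sequence of length \<open>c\<close> is dependent only if its
    weight has small additive order (\<open>order_bounded_if_dependent\<close>). Hence the ideal generated by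
    a commutator of \<open>c\<close> elements of independent weights has boundedly many non-zero components
    (\<open>few_weights\<close>). The elimination of Kreknin and Shalev (\<open>kreknin_shalev\<close>) shows that a derived term
    of bounded index centralises this ideal; induction on \<open>c\<close> concludes.

  \<^item> Modulo \<open>L''\<close>, the derived algebra is killed by a bounded number of commutations with \<open>L\<close>
    (\<open>metabelian_nilpotent\<close>). Factors may be permuted here, so one can bring together either
    \<open>c\<close> factors of independent weights or many factors of the same weight \<open>b\<close>. If \<open>b\<close> has small order
    \<open>m\<close>, then a factor \<open>v\<close> is, up to division by \<open>m\<close>, the sum over \<open>t < m\<close> of the twisted orbit sums
    \<open>\<Sum>\<^sub>h \<omega>^(t(r(h) - 1)b) v^h\<close>, and \<open>c\<close> of these with the same \<open>t\<close> annihilate (\<open>block_average_killed\<close>).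

  \<^item> A soluble algebra whose metabelian sections are nilpotent in this sense is nilpotent, as in
    the theorem of P. Hall (\<open>soluble_nilpotent\<close>).

  The root of unity need not lie in the field. Instead of extending the field one works
  in the group of formal sums \<open>\<Sum> x\<^sub>i \<omega>^i\<close> with \<open>x\<^sub>i \<in> L\<close>, modulo the kernel of multiplication by
  \<open>\<Prod> (1 - \<omega>^(n/p))\<close>, the product over the primes \<open>p\<close> dividing \<open>n\<close>: modulo this kernel, \<open>\<omega>^i - 1\<close> can be cancelled
  unless \<open>n\<close> divides \<open>i\<close> (\<open>shift_cancel\<close>). For this reason all the Lie theory below is developed modulo a
  subgroup, without forming quotients.

  Finally, the bound in the theorem is chosen by means of algebras carried by sets of natural
  numbers only. A commutator in an arbitrary \<open>L\<close> lies in a countable subalgebra, invariant under \<open>FH\<close>, over a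
  countable subfield, and this can be copied to the natural numbers
  (\<open>bound_for_countable_suffices\<close>).\<close>

section \<open>Lie rings modulo a subgroup\<close>

definition add_subgroup :: "'a::ab_group_add set \<Rightarrow> bool"
  where "add_subgroup S \<longleftrightarrow> 0 \<in> S \<and> (\<forall>x\<in>S. \<forall>y\<in>S. x - y \<in> S)"

lemma add_subgroup_zero: "add_subgroup S \<Longrightarrow> 0 \<in> S"
  and add_subgroup_diff: "add_subgroup S \<Longrightarrow> x \<in> S \<Longrightarrow> y \<in> S \<Longrightarrow> x - y \<in> S"
  by (auto simp: add_subgroup_def)

lemma add_subgroup_uminus: "add_subgroup S \<Longrightarrow> x \<in> S \<Longrightarrow> - x \<in> S"
  using add_subgroup_diff[of S 0 x] add_subgroup_zero[of S] by simp

lemma add_subgroup_add: "add_subgroup S \<Longrightarrow> x \<in> S \<Longrightarrow> y \<in> S \<Longrightarrow> x + y \<in> S"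
  using add_subgroup_diff[of S x "- y"] add_subgroup_uminus[of S y] by simp

lemma add_subgroup_sum: "add_subgroup S \<Longrightarrow> (\<And>i. i \<in> I \<Longrightarrow> f i \<in> S) \<Longrightarrow> sum f I \<in> S"
  by (induction I rule: infinite_finite_induct) (auto simp: add_subgroup_zero add_subgroup_add)

lemma add_subgroup_cong:
  "add_subgroup S \<Longrightarrow> x - y \<in> S \<Longrightarrow> x \<in> S \<longleftrightarrow> y \<in> S"
  by (metis add_diff_cancel_left' add_subgroup_diff diff_add_cancel add_subgroup_add)

inductive_set add_span :: "'a::ab_group_add set \<Rightarrow> 'a set" for T
  where
    zero: "0 \<in> add_span T"
  | base: "x \<in> T \<Longrightarrow> x \<in> add_span T"
  | diff: "x \<in> add_span T \<Longrightarrow> y \<in> add_span T \<Longrightarrow> x - y \<in> add_span T"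

lemma add_subgroup_add_span: "add_subgroup (add_span T)"
  by (simp add: add_subgroup_def add_span.zero add_span.diff)

lemma add_span_least: "add_subgroup S \<Longrightarrow> T \<subseteq> S \<Longrightarrow> add_span T \<subseteq> S"
proof
  fix x assume "x \<in> add_span T" and "add_subgroup S" "T \<subseteq> S"
  then show "x \<in> S" by induction (auto simp: add_subgroup_def)
qed

lemma add_span_mono: "S \<subseteq> T \<Longrightarrow> add_span S \<subseteq> add_span T"
  by (rule add_span_least[OF add_subgroup_add_span]) (auto intro: add_span.base)

definition additive_map :: "('a::ab_group_add \<Rightarrow> 'b::ab_group_add) \<Rightarrow> bool"
  where "additive_map f \<longleftrightarrow> (\<forall>x y. f (x - y) = f x - f y)"

lemma additive_map_simps:
  assumes "additive_map f"
  shows "f (x - y) = f x - f y" "f 0 = 0" "f (- x) = - f x" "f (x + y) = f x + f y"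
proof -
  show d: "f (x - y) = f x - f y" for x y using assms by (simp add: additive_map_def)
  show z: "f 0 = 0" using d[of 0 0] by simp
  show m: "f (- x) = - f x" for x using d[of 0 x] z by simp
  show "f (x + y) = f x + f y" using d[of x "- y"] m by simp
qed

lemma additive_map_sum: "additive_map f \<Longrightarrow> f (sum g I) = (\<Sum>i\<in>I. f (g i))"
  by (induction I rule: infinite_finite_induct) (auto simp: additive_map_simps)

lemma additive_map_span:
  assumes "additive_map f" "add_subgroup S" "\<And>x. x \<in> T \<Longrightarrow> f x \<in> S" "x \<in> add_span T"
  shows "f x \<in> S"
  using assms(4)
  by induction (use assms(1-3) in \<open>auto simp: additive_map_simps add_subgroup_zero add_subgroup_diff\<close>)

lemma biadditive_span:
  assumes "\<And>y. additive_map (\<lambda>x. f x y)" "\<And>x. additive_map (f x)" "add_subgroup S"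
    and "\<And>x y. x \<in> T \<Longrightarrow> y \<in> U \<Longrightarrow> f x y \<in> S"
    and "x \<in> add_span T" "y \<in> add_span U"
  shows "f x y \<in> S"
proof (rule additive_map_span[OF assms(1) assms(3) _ assms(5)])
  show "f x y \<in> S" if "x \<in> T" for x
    by (rule additive_map_span[OF assms(2) assms(3) _ assms(6)]) (simp add: assms(4) that)
qed

text \<open>The quotient by \<open>Z\<close> is a Lie ring, but it is never formed: with a fixed carrier type, the
  ideal can be enlarged in the course of an induction.\<close>

locale lie_ring_mod =
  fixes br :: "'a::ab_group_add \<Rightarrow> 'a \<Rightarrow> 'a" and Z :: "'a set"
  assumes br_left: "additive_map (\<lambda>x. br x y)"
    and br_right: "additive_map (br x)"
    and Z_subgroup: "add_subgroup Z"
    and Z_left: "x \<in> Z \<Longrightarrow> br x y \<in> Z"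
    and Z_right: "y \<in> Z \<Longrightarrow> br x y \<in> Z"
    and br_self: "br x x \<in> Z"
    and br_jacobi: "br (br x y) z + br (br y z) x + br (br z x) y \<in> Z"
begin

lemmas br_simps = additive_map_simps[OF br_left] additive_map_simps[OF br_right]

lemma br_antisym: "br x y + br y x \<in> Z"
proof -
  have "br (x + y) (x + y) - br x x - br y y \<in> Z"
    by (intro add_subgroup_diff Z_subgroup br_self)
  then show ?thesis by (simp add: br_simps algebra_simps)
qed

lemma br_leibniz: "br (br x y) z - (br (br x z) y + br x (br y z)) \<in> Z"
proof -
  have "(br (br x y) z + br (br y z) x + br (br z x) y)
      - (br (br y z) x + br x (br y z)) - br (br z x + br x z) y \<in> Z"
    by (intro add_subgroup_diff add_subgroup_add Z_subgroup br_jacobi br_antisym Z_left)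
  then show ?thesis by (simp add: br_simps algebra_simps)
qed

abbreviation lnc :: "'a \<Rightarrow> 'a list \<Rightarrow> 'a" where "lnc \<equiv> foldl br"

lemma lnc_additive: "additive_map (\<lambda>x. lnc x ys)"
proof (induction ys rule: rev_induct)
  case (snoc y ys)
  then show ?case unfolding additive_map_def by (simp add: br_simps)
qed (simp add: additive_map_def)

lemmas lnc_simps = additive_map_simps[OF lnc_additive]

lemma lnc_Z: "x \<in> Z \<Longrightarrow> lnc x ys \<in> Z"
  by (induction ys arbitrary: x) (auto simp: Z_left)

end

locale graded_lie = lie_ring_mod br Z for br :: "'a::ab_group_add \<Rightarrow> 'a \<Rightarrow> 'a" and Z +
  fixes n :: int
  assumes n_pos: "n > 0"
begin

text \<open>A grading by the integers modulo \<open>n\<close>, given as an \<open>n\<close>-periodic family. The components are not required to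
  be independent: only the identities between homogeneous components of the ambient algebra
  depend on that, and they are proved separately.\<close>

definition graded :: "(int \<Rightarrow> 'a set) \<Rightarrow> bool"
  where "graded Y \<longleftrightarrow> (\<forall>i. add_subgroup (Y i)) \<and> (\<forall>i j. i mod n = j mod n \<longrightarrow> Y i = Y j)
    \<and> (\<forall>i j. \<forall>x\<in>Y i. \<forall>y\<in>Y j. br x y \<in> Y (i + j))"

lemma gradedD:
  assumes "graded Y"
  shows "add_subgroup (Y i)" "i mod n = j mod n \<Longrightarrow> Y i = Y j"
    "x \<in> Y i \<Longrightarrow> y \<in> Y j \<Longrightarrow> br x y \<in> Y (i + j)"
  using assms unfolding graded_def by blast+

lemma graded_br: "graded Y \<Longrightarrow> x \<in> Y i \<Longrightarrow> y \<in> Y j \<Longrightarrow> (i + j) mod n = k mod n \<Longrightarrow> br x y \<in> Y k"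
  using gradedD by blast

text \<open>An ideal of the ring generated by the components of \<open>Y\<close>, except that it may contain elements
  outside this ring.\<close>

definition rel_ideal :: "(int \<Rightarrow> 'a set) \<Rightarrow> 'a set \<Rightarrow> bool"
  where "rel_ideal Y N \<longleftrightarrow> add_subgroup N \<and> Z \<subseteq> N \<and> (\<forall>i. \<forall>x\<in>N. \<forall>y\<in>Y i. br x y \<in> N)"

lemma rel_idealD:
  assumes "rel_ideal Y N"
  shows "add_subgroup N" "Z \<subseteq> N" "x \<in> N \<Longrightarrow> y \<in> Y i \<Longrightarrow> br x y \<in> N"
  using assms by (auto simp: rel_ideal_def)

lemma rel_ideal_right: "rel_ideal Y N \<Longrightarrow> x \<in> N \<Longrightarrow> y \<in> Y i \<Longrightarrow> br y x \<in> N"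
  using br_antisym[of y x] rel_idealD[of Y N]
  by (metis add_subgroup_cong diff_minus_eq_add subsetD add_subgroup_uminus)

lemma rel_ideal_subset: "rel_ideal Y N \<Longrightarrow> (\<And>i. Y' i \<subseteq> Y i) \<Longrightarrow> rel_ideal Y' N"
  unfolding rel_ideal_def by blast

definition der :: "(int \<Rightarrow> 'a set) \<Rightarrow> int \<Rightarrow> 'a set"
  where "der Y k = add_span {br x y | x y i j. x \<in> Y i \<and> y \<in> Y j \<and> (i + j) mod n = k mod n}"

lemma der_br: "x \<in> Y i \<Longrightarrow> y \<in> Y j \<Longrightarrow> (i + j) mod n = k mod n \<Longrightarrow> br x y \<in> der Y k"
  unfolding der_def by (rule add_span.base) blast

lemma der_subset: "graded Y \<Longrightarrow> der Y k \<subseteq> Y k"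
  unfolding der_def by (intro add_span_least) (auto intro: gradedD graded_br)

lemma graded_der:
  assumes "graded Y" shows "graded (der Y)"
  unfolding graded_def
proof (intro conjI allI ballI impI)
  show "add_subgroup (der Y i)" for i by (simp add: der_def add_subgroup_add_span)
  show "i mod n = j mod n \<Longrightarrow> der Y i = der Y j" for i j by (simp add: der_def)
  show "br x y \<in> der Y (i + j)" if "x \<in> der Y i" "y \<in> der Y j" for i j x y
    by (rule der_br) (use der_subset[OF assms] that in auto)
qed

lemma graded_dern: "graded Y \<Longrightarrow> graded ((der ^^ s) Y)"
  by (induction s) (auto intro: graded_der)

lemma dern_subset: "graded Y \<Longrightarrow> (der ^^ s) Y k \<subseteq> Y k"
proof (induction s)
  case (Suc s)
  then show ?case using der_subset[OF graded_dern[of Y s], of k] by auto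
qed simp

lemma dern_antimono: "graded Y \<Longrightarrow> s \<le> t \<Longrightarrow> (der ^^ t) Y k \<subseteq> (der ^^ s) Y k"
  using dern_subset[OF graded_dern[of Y s], of "t - s" k]
  by (metis comp_apply funpow_add le_add_diff_inverse2)

section \<open>The elimination of Kreknin and Shalev\<close>

text \<open>The homogeneous elements of the subring generated, modulo \<open>N\<close>, by the components whose weights lie in
  \<open>B\<close>. The weight is recorded because an element may belong to several components.\<close>

inductive_set homog_gen :: "(int \<Rightarrow> 'a set) \<Rightarrow> int set \<Rightarrow> 'a set \<Rightarrow> (int \<times> 'a) set"
  for Y B N
  where
    null: "x \<in> N \<Longrightarrow> x \<in> Y i \<Longrightarrow> (i, x) \<in> homog_gen Y B N"
  | gen: "x \<in> Y i \<Longrightarrow> i mod n \<in> B \<Longrightarrow> (i, x) \<in> homog_gen Y B N"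
  | diff: "(i, x) \<in> homog_gen Y B N \<Longrightarrow> (i, y) \<in> homog_gen Y B N \<Longrightarrow> (i, x - y) \<in> homog_gen Y B N"
  | brac: "(i, x) \<in> homog_gen Y B N \<Longrightarrow> (j, y) \<in> homog_gen Y B N \<Longrightarrow> (i + j) mod n = k mod n
      \<Longrightarrow> (k, br x y) \<in> homog_gen Y B N"

lemma homog_gen_subset:
  assumes "(i, x) \<in> homog_gen Y B N" "graded Y"
  shows "x \<in> Y i"
  using assms(1)
  by induction (use assms(2) in \<open>auto intro: gradedD(1) add_subgroup_diff graded_br\<close>)

lemma homog_gen_empty:
  assumes "(i, x) \<in> homog_gen Y {} N" "graded Y" "rel_ideal Y N"
  shows "x \<in> N"
proof -
  from assms(1) have "x \<in> N \<and> x \<in> Y i"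
    by induction (use assms(2,3) in \<open>auto intro: gradedD(1) rel_idealD(1,3) add_subgroup_diff graded_br\<close>)
  then show ?thesis ..
qed

text \<open>A bracket with an element of the generated subring is a combination of brackets with generators,
  by \<open>[y, [u, v]] = [[y, u], v] - [[y, v], u]\<close>.\<close>

lemma br_homog_gen:
  assumes Y: "graded Y" and N: "rel_ideal Y N"
    and F: "F = (\<lambda>t. add_span ((N \<inter> Y t) \<union>
        {br u v | u v w g. u \<in> Y w \<and> v \<in> Y g \<and> g mod n \<in> B \<and> (w + g) mod n = t mod n}))"
    and x: "(i, x) \<in> homog_gen Y B N" and y: "y \<in> Y j" and t: "(j + i) mod n = t mod n"
  shows "br y x \<in> F t"
  using x y t
proof (induction arbitrary: y j t)
  case (null x i)
  then show ?case unfolding F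
    by (intro add_span.base) (auto intro: rel_ideal_right[OF N] graded_br[OF Y])
next
  case (gen x i)
  then show ?case unfolding F by (intro add_span.base) auto
next
  case (diff i x x')
  then show ?case by (auto simp: F br_simps intro: add_span.diff)
next
  case (brac i u l v k)
  have Yu: "u \<in> Y i" "v \<in> Y l" using brac homog_gen_subset[OF _ Y] by auto
  have e: "(j + i + l) mod n = t mod n"
    using brac.hyps(3) brac.prems(2) by (metis add.assoc mod_add_right_eq)
  have A: "br (br y u) v \<in> F t"
    by (rule brac.IH(2)[OF gradedD(3)[OF Y brac.prems(1) Yu(1)] e])
  have e': "(j + l + i) mod n = t mod n" using e by (simp add: algebra_simps)
  have B: "br (br y v) u \<in> F t"
    by (rule brac.IH(1)[OF gradedD(3)[OF Y brac.prems(1) Yu(2)] e'])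
  have "br (br y u) v - br (br y v) u - br y (br u v) \<in> Z"
    using br_leibniz[of y u v] by (simp add: algebra_simps)
  moreover have "br (br y u) v - br (br y v) u - br y (br u v) \<in> Y t"
    by (intro add_subgroup_diff gradedD(1,3)[OF Y] graded_br[OF Y, of _ "j + i" _ l] graded_br[OF Y, of _ "j + l" _ i]
        graded_br[OF Y, of _ j _ "i + l"] Yu brac.prems e e') (use e in \<open>simp add: algebra_simps\<close>)
  ultimately have C: "br (br y u) v - br (br y v) u - br y (br u v) \<in> F t"
    unfolding F by (intro add_span.base) (use rel_idealD(2)[OF N] in auto)
  have sg: "add_subgroup (F t)" by (simp add: F add_subgroup_add_span)
  from add_subgroup_diff[OF sg add_subgroup_diff[OF sg A B] C] show ?case by simp
qed

text \<open>The weights in the initial segment \<open>E\<close> of \<open>D\<close> are eliminated one after the other. Let \<open>k\<close> be the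
  largest of them and \<open>A\<close> the set of the others. The induction hypothesis expresses the elements of a derived
  term by components of weights in \<open>D - A\<close>, so that one more derived step expresses weight \<open>k\<close>
  by brackets \<open>[u, v]\<close> with the weight \<open>g\<close> of \<open>v\<close> in \<open>D - A\<close>. As the weight \<open>w\<close> of \<open>u\<close> is not \<open>0\<close>, the
  weight \<open>g\<close> is not \<open>k\<close>; so \<open>g > k\<close>, hence \<open>w + g = n + k\<close> and \<open>w > k\<close> too. Thus weight \<open>k\<close> of the derived term
  of index \<open>s + 1\<close> is expressed by larger weights, and the induction hypothesis inside that derived term removes the
  remaining weights; this explains the exponent \<open>2^|E| - 1\<close>.\<close>

lemma kreknin_elimination:
  assumes "finite E" and "graded Y" and "rel_ideal Y N" and "D \<subseteq> {1..<n}"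
    and "\<And>i. i mod n \<notin> D \<Longrightarrow> Y i \<subseteq> N" and "E \<subseteq> D" and "\<And>g e. g \<in> D - E \<Longrightarrow> e \<in> E \<Longrightarrow> e < g"
    and "x \<in> (der ^^ (2 ^ card E - 1)) Y i"
  shows "(i, x) \<in> homog_gen Y (D - E) N"
  using assms
proof (induction E arbitrary: Y x i rule: finite_linorder_max_induct)
  case empty
  then show ?case by (cases "i mod n \<in> D") (auto intro: homog_gen.intros)
next
  case (insert k A)
  define s :: nat where "s = 2 ^ card A - 1"
  have kA: "k \<notin> A" using insert.hyps by auto
  have card: "2 ^ card (insert k A) - 1 = s + Suc s"
  proof -
    have "(1::nat) \<le> 2 ^ card A" by simp
    moreover have "card (insert k A) = Suc (card A)" using insert.hyps(1) kA by simp
    ultimately show ?thesis unfolding s_def by simp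
  qed
  note Y = insert.prems(1) and N = insert.prems(2)
  have kD: "k \<in> D" using insert.prems by auto
  have k: "0 < k" "k < n" using kD insert.prems(3) by auto
  have nD: "0 \<notin> D" using insert.prems(3) by auto
  have IH: "(i, x) \<in> homog_gen Y' (D - A) N"
    if "graded Y'" "\<And>i. Y' i \<subseteq> Y i" "x \<in> (der ^^ s) Y' i" for Y' x i
  proof (rule insert.IH)
    show "rel_ideal Y' N" using rel_ideal_subset[OF N] that(2) by blast
    show "Y' i \<subseteq> N" if "i mod n \<notin> D" for i using that \<open>\<And>i. Y' i \<subseteq> Y i\<close> insert.prems(4) by blast
    show "e < g" if "g \<in> D - A" "e \<in> A" for g e
      using that insert.hyps(2) insert.prems(6)[of g e] by (cases "g = k") auto
  qed (use that insert.prems s_def in auto)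
  let ?W = "(der ^^ s) Y" and ?V = "(der ^^ Suc s) Y"
  have main: "(i, x) \<in> homog_gen Y (D - insert k A) N" if x: "x \<in> ?V i" and i: "i mod n = k" for x i
  proof -
    define F where "F = (\<lambda>t. add_span ((N \<inter> Y t) \<union>
        {br u v | u v w g. u \<in> Y w \<and> v \<in> Y g \<and> g mod n \<in> D - A \<and> (w + g) mod n = t mod n}))"
    have "?V i \<subseteq> F i"
      unfolding funpow.simps comp_def der_def[of "(der ^^ s) Y"]
    proof (rule add_span_least)
      show "add_subgroup (F i)" by (simp add: F_def add_subgroup_add_span)
      show "{br x y |x y a b. x \<in> ?W a \<and> y \<in> ?W b \<and> (a + b) mod n = i mod n} \<subseteq> F i"
      proof clarify
        fix y x a b assume "y \<in> ?W a" "x \<in> ?W b" "(a + b) mod n = i mod n"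
        moreover from this have "(b, x) \<in> homog_gen Y (D - A) N" using IH[OF Y] by blast
        ultimately show "br y x \<in> F i"
          using br_homog_gen[OF Y N F_def] dern_subset[OF Y] by blast
      qed
    qed
    then have "x \<in> F i" using x by blast
    moreover have "F i \<subseteq> {z. (i, z) \<in> homog_gen Y (D - insert k A) N}"
      unfolding F_def
    proof (rule add_span_least)
      show "add_subgroup {z. (i, z) \<in> homog_gen Y (D - insert k A) N}"
        using N Y unfolding add_subgroup_def
        by (auto intro: homog_gen.null homog_gen.diff add_subgroup_zero gradedD rel_idealD)
      have "(i, br u v) \<in> homog_gen Y (D - insert k A) N"
        if u: "u \<in> Y w" and v: "v \<in> Y g" and g: "g mod n \<in> D - A" and t: "(w + g) mod n = i mod n"
        for u v w g
      proof -
        have uv: "br u v \<in> Y i" using graded_br[OF Y u v t] .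
        have null: ?thesis if "u \<in> N"
          using that v uv rel_idealD(3)[OF N] by (blast intro: homog_gen.null)
        show ?thesis
        proof (cases "w mod n \<in> D")
          case False
          then show ?thesis using null u insert.prems(4) by blast
        next
          case wD: True
          have wg: "(w mod n + g mod n) mod n = k" using t i by (simp add: mod_add_eq)
          have w: "0 < w mod n" "w mod n < n" using wD insert.prems(3) by auto
          have gg: "0 < g mod n" "g mod n < n" using g insert.prems(3) by auto
          have gk: "g mod n \<noteq> k"
          proof
            assume "g mod n = k"
            then have "(w mod n + k - k) mod n = 0" using wg by (metis mod_diff_left_eq diff_self mod_0)
            then show False using w by simp
          qed
          then have gE: "g mod n \<in> D - insert k A" using g by auto
          then have "k < g mod n" using insert.prems(6) by blast
          have "w mod n + g mod n = n + k"
          proof (cases "w mod n + g mod n < n")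
            case True
            then have "w mod n + g mod n = k" using wg w gg by simp
            then show ?thesis using \<open>k < g mod n\<close> w by linarith
          next
            case False
            have "(w mod n + g mod n - n) mod n = w mod n + g mod n - n"
              using False w gg by (intro mod_pos_pos_trivial) linarith+
            then show ?thesis using wg by simp
          qed
          then have "k < w mod n" using gg by linarith
          then have "w mod n \<in> D - insert k A" using wD insert.hyps(2) by auto
          then show ?thesis using gE u v t by (blast intro: homog_gen.gen homog_gen.brac)
        qed
      qed
      then show "N \<inter> Y i \<union> {br u v |u v w g. u \<in> Y w \<and> v \<in> Y g \<and> g mod n \<in> D - A \<and> (w + g) mod n = i mod n}
        \<subseteq> {z. (i, z) \<in> homog_gen Y (D - insert k A) N}"
        by (auto intro: homog_gen.null)
    qed
    ultimately show ?thesis by blast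
  qed
  have "x \<in> (der ^^ s) ?V i" using insert.prems(7) unfolding card funpow_add by simp
  then have "(i, x) \<in> homog_gen ?V (D - A) N"
    by (intro IH graded_dern Y dern_subset)
  then show ?case
  proof induction
    case (gen x i)
    show ?case
    proof (cases "i mod n = k")
      case True then show ?thesis using main gen by blast
    next
      case False
      then show ?thesis using gen dern_subset[OF Y] by (blast intro: homog_gen.gen)
    qed
  qed (use dern_subset[OF Y] in \<open>blast intro: homog_gen.intros\<close>)+
qed

text \<open>The case \<open>E = D\<close> of the elimination: nothing is left to generate with.\<close>

theorem kreknin_shalev:
  assumes "graded Y" "rel_ideal Y N" "D \<subseteq> {1..<n}" "\<And>i. i mod n \<notin> D \<Longrightarrow> Y i \<subseteq> N"
  shows "(der ^^ (2 ^ card D - 1)) Y i \<subseteq> N"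
proof
  fix x assume "x \<in> (der ^^ (2 ^ card D - 1)) Y i"
  then have "(i, x) \<in> homog_gen Y (D - D) N"
    using assms by (intro kreknin_elimination) (auto intro: finite_subset)
  then show "x \<in> N" using homog_gen_empty assms by auto
qed

end

section \<open>Dependent sequences of weights\<close>

lemma adjacent_swap_induct:
  assumes swap: "\<And>as x y bs. P (as @ x # y # bs) \<Longrightarrow> P (as @ y # x # bs)"
    and "mset xs = mset ys" and "P xs"
  shows "P ys"
proof -
  have front: "P (zs @ as @ y # bs) \<Longrightarrow> P (zs @ y # as @ bs)" for zs as y bs
  proof (induction as arbitrary: bs rule: rev_induct)
    case (snoc a as)
    have "P ((zs @ as) @ y # a # bs)" by (rule swap) (use snoc.prems in simp)
    then show ?case using snoc.IH[of "a # bs"] by simp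
  qed simp
  have "P (zs @ xs) \<Longrightarrow> P (zs @ ys)" for zs
    using assms(2)
  proof (induction ys arbitrary: xs zs)
    case (Cons y ys)
    then have "y \<in> set xs" by (metis list.set_intros(1) set_mset_mset)
    then obtain as bs where xs: "xs = as @ y # bs" by (meson split_list)
    have "P ((zs @ [y]) @ as @ bs)" using front[of zs as y bs] Cons.prems(1) xs by simp
    then have "P ((zs @ [y]) @ ys)" by (rule Cons.IH) (use Cons.prems xs in simp)
    then show ?case by simp
  qed simp
  from this[of "[]"] show ?thesis using assms(3) by simp
qed

text \<open>Multiplying \<open>A v\<close> by the adjugate of \<open>A\<close> gives \<open>det A \<cdot> v\<close>. So \<open>m = |det A|\<close> works for all
  moduli \<open>n\<close> at once, and the Leibniz formula bounds it.\<close>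

lemma nonsingular_integer_system:
  fixes k :: "'h \<Rightarrow> 'h \<Rightarrow> int"
  assumes "finite H" and bound: "\<And>x y. x \<in> H \<Longrightarrow> y \<in> H \<Longrightarrow> \<bar>k x y\<bar> \<le> B"
    and inj: "\<And>u. (\<And>x. x \<in> H \<Longrightarrow> (\<Sum>y\<in>H. k x y * u y) = 0) \<Longrightarrow> (\<And>x. x \<in> H \<Longrightarrow> u x = 0)"
  shows "\<exists>m. 0 < m \<and> m \<le> fact (card H) * B ^ card H \<and>
    (\<forall>n v. (\<forall>x\<in>H. n dvd (\<Sum>y\<in>H. k x y * v y)) \<longrightarrow> (\<forall>x\<in>H. n dvd m * v x))"
proof -
  define q where "q = card H"
  obtain g where g: "bij_betw g {0..<q} H"
    using ex_bij_betw_nat_finite[OF assms(1)] q_def by auto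
  define A where "A = mat q q (\<lambda>(i, j). k (g i) (g j))"
  have A: "A \<in> carrier_mat q q" by (simp add: A_def)
  have gH: "i < q \<Longrightarrow> g i \<in> H" for i using g by (auto simp: bij_betw_def)
  have mult: "(A *\<^sub>v vec q (\<lambda>j. v (g j))) $ i = (\<Sum>y\<in>H. k (g i) y * v y)" if "i < q" for i v
  proof -
    have "(A *\<^sub>v vec q (\<lambda>j. v (g j))) $ i = (\<Sum>j = 0..<q. k (g i) (g j) * v (g j))"
      using that by (simp add: A_def scalar_prod_def)
    also have "\<dots> = (\<Sum>y\<in>H. k (g i) y * v y)"
      by (rule sum.reindex_bij_betw[OF g])
    finally show ?thesis .
  qed
  have "det A \<noteq> 0"
  proof
    assume "det A = 0"
    then obtain w where w: "w \<in> carrier_vec q" "w \<noteq> 0\<^sub>v q" "A *\<^sub>v w = 0\<^sub>v q"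
      using det_0_iff_vec_prod_zero[OF A] by auto
    define u where "u y = w $ (the_inv_into {0..<q} g y)" for y
    have ug: "u (g j) = w $ j" if "j < q" for j
      using that g by (simp add: u_def bij_betw_def the_inv_into_f_f)
    have wu: "w = vec q (\<lambda>j. u (g j))" using w(1) ug by (intro eq_vecI) auto
    have "u x = 0" if "x \<in> H" for x
    proof (rule inj[OF _ that])
      fix x assume "x \<in> H"
      then obtain i where i: "i < q" "g i = x" using g by (auto simp: bij_betw_def)
      have "(A *\<^sub>v vec q (\<lambda>j. u (g j))) $ i = 0" using w(3) i(1) by (simp flip: wu)
      then show "(\<Sum>y\<in>H. k x y * u y) = 0" using mult[OF i(1), of u] i(2) by simp
    qed
    then have "w = 0\<^sub>v q" using gH w(1) by (subst wu) (auto intro: eq_vecI)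
    then show False using w by simp
  qed
  moreover have "\<bar>det A\<bar> \<le> fact q * B ^ q"
  proof -
    have "\<bar>det A\<bar> \<le> (\<Sum>p\<in>{p. p permutes {0..<q}}. \<bar>signof p * (\<Prod>i = 0..<q. A $$ (i, p i))\<bar>)"
      unfolding det_def'[OF A] by (rule sum_abs)
    also have "\<dots> \<le> (\<Sum>p\<in>{p. p permutes {0..<q}}. B ^ q)"
    proof (rule sum_mono)
      fix p assume "p \<in> {p. p permutes {0..<q}}"
      then have p: "i < q \<Longrightarrow> p i < q" for i
        using permutes_in_image[of p "{0..<q}" i] by auto
      have "\<bar>signof p * (\<Prod>i = 0..<q. A $$ (i, p i))\<bar> = (\<Prod>i = 0..<q. \<bar>A $$ (i, p i)\<bar>)"
        by (simp add: abs_mult abs_prod sign_def)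
      also have "\<dots> \<le> (\<Prod>i = 0..<q. B)"
        by (rule prod_mono) (auto simp: A_def p gH bound)
      finally show "\<bar>signof p * (\<Prod>i = 0..<q. A $$ (i, p i))\<bar> \<le> B ^ q" by simp
    qed
    also have "\<dots> = fact q * B ^ q" by (simp add: card_permutations[of _ q])
    finally show ?thesis by simp
  qed
  moreover have "n dvd \<bar>det A\<bar> * v x" if v: "\<forall>x\<in>H. n dvd (\<Sum>y\<in>H. k x y * v y)" and x: "x \<in> H" for n v x
  proof -
    define w where "w = vec q (\<lambda>j. v (g j))"
    have w: "w \<in> carrier_vec q" by (simp add: w_def)
    obtain i where i: "i < q" "g i = x" using g x by (auto simp: bij_betw_def)
    have "adj_mat A *\<^sub>v (A *\<^sub>v w) = (adj_mat A * A) *\<^sub>v w"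
      using adj_mat(1)[OF A] w A by simp
    also have "\<dots> = det A \<cdot>\<^sub>v w"
      unfolding adj_mat(3)[OF A] using w by auto
    finally have "det A \<cdot>\<^sub>v w = adj_mat A *\<^sub>v (A *\<^sub>v w)" by simp
    then have "det A * v x = (adj_mat A *\<^sub>v (A *\<^sub>v w)) $ i"
      using i by (metis index_smult_vec(1) index_vec w_def dim_vec)
    also have "\<dots> = (\<Sum>j = 0..<q. adj_mat A $$ (i, j) * (A *\<^sub>v w) $ j)"
      using i adj_mat(1)[OF A] A by (auto simp: scalar_prod_def intro!: sum.cong)
    also have "n dvd \<dots>"
    proof (rule dvd_sum)
      fix j assume "j \<in> {0..<q}"
      then have "(A *\<^sub>v w) $ j = (\<Sum>y\<in>H. k (g j) y * v y)" "g j \<in> H"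
        using mult[of j v] gH[of j] by (auto simp: w_def)
      then have "n dvd (A *\<^sub>v w) $ j" using v by simp
      then show "n dvd adj_mat A $$ (i, j) * (A *\<^sub>v w) $ j" by (rule dvd_mult)
    qed
    finally show ?thesis by (simp add: abs_if)
  qed
  ultimately show ?thesis unfolding q_def[symmetric]
    by (intro exI[of _ "\<bar>det A\<bar>"]) auto
qed

text \<open>The action of the complement on the kernel, identified with the integers modulo \<open>n\<close>: \<open>h\<close> acts as
  multiplication by \<open>rho h\<close>, and \<open>rho_coprime\<close> says that it fixes no non-zero residue, not even after passing to a quotient of
  the kernel.\<close>

locale frobenius_weights = HG: group HG for HG :: "'h monoid" +
  fixes rho :: "'h \<Rightarrow> int" and n :: int
  assumes n_pos: "n > 0"
    and finite_H: "finite (carrier HG)"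
    and rho_one: "[rho \<one>\<^bsub>HG\<^esub> = 1] (mod n)"
    and rho_mult: "g \<in> carrier HG \<Longrightarrow> h \<in> carrier HG \<Longrightarrow> [rho (g \<otimes>\<^bsub>HG\<^esub> h) = rho g * rho h] (mod n)"
    and rho_coprime: "h \<in> carrier HG \<Longrightarrow> h \<noteq> \<one>\<^bsub>HG\<^esub> \<Longrightarrow> coprime (rho h - 1) n"
begin

abbreviation "H \<equiv> carrier HG"
abbreviation "q \<equiv> card H"

lemma rho_cancel:
  assumes "h \<in> H" "h \<noteq> \<one>\<^bsub>HG\<^esub>" "n dvd (rho h - 1) * a"
  shows "n dvd a"
  using rho_coprime[OF assms(1,2)] assms(3) by (metis coprime_commute coprime_dvd_mult_right_iff)

lemma rho_pow: "h \<in> H \<Longrightarrow> [rho (h [^]\<^bsub>HG\<^esub> (s::nat)) = rho h ^ s] (mod n)"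
proof (induction s)
  case (Suc s)
  have "[rho (h [^]\<^bsub>HG\<^esub> s \<otimes>\<^bsub>HG\<^esub> h) = rho (h [^]\<^bsub>HG\<^esub> s) * rho h] (mod n)"
    by (rule rho_mult) (use Suc in auto)
  also have "[rho (h [^]\<^bsub>HG\<^esub> s) * rho h = rho h ^ s * rho h] (mod n)"
    by (intro cong_mult Suc cong_refl)
  finally show ?case by (simp add: mult.commute)
qed (use rho_one in auto)

lemma q_pos: "q > 0" using finite_H HG.one_closed card_gt_0_iff by blast

text \<open>Some non-trivial choice of group elements, one for each entry, leaves the sum unchanged.\<close>

definition dependent :: "int list \<Rightarrow> bool"
  where "dependent as \<longleftrightarrow> (\<exists>ps. map snd ps = as \<and> fst ` set ps \<subseteq> H \<and> (\<exists>p\<in>set ps. fst p \<noteq> \<one>\<^bsub>HG\<^esub>)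
    \<and> [(\<Sum>(h, a)\<leftarrow>ps. rho h * a) = sum_list as] (mod n))"

lemma dependent_mset:
  assumes "mset as = mset bs" "dependent as"
  shows "dependent bs"
proof (rule adjacent_swap_induct[where P = dependent, OF _ assms])
  fix as x y bs assume "dependent (as @ x # y # bs)"
  then obtain ps where ps: "map snd ps = as @ x # y # bs" "fst ` set ps \<subseteq> H"
    "\<exists>p\<in>set ps. fst p \<noteq> \<one>\<^bsub>HG\<^esub>" "[(\<Sum>(h, a)\<leftarrow>ps. rho h * a) = sum_list (as @ x # y # bs)] (mod n)"
    unfolding dependent_def by auto
  from ps(1) obtain p1 a b p2 where *: "ps = p1 @ a # b # p2" "map snd p1 = as" "snd a = x" "snd b = y"
    "map snd p2 = bs"
    by (auto simp: map_eq_append_conv)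
  show "dependent (as @ y # x # bs)"
    unfolding dependent_def
    by (rule exI[of _ "p1 @ b # a # p2"]) (use ps * in \<open>auto simp: add_ac\<close>)
qed

lemma independent_singleton:
  assumes "\<not> n dvd a" shows "\<not> dependent [a]"
proof
  assume "dependent [a]"
  then obtain h where "h \<in> H" "h \<noteq> \<one>\<^bsub>HG\<^esub>" "[rho h * a = a] (mod n)"
    by (auto simp: dependent_def map_eq_Cons_conv)
  then have "n dvd (rho h - 1) * a" by (simp add: cong_iff_dvd_diff algebra_simps)
  then show False using rho_cancel assms \<open>h \<in> H\<close> \<open>h \<noteq> \<one>\<^bsub>HG\<^esub>\<close> by blast
qed

text \<open>The entry \<open>j\<close> can be recovered from the word of group elements that witnesses the dependence: the
  element \<open>h\<close> at \<open>j\<close> is non-trivial, as \<open>as\<close> is independent, so the relation determines \<open>(rho h - 1) j\<close>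
  and with it \<open>j\<close> modulo \<open>n\<close>. There are \<open>q ^ Suc (length as)\<close> words.\<close>

lemma card_dependent_extensions:
  assumes "\<not> dependent as"
  shows "card {j \<in> {0..<n}. dependent (as @ [j])} \<le> q ^ Suc (length as)"
proof -
  let ?D = "{j \<in> {0..<n}. dependent (as @ [j])}"
  let ?L = "{hs. set hs \<subseteq> H \<and> length hs = Suc (length as)}"
  have "\<exists>f. \<forall>j\<in>?D. map snd (f j) = as @ [j] \<and> fst ` set (f j) \<subseteq> H \<and> (\<exists>p\<in>set (f j). fst p \<noteq> \<one>\<^bsub>HG\<^esub>)
    \<and> [(\<Sum>(h, a)\<leftarrow>f j. rho h * a) = sum_list (as @ [j])] (mod n)"
    by (rule bchoice) (auto simp: dependent_def)
  then obtain f where f: "\<And>j. j \<in> ?D \<Longrightarrow> map snd (f j) = as @ [j] \<and> fst ` set (f j) \<subseteq> H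
      \<and> (\<exists>p\<in>set (f j). fst p \<noteq> \<one>\<^bsub>HG\<^esub>)
      \<and> [(\<Sum>(h, a)\<leftarrow>f j. rho h * a) = sum_list (as @ [j])] (mod n)"
    by blast
  have *: "\<exists>ps h. f j = ps @ [(h, j)] \<and> map snd ps = as \<and> h \<in> H \<and> h \<noteq> \<one>\<^bsub>HG\<^esub>
      \<and> [(\<Sum>(h, a)\<leftarrow>ps. rho h * a) + rho h * j = sum_list as + j] (mod n)" if j: "j \<in> ?D" for j
  proof -
    from f[OF j] obtain ps h where ps: "f j = ps @ [(h, j)]" "map snd ps = as"
      by (auto simp: map_eq_append_conv map_eq_Cons_conv)
    have c: "[(\<Sum>(h, a)\<leftarrow>ps. rho h * a) + rho h * j = sum_list as + j] (mod n)" using f[OF j] ps by simp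
    have "h \<noteq> \<one>\<^bsub>HG\<^esub>"
    proof
      assume h: "h = \<one>\<^bsub>HG\<^esub>"
      have "[rho h * j = 1 * j] (mod n)" unfolding h by (intro cong_mult rho_one cong_refl)
      from cong_diff[OF c this] have "[(\<Sum>(h, a)\<leftarrow>ps. rho h * a) = sum_list as] (mod n)" by simp
      then have "dependent as" unfolding dependent_def
        using f[OF j] ps h by (intro exI[of _ ps]) auto
      then show False using assms by simp
    qed
    moreover have "h \<in> H" using f[OF j] ps by auto
    ultimately show ?thesis using ps c by blast
  qed
  have "inj_on (\<lambda>j. map fst (f j)) ?D"
  proof (rule inj_onI)
    fix j j' assume j: "j \<in> ?D" and j': "j' \<in> ?D" and eq: "map fst (f j) = map fst (f j')"
    obtain ps h where a: "f j = ps @ [(h, j)]" "map snd ps = as" "h \<in> H" "h \<noteq> \<one>\<^bsub>HG\<^esub>"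
      "[(\<Sum>(h, a)\<leftarrow>ps. rho h * a) + rho h * j = sum_list as + j] (mod n)" using *[OF j] by blast
    obtain ps' h' where b: "f j' = ps' @ [(h', j')]" "map snd ps' = as"
      "[(\<Sum>(h, a)\<leftarrow>ps'. rho h * a) + rho h' * j' = sum_list as + j'] (mod n)" using *[OF j'] by blast
    have hh: "h' = h" and "map fst ps = map fst ps'" using eq a b by auto
    then have pp: "ps' = ps" using a(2) b(2) by (metis zip_map_fst_snd)
    have "[rho h * j - rho h * j' = j - j'] (mod n)"
      using cong_diff[OF a(5) b(3)[unfolded hh pp]] by simp
    then have "n dvd (rho h - 1) * (j - j')" by (simp add: cong_iff_dvd_diff algebra_simps)
    then have "n dvd j - j'" using rho_cancel a by blast
    then have "j mod n = j' mod n" by (simp add: mod_eq_dvd_iff)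
    then show "j = j'" using j j' by auto
  qed
  moreover have "(\<lambda>j. map fst (f j)) ` ?D \<subseteq> ?L"
  proof clarify
    fix j assume "j \<in> {0..<n}" "dependent (as @ [j])"
    then have j: "j \<in> ?D" by simp
    have "length (f j) = Suc (length as)" using f[OF j] by (metis length_append_singleton length_map)
    then show "set (map fst (f j)) \<subseteq> H \<and> length (map fst (f j)) = Suc (length as)" using f[OF j] by auto
  qed
  ultimately have "card ?D \<le> card ?L"
    by (rule card_inj_on_le) (use finite_lists_length_eq[OF finite_H] in auto)
  then show ?thesis using card_lists_length_eq[OF finite_H] by simp
qed

lemma bij_mult_right: "h \<in> H \<Longrightarrow> bij_betw (\<lambda>g. g \<otimes>\<^bsub>HG\<^esub> h) H H"
proof (rule bij_betw_byWitness[where f' = "\<lambda>g. g \<otimes>\<^bsub>HG\<^esub> inv\<^bsub>HG\<^esub> h"])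
qed (auto simp: HG.m_assoc)

definition order_bound :: "nat \<Rightarrow> int"
  where "order_bound c = fact q * (2 * int c + int q) ^ q"

text \<open>The equation says that \<open>u\<close> is annihilated by the sum of the operators \<open>T u(g) = \<Sum>\<^sub>h (u(g) - u(gh))\<close> and
  \<open>Q u(g) = \<Sum>\<^sub>s u(g h1^s)\<close>. Both are non-negative: \<open>\<langle>u, T u\<rangle>\<close> is half the sum of all \<open>(u(g) - u(gh))\<^sup>2\<close>, and
  \<open>q \<langle>u, Q u\<rangle> = \<langle>Q u, Q u\<rangle>\<close>. So both expressions vanish. The first gives \<open>u(g h1) = u(g)\<close>, whence \<open>Q u = q u\<close>,
  and the second gives \<open>Q u = 0\<close>.\<close>

lemma harmonic_rigidity:
  fixes u :: "'h \<Rightarrow> int"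
  assumes hs: "set hs \<subseteq> H" and h1: "h1 \<in> set hs"
    and eq: "\<And>g. g \<in> H \<Longrightarrow> int (length hs) * u g - (\<Sum>h\<leftarrow>hs. u (g \<otimes>\<^bsub>HG\<^esub> h))
        + (\<Sum>s<q. u (g \<otimes>\<^bsub>HG\<^esub> h1 [^]\<^bsub>HG\<^esub> s)) = 0"
    and g: "g \<in> H"
  shows "u g = 0"
proof -
  have h1H: "h1 \<in> H" using hs h1 by auto
  define E where "E h = (\<Sum>g\<in>H. (u g - u (g \<otimes>\<^bsub>HG\<^esub> h))\<^sup>2)" for h
  define A where "A g = (\<Sum>s<q. u (g \<otimes>\<^bsub>HG\<^esub> h1 [^]\<^bsub>HG\<^esub> s))" for g
  have E0: "E h \<ge> 0" for h by (simp add: E_def sum_nonneg)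
  have E: "E h = 2 * (\<Sum>g\<in>H. u g * (u g - u (g \<otimes>\<^bsub>HG\<^esub> h)))" if "h \<in> H" for h
  proof -
    have "(\<Sum>g\<in>H. (u (g \<otimes>\<^bsub>HG\<^esub> h))\<^sup>2) = (\<Sum>g\<in>H. (u g)\<^sup>2)"
      by (rule sum.reindex_bij_betw[OF bij_mult_right[OF that], of "\<lambda>g. (u g)\<^sup>2"])
    then show ?thesis unfolding E_def
      by (simp add: power2_diff sum.distrib sum_subtractf algebra_simps power2_eq_square sum_distrib_left)
  qed
  have A1: "A (g \<otimes>\<^bsub>HG\<^esub> h1) = A g" if "g \<in> H" for g
  proof -
    have e: "g \<otimes>\<^bsub>HG\<^esub> h1 \<otimes>\<^bsub>HG\<^esub> h1 [^]\<^bsub>HG\<^esub> s = g \<otimes>\<^bsub>HG\<^esub> h1 [^]\<^bsub>HG\<^esub> Suc s" for s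
      using that h1H HG.nat_pow_Suc2[of h1 s] by (simp add: HG.m_assoc)
    have "A (g \<otimes>\<^bsub>HG\<^esub> h1) = (\<Sum>s<q. u (g \<otimes>\<^bsub>HG\<^esub> h1 [^]\<^bsub>HG\<^esub> Suc s))" unfolding A_def e ..
    also have "\<dots> = (\<Sum>s<Suc q. u (g \<otimes>\<^bsub>HG\<^esub> h1 [^]\<^bsub>HG\<^esub> s)) - u g"
      using that by (subst sum.lessThan_Suc_shift) simp
    also have "h1 [^]\<^bsub>HG\<^esub> q = \<one>\<^bsub>HG\<^esub>" using HG.pow_order_eq_1[OF h1H] by (simp add: Coset.order_def)
    then have "(\<Sum>s<Suc q. u (g \<otimes>\<^bsub>HG\<^esub> h1 [^]\<^bsub>HG\<^esub> s)) - u g = A g" using that by (simp add: A_def)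
    finally show ?thesis .
  qed
  have As: "A (g \<otimes>\<^bsub>HG\<^esub> h1 [^]\<^bsub>HG\<^esub> s) = A g" if "g \<in> H" for g and s :: nat
    using that
  proof (induction s)
    case (Suc s)
    then show ?case using A1[of "g \<otimes>\<^bsub>HG\<^esub> h1 [^]\<^bsub>HG\<^esub> s"] h1H by (simp add: HG.m_assoc)
  qed simp
  have "(\<Sum>g\<in>H. (A g)\<^sup>2) = (\<Sum>g\<in>H. \<Sum>s<q. A g * u (g \<otimes>\<^bsub>HG\<^esub> h1 [^]\<^bsub>HG\<^esub> s))"
    by (simp add: A_def power2_eq_square sum_distrib_left)
  also have "\<dots> = (\<Sum>s<q. \<Sum>g\<in>H. A (g \<otimes>\<^bsub>HG\<^esub> h1 [^]\<^bsub>HG\<^esub> s) * u (g \<otimes>\<^bsub>HG\<^esub> h1 [^]\<^bsub>HG\<^esub> s))"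
    by (subst sum.swap) (simp add: As)
  also have "\<dots> = (\<Sum>s<q. \<Sum>g\<in>H. A g * u g)"
    using sum.reindex_bij_betw[OF bij_mult_right, of _ "\<lambda>g. A g * u g"] h1H by simp
  finally have AA: "(\<Sum>g\<in>H. (A g)\<^sup>2) = int q * (\<Sum>g\<in>H. A g * u g)" by simp
  have "(\<Sum>g\<in>H. A g * u g) * int q \<ge> 0" using AA sum_nonneg[of H "\<lambda>g. (A g)\<^sup>2"] by (simp add: mult.commute)
  then have Apos: "(\<Sum>g\<in>H. A g * u g) \<ge> 0" using q_pos by (simp add: zero_le_mult_iff)
  have "0 = (\<Sum>g\<in>H. u g * (int (length hs) * u g - (\<Sum>h\<leftarrow>hs. u (g \<otimes>\<^bsub>HG\<^esub> h)) + A g))"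
    using eq by (simp add: A_def)
  also have "\<dots> = (\<Sum>g\<in>H. (\<Sum>h\<leftarrow>hs. u g * (u g - u (g \<otimes>\<^bsub>HG\<^esub> h)))) + (\<Sum>g\<in>H. A g * u g)"
  proof -
    have "u g * (int (length hs) * u g - (\<Sum>h\<leftarrow>hs. u (g \<otimes>\<^bsub>HG\<^esub> h))) = (\<Sum>h\<leftarrow>hs. u g * (u g - u (g \<otimes>\<^bsub>HG\<^esub> h)))" for g
      by (induction hs) (auto simp: algebra_simps)
    then show ?thesis by (simp only: distrib_left sum.distrib mult.commute[of "A _"])
  qed
  also have "(\<Sum>g\<in>H. (\<Sum>h\<leftarrow>hs. u g * (u g - u (g \<otimes>\<^bsub>HG\<^esub> h)))) = (\<Sum>h\<leftarrow>hs. \<Sum>g\<in>H. u g * (u g - u (g \<otimes>\<^bsub>HG\<^esub> h)))"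
    by (induction hs) (auto simp: sum.distrib)
  finally have "(\<Sum>h\<leftarrow>hs. \<Sum>g\<in>H. u g * (u g - u (g \<otimes>\<^bsub>HG\<^esub> h))) + (\<Sum>g\<in>H. A g * u g) = 0" by simp
  moreover have "2 * (\<Sum>h\<leftarrow>hs. \<Sum>g\<in>H. u g * (u g - u (g \<otimes>\<^bsub>HG\<^esub> h))) = (\<Sum>h\<leftarrow>hs. E h)"
    using hs by (induction hs) (auto simp: E)
  moreover have Esum: "E h1 \<le> (\<Sum>h\<leftarrow>hs. E h)"
  proof -
    have nn: "0 \<le> (\<Sum>h\<leftarrow>xs. E h)" for xs by (induction xs) (auto simp: E0)
    from h1 show ?thesis
    proof (induction hs)
      case (Cons h hs)
      then show ?case using nn[of hs] E0[of h] by (cases "h = h1") auto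
    qed simp
  qed
  ultimately have "E h1 = 0" "(\<Sum>g\<in>H. A g * u g) = 0" using E0[of h1] Apos by linarith+
  then have u1: "u (g \<otimes>\<^bsub>HG\<^esub> h1) = u g" if "g \<in> H" for g
    using that finite_H by (auto simp: E_def sum_nonneg_eq_0_iff)
  have us: "u (g \<otimes>\<^bsub>HG\<^esub> h1 [^]\<^bsub>HG\<^esub> s) = u g" for s :: nat
  proof (induction s)
    case (Suc s)
    then show ?case using u1[of "g \<otimes>\<^bsub>HG\<^esub> h1 [^]\<^bsub>HG\<^esub> s"] h1H g by (simp add: HG.m_assoc)
  qed (use g in simp)
  have "(\<Sum>g\<in>H. (A g)\<^sup>2) = 0" using AA \<open>(\<Sum>g\<in>H. A g * u g) = 0\<close> by simp
  then have "A g = 0" using g finite_H by (auto simp: sum_nonneg_eq_0_iff)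
  then show ?thesis using us q_pos by (simp add: A_def)
qed

text \<open>The relation \<open>(\<Sum> rho h\<^sub>i) b = c b\<close> says that the operator \<open>T\<close> above annihilates the vector \<open>y \<mapsto> rho y * b\<close>
  modulo \<open>n\<close>. So does \<open>Q\<close>, for \<open>h1\<close> one of the non-trivial \<open>h\<^sub>i\<close>: the sum of the powers of \<open>rho h1\<close> is \<open>0\<close>
  modulo \<open>n\<close>, since \<open>rho h1 - 1\<close> can be cancelled. As \<open>T + Q\<close> is non-singular over the integers, with entries
  bounded in terms of \<open>c\<close> and \<open>q\<close>, its determinant annihilates \<open>b\<close>.\<close>

lemma order_bounded_if_dependent:
  assumes "dependent (replicate c b)"
  shows "\<exists>m. 0 < m \<and> m \<le> order_bound c \<and> n dvd m * b"
proof -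
  obtain ps where ps: "map snd ps = replicate c b" "fst ` set ps \<subseteq> H" "\<exists>p\<in>set ps. fst p \<noteq> \<one>\<^bsub>HG\<^esub>"
    "[(\<Sum>(h, a)\<leftarrow>ps. rho h * a) = sum_list (replicate c b)] (mod n)"
    using assms by (auto simp: dependent_def)
  define hs where "hs = map fst ps"
  have len: "length hs = c" using ps(1) by (metis hs_def length_map length_replicate)
  have hs: "set hs \<subseteq> H" using ps(2) by (simp add: hs_def)
  obtain h1 where h1: "h1 \<in> set hs" "h1 \<noteq> \<one>\<^bsub>HG\<^esub>" using ps(3) by (auto simp: hs_def)
  have h1H: "h1 \<in> H" using hs h1 by auto
  have "\<forall>p\<in>set ps. snd p = b" using ps(1) by (metis in_set_replicate list.set_map imageI)
  then have "(\<Sum>(h, a)\<leftarrow>ps. rho h * a) = (\<Sum>h\<leftarrow>hs. rho h) * b"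
    unfolding hs_def by (induction ps) (auto simp: algebra_simps)
  then have hb: "[(\<Sum>h\<leftarrow>hs. rho h) * b = int c * b] (mod n)" using ps(4) by (simp add: sum_list_replicate)
  \<comment> \<open>The matrix of \<open>T + Q\<close>. The operator \<open>T\<close> alone is singular: it annihilates constants.\<close>
  define k :: "'h \<Rightarrow> 'h \<Rightarrow> int" where "k x y = int c * of_bool (x = y)
    - (\<Sum>h\<leftarrow>hs. of_bool (x \<otimes>\<^bsub>HG\<^esub> h = y)) + (\<Sum>s<q. of_bool (x \<otimes>\<^bsub>HG\<^esub> h1 [^]\<^bsub>HG\<^esub> s = y))" for x y
  have k: "(\<Sum>y\<in>H. k x y * u y) = int c * u x - (\<Sum>h\<leftarrow>hs. u (x \<otimes>\<^bsub>HG\<^esub> h)) + (\<Sum>s<q. u (x \<otimes>\<^bsub>HG\<^esub> h1 [^]\<^bsub>HG\<^esub> s))"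
    if x: "x \<in> H" for x and u :: "'h \<Rightarrow> int"
  proof -
    have d: "(\<Sum>y\<in>H. of_bool (z = y) * u y) = u z" if "z \<in> H" for z
      using that finite_H by (simp add: of_bool_def if_distrib[of "\<lambda>t. t * _"] cong: if_cong)
    have "(\<Sum>y\<in>H. k x y * u y) = int c * (\<Sum>y\<in>H. of_bool (x = y) * u y)
      - (\<Sum>y\<in>H. (\<Sum>h\<leftarrow>hs. of_bool (x \<otimes>\<^bsub>HG\<^esub> h = y)) * u y) + (\<Sum>y\<in>H. (\<Sum>s<q. of_bool (x \<otimes>\<^bsub>HG\<^esub> h1 [^]\<^bsub>HG\<^esub> s = y)) * u y)"
      by (simp add: k_def algebra_simps sum.distrib sum_subtractf sum_distrib_left)
    also have "(\<Sum>y\<in>H. (\<Sum>h\<leftarrow>hs. of_bool (x \<otimes>\<^bsub>HG\<^esub> h = y)) * u y) = (\<Sum>h\<leftarrow>hs. u (x \<otimes>\<^bsub>HG\<^esub> h))"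
      using hs
    proof (induction hs)
      case (Cons h hs)
      then show ?case using d[of "x \<otimes>\<^bsub>HG\<^esub> h"] x by (simp add: distrib_right sum.distrib)
    qed simp
    also have "(\<Sum>y\<in>H. (\<Sum>s<q. of_bool (x \<otimes>\<^bsub>HG\<^esub> h1 [^]\<^bsub>HG\<^esub> s = y)) * u y) = (\<Sum>s<q. u (x \<otimes>\<^bsub>HG\<^esub> h1 [^]\<^bsub>HG\<^esub> s))"
      unfolding sum_distrib_right by (subst sum.swap) (use d x h1H in simp)
    finally show ?thesis using d[OF x] by simp
  qed
  have bound: "\<bar>k x y\<bar> \<le> 2 * int c + int q" for x y
  proof -
    have 1: "\<bar>\<Sum>h\<leftarrow>hs. of_bool (x \<otimes>\<^bsub>HG\<^esub> h = y)\<bar> \<le> int c"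
      unfolding len[symmetric] by (induction hs) auto
    have "\<bar>\<Sum>s<q. (of_bool (x \<otimes>\<^bsub>HG\<^esub> h1 [^]\<^bsub>HG\<^esub> s = y) :: int)\<bar> \<le> (\<Sum>s<q. 1)"
      by (rule order_trans[OF sum_abs sum_mono]) auto
    then have 2: "\<bar>\<Sum>s<q. (of_bool (x \<otimes>\<^bsub>HG\<^esub> h1 [^]\<^bsub>HG\<^esub> s = y) :: int)\<bar> \<le> int q" by simp
    have 3: "\<bar>int c * of_bool (x = y)\<bar> \<le> int c" by auto
    show ?thesis unfolding k_def using 1 2 3 by linarith
  qed
  have inj: "u x = 0" if "\<And>x. x \<in> H \<Longrightarrow> (\<Sum>y\<in>H. k x y * u y) = 0" "x \<in> H" for u x
    by (rule harmonic_rigidity[OF hs h1(1) _ that(2)]) (use that(1) k len in simp)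
  obtain m where m: "0 < m" "m \<le> fact q * (2 * int c + int q) ^ q"
    "\<And>v x. (\<forall>x\<in>H. n dvd (\<Sum>y\<in>H. k x y * v y)) \<Longrightarrow> x \<in> H \<Longrightarrow> n dvd m * v x"
  proof -
    have "\<exists>m. 0 < m \<and> m \<le> fact q * (2 * int c + int q) ^ q \<and>
      (\<forall>n v. (\<forall>x\<in>H. n dvd (\<Sum>y\<in>H. k x y * v y)) \<longrightarrow> (\<forall>x\<in>H. n dvd m * v x))"
      by (rule nonsingular_integer_system[OF finite_H]) (rule bound, use inj in blast)
    then show ?thesis using that by blast
  qed
  have geo: "n dvd (\<Sum>s<q. rho h1 ^ s)"
  proof (rule rho_cancel[OF h1H h1(2)])
    have "(rho h1 - 1) * (\<Sum>s<q. rho h1 ^ s) = rho h1 ^ q - 1" by (simp add: power_diff_1_eq)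
    moreover have "[rho h1 ^ q = 1] (mod n)"
      using cong_trans[OF cong_sym[OF rho_pow[OF h1H, of q]]] HG.pow_order_eq_1[OF h1H] rho_one
      by (simp add: Coset.order_def)
    ultimately show "n dvd (rho h1 - 1) * (\<Sum>s<q. rho h1 ^ s)" by (simp add: cong_iff_dvd_diff)
  qed
  have "n dvd (\<Sum>y\<in>H. k x y * (rho y * b))" if x: "x \<in> H" for x
  proof -
    have "[(\<Sum>h\<leftarrow>hs. rho (x \<otimes>\<^bsub>HG\<^esub> h) * b) = (\<Sum>h\<leftarrow>hs. rho x * rho h * b)] (mod n)"
      using hs by (induction hs) (auto intro!: cong_add cong_mult rho_mult x)
    also have "(\<Sum>h\<leftarrow>hs. rho x * rho h * b) = rho x * ((\<Sum>h\<leftarrow>hs. rho h) * b)"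
      by (induction hs) (auto simp: algebra_simps)
    also have "[rho x * ((\<Sum>h\<leftarrow>hs. rho h) * b) = rho x * (int c * b)] (mod n)"
      by (intro cong_mult hb cong_refl)
    finally have 1: "[(\<Sum>h\<leftarrow>hs. rho (x \<otimes>\<^bsub>HG\<^esub> h) * b) = int c * (rho x * b)] (mod n)" by (simp add: algebra_simps)
    have "[(\<Sum>s<q. rho (x \<otimes>\<^bsub>HG\<^esub> h1 [^]\<^bsub>HG\<^esub> s) * b) = (\<Sum>s<q. rho x * rho h1 ^ s * b)] (mod n)"
    proof (intro cong_sum cong_mult cong_refl)
      fix s :: nat
      have "[rho (x \<otimes>\<^bsub>HG\<^esub> h1 [^]\<^bsub>HG\<^esub> s) = rho x * rho (h1 [^]\<^bsub>HG\<^esub> s)] (mod n)"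
        by (intro rho_mult x HG.nat_pow_closed h1H)
      also have "[rho x * rho (h1 [^]\<^bsub>HG\<^esub> s) = rho x * rho h1 ^ s] (mod n)"
        by (intro cong_mult cong_refl rho_pow h1H)
      finally show "[rho (x \<otimes>\<^bsub>HG\<^esub> h1 [^]\<^bsub>HG\<^esub> s) = rho x * rho h1 ^ s] (mod n)" .
    qed
    also have "(\<Sum>s<q. rho x * rho h1 ^ s * b) = rho x * b * (\<Sum>s<q. rho h1 ^ s)"
      by (simp add: sum_distrib_left algebra_simps)
    finally have "n dvd (\<Sum>s<q. rho (x \<otimes>\<^bsub>HG\<^esub> h1 [^]\<^bsub>HG\<^esub> s) * b) - rho x * b * (\<Sum>s<q. rho h1 ^ s)"
      by (simp add: cong_iff_dvd_diff)
    then have 2: "n dvd (\<Sum>s<q. rho (x \<otimes>\<^bsub>HG\<^esub> h1 [^]\<^bsub>HG\<^esub> s) * b)" using geo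
      by (meson dvd_diff_commute dvd_mult dvd_diff_right_iff zdvd_zdiffD)
    have "n dvd int c * (rho x * b) - (\<Sum>h\<leftarrow>hs. rho (x \<otimes>\<^bsub>HG\<^esub> h) * b)"
      using 1 by (simp add: cong_iff_dvd_diff dvd_diff_commute)
    then show ?thesis unfolding k[OF x] using 2 by (rule dvd_add)
  qed
  then have "n dvd m * (rho \<one>\<^bsub>HG\<^esub> * b)" using m(3)[of "\<lambda>y. rho y * b" "\<one>\<^bsub>HG\<^esub>"] by blast
  moreover have "[m * (rho \<one>\<^bsub>HG\<^esub> * b) = m * (1 * b)] (mod n)" by (intro cong_mult rho_one cong_refl)
  ultimately have "n dvd m * b" by (metis cong_dvd_iff mult_1)
  then show ?thesis using m by (auto simp: order_bound_def)
qed

end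

section \<open>Solubility\<close>

definition extension_bound :: "nat \<Rightarrow> nat \<Rightarrow> nat"
  where "extension_bound c q = q ^ (c + 1)"

text \<open>Large enough for two purposes: it exceeds the order of any weight \<open>b\<close> whose \<open>c\<close>-fold repetition is
  dependent, and a run of this length contains \<open>extension_bound c q\<close> factors followed by \<open>c\<close> more.\<close>

definition block_bound :: "nat \<Rightarrow> nat \<Rightarrow> nat"
  where "block_bound c q = extension_bound c q + fact q * (2 * c + q) ^ q + c + 1"

lemma ext_le_block: "extension_bound c q + c + 1 \<le> block_bound c q"
  by (simp add: block_bound_def)

definition weight_bound :: "nat \<Rightarrow> nat \<Rightarrow> nat"
  where "weight_bound c q = block_bound c q ^ extension_bound c q"

text \<open>The exponent is squared because the elimination is applied to the differences of the weights that are counted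
  by \<open>weight_bound\<close>.\<close>

primrec derived_bound :: "nat \<Rightarrow> nat \<Rightarrow> nat"
  where
    "derived_bound 0 q = 0"
  | "derived_bound (Suc c) q = Suc (derived_bound c q + 2 ^ (weight_bound (Suc c) q ^ 2))"

lemma sum_list_eq_sum_count_list:
  fixes xs :: "int list"
  assumes "set xs \<subseteq> D" "finite D"
  shows "sum_list xs = (\<Sum>b\<in>D. int (count_list xs b) * b)"
  using assms(1)
proof (induction xs)
  case (Cons x xs)
  have "(\<Sum>b\<in>D. int (count_list (x # xs) b) * b)
    = (\<Sum>b\<in>D. int (count_list xs b) * b + (if b = x then b else 0))"
    by (rule sum.cong) (auto simp: algebra_simps)
  then show ?case using Cons assms(2) by (simp add: sum.distrib)
qed simp

locale frobenius_graded = graded_lie br Z n + frobenius_weights HG rho n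
  for br :: "'a::ab_group_add \<Rightarrow> 'a \<Rightarrow> 'a" and Z n and HG :: "'h monoid" and rho
begin

definition homog :: "(int \<Rightarrow> 'a set) \<Rightarrow> (int \<times> 'a) list \<Rightarrow> bool"
  where "homog Y ps \<longleftrightarrow> (\<forall>p\<in>set ps. fst p \<in> {0..<n} \<and> snd p \<in> Y (fst p))"

abbreviation wt :: "(int \<times> 'a) list \<Rightarrow> int" where "wt ps \<equiv> sum_list (map fst ps)"
abbreviation lc :: "'a \<Rightarrow> (int \<times> 'a) list \<Rightarrow> 'a" where "lc x ps \<equiv> lnc x (map snd ps)"

lemma homog_simps [simp]:
  "homog Y []" "homog Y (p # ps) \<longleftrightarrow> fst p \<in> {0..<n} \<and> snd p \<in> Y (fst p) \<and> homog Y ps"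
  "homog Y (ps @ qs) \<longleftrightarrow> homog Y ps \<and> homog Y qs"
  by (auto simp: homog_def)

lemma homog_mset: "homog Y ps \<Longrightarrow> mset qs = mset ps \<Longrightarrow> homog Y qs"
  unfolding homog_def by (metis set_mset_mset)

lemma homog_mono: "homog Y ps \<Longrightarrow> (\<And>i. Y i \<subseteq> Y' i) \<Longrightarrow> homog Y' ps"
  unfolding homog_def by blast

lemma graded_mod: "graded Y \<Longrightarrow> Y (i mod n) = Y i"
  using gradedD(2)[of Y "i mod n" i] by simp

lemma mod_eqI: "n dvd a - b \<Longrightarrow> a mod n = b mod n" by (simp add: mod_eq_dvd_iff)

lemma mod_range: "i mod n \<in> {0..<n}" using n_pos by simp

lemma lc_mem: "graded Y \<Longrightarrow> x \<in> Y a \<Longrightarrow> homog Y ps \<Longrightarrow> lc x ps \<in> Y (a + wt ps)"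
proof (induction ps arbitrary: x a)
  case (Cons p ps)
  have "br x (snd p) \<in> Y (a + fst p)" using Cons.prems gradedD(3) by auto
  then show ?case using Cons.IH[of "br x (snd p)" "a + fst p"] Cons.prems by (auto simp: add.assoc)
qed simp

lemma lc_ideal: "rel_ideal Y N \<Longrightarrow> x \<in> N \<Longrightarrow> homog Y ps \<Longrightarrow> lc x ps \<in> N"
  by (induction ps arbitrary: x) (auto intro: rel_idealD(3))

lemma lnc_diff: "lnc (x - y) zs = lnc x zs - lnc y zs"
  by (rule lnc_simps)

lemma lc_swap:
  "lnc V (x # y # zs) - lnc V (y # x # zs) - lnc V (br x y # zs) \<in> Z"
proof -
  have "br (br V x) y - br (br V y) x - br V (br x y) \<in> Z"
    using br_leibniz[of V x y] by (simp add: algebra_simps)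
  from lnc_Z[OF this, of zs] show ?thesis by (simp add: lnc_diff)
qed

text \<open>The length is that of \<open>ps\<close>: the commutators have \<open>c + 1\<close> entries.\<close>

definition selective :: "nat \<Rightarrow> (int \<Rightarrow> 'a set) \<Rightarrow> 'a set \<Rightarrow> bool"
  where "selective c Y N \<longleftrightarrow> (\<forall>a x ps. a \<in> {0..<n} \<longrightarrow> x \<in> Y a \<longrightarrow> homog Y ps \<longrightarrow> length ps = c
    \<longrightarrow> \<not> dependent (a # map fst ps) \<longrightarrow> lc x ps \<in> N)"

lemma selectiveD:
  "selective c Y N \<Longrightarrow> a \<in> {0..<n} \<Longrightarrow> x \<in> Y a \<Longrightarrow> homog Y ps \<Longrightarrow> length ps = c
    \<Longrightarrow> \<not> dependent (a # map fst ps) \<Longrightarrow> lc x ps \<in> N"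
  by (auto simp: selective_def)

text \<open>The divisor \<open>m\<close> of \<open>n\<close> is a multiple of the additive order of \<open>b\<close>. It is required to divide \<open>n\<close> because
  later one has to divide by it.\<close>

definition small_order :: "nat \<Rightarrow> int \<Rightarrow> bool"
  where "small_order c b \<longleftrightarrow> (\<exists>m. 0 < m \<and> m \<le> int (block_bound c q) \<and> m dvd n \<and> n dvd m * b)"

lemma small_orderI:
  assumes "0 < m" "m \<le> int (block_bound c q)" "n dvd m * b"
  shows "small_order c b"
proof -
  define k where "k = n div gcd n b"
  have g: "gcd n b > 0" using n_pos by (simp add: gcd_pos_int)
  have nk: "n = k * gcd n b" by (simp add: k_def)
  have "k > 0" using n_pos g nk by (metis zero_less_mult_pos2)
  moreover have "k dvd m"
  proof -
    obtain b' where b': "b = b' * gcd n b" by (metis dvd_div_mult_self gcd_dvd2)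
    have "coprime k b'"
      using g by (metis b' div_gcd_coprime k_def n_pos nonzero_mult_div_cancel_right order_less_irrefl)
    have "k * gcd n b dvd m * b' * gcd n b" using assms(3) nk b' by (metis mult.assoc)
    then have "k dvd m * b'" using g n_pos by auto
    then show ?thesis using \<open>coprime k b'\<close> by (simp add: coprime_dvd_mult_left_iff)
  qed
  then have "k \<le> m" using assms(1) zdvd_imp_le by blast
  moreover have "k dvd n" using nk by (metis dvd_triv_left)
  moreover have "n dvd k * b" using nk by (metis dvd_triv_left gcd_dvd2 mult_dvd_mono dvd_refl)
  ultimately show ?thesis using assms(2) unfolding small_order_def by (intro exI[of _ k]) auto
qed

text \<open>As \<open>b\<close> has large order, \<open>c\<close> copies of \<open>b\<close> are independent, and the weights \<open>a + s b\<close> with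
  \<open>s \<le> extension_bound c q\<close> are distinct. They cannot all be dependent on the \<open>c\<close> copies of \<open>b\<close>, and as
  soon as one is not, the next \<open>c\<close> factors annihilate.\<close>

lemma long_block:
  assumes Y: "graded Y" and N: "rel_ideal Y N" and S: "selective c Y N"
    and b: "\<not> small_order c b" and x: "x \<in> Y a" and ps: "homog Y ps" "\<forall>p\<in>set ps. fst p = b"
    and len: "length ps \<ge> block_bound c q"
  shows "lc x ps \<in> N"
proof -
  have indep: "\<not> dependent (replicate c b)"
  proof
    assume "dependent (replicate c b)"
    then obtain m where "0 < m" "m \<le> order_bound c" "n dvd m * b" using order_bounded_if_dependent by blast
    moreover have "order_bound c \<le> int (block_bound c q)" by (simp add: order_bound_def block_bound_def)
    ultimately show False using small_orderI[of m c b] b by simp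
  qed
  let ?D = "{j \<in> {0..<n}. dependent (replicate c b @ [j])}"
  have cD: "card ?D \<le> extension_bound c q" using card_dependent_extensions[OF indep] by (simp add: extension_bound_def)
  have finD: "finite ?D" by (rule finite_subset[of _ "{0..<n}"]) auto
  have "\<exists>s\<in>{0..extension_bound c q}. (a + int s * b) mod n \<notin> ?D"
  proof (rule ccontr)
    assume "\<not> ?thesis"
    then have sub: "(\<lambda>s. (a + int s * b) mod n) ` {0..extension_bound c q} \<subseteq> ?D" by blast
    have inj: "s \<ge> t" if "(a + int s * b) mod n = (a + int t * b) mod n" "s \<le> extension_bound c q" "t \<le> extension_bound c q" for s t
    proof (rule ccontr)
      assume "\<not> s \<ge> t"
      then have st: "0 < int t - int s" "int t - int s \<le> int (block_bound c q)"
        using that ext_le_block[of c q] by linarith+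
      have "n dvd (int t - int s) * b" using that(1)[symmetric] by (simp add: mod_eq_dvd_iff algebra_simps)
      then show False using b small_orderI[OF st] by simp
    qed
    then have "inj_on (\<lambda>s. (a + int s * b) mod n) {0..extension_bound c q}"
      by (intro inj_onI) (metis atLeastAtMost_iff order_antisym)
    then have "card {0..extension_bound c q} \<le> card ?D" using sub finD card_inj_on_le by blast
    then show False using cD by simp
  qed
  then obtain s where s: "s \<le> extension_bound c q" "(a + int s * b) mod n \<notin> ?D" by auto
  define p1 p2 p3 where "p1 = take s ps" "p2 = take c (drop s ps)" "p3 = drop c (drop s ps)"
  have pps: "ps = p1 @ p2 @ p3" unfolding p1_p2_p3_def by (simp only: append_take_drop_id)
  have l: "length p1 = s" "length p2 = c" using len s by (auto simp: p1_p2_p3_def block_bound_def)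
  have h: "homog Y p1" "homog Y p2" "homog Y p3" using ps(1) pps by auto
  have fs: "map fst p = replicate (length p) b" if "\<forall>z\<in>set p. fst z = b" for p :: "(int \<times> 'a) list"
    using that by (induction p) auto
  have f1: "map fst p1 = replicate s b" "map fst p2 = replicate c b"
    using fs[of p1] fs[of p2] ps(2) pps l by auto
  have "lc x p1 \<in> Y (a + int s * b)" using lc_mem[OF Y x h(1)] f1 by (simp add: sum_list_replicate)
  then have u: "lc x p1 \<in> Y ((a + int s * b) mod n)" by (simp add: graded_mod[OF Y])
  have "\<not> dependent ((a + int s * b) mod n # replicate c b)"
    using s(2) mod_range dependent_mset[of "(a + int s * b) mod n # replicate c b" "replicate c b @ [(a + int s * b) mod n]"]
    by auto
  then have "lc (lc x p1) p2 \<in> N" using selectiveD[OF S mod_range u h(2) l(2)] f1 by simp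
  then have "lc (lc (lc x p1) p2) p3 \<in> N" using lc_ideal[OF N _ h(3)] by blast
  then show ?thesis by (simp add: pps)
qed

text \<open>Among the commutators \<open>[U, m\<^sub>1, \<dots>, m\<^sub>s]\<close> of a given weight that do not lie in \<open>N\<close>, take one with \<open>s\<close> minimal. Swapping
  two neighbours changes it by a shorter commutator, with entry \<open>[m\<^sub>i, m\<^sub>i\<^sub>+\<^sub>1]\<close>, of the same weight, which lies in \<open>N\<close>; so
  the entries can be permuted freely. Every entry can therefore be moved next to \<open>U\<close>, which shows that its weight lies in
  \<open>D\<close>, and all entries of a weight \<open>b\<close> can be collected in one block, which shows that there are few of them
  if \<open>b\<close> has large order. If \<open>b\<close> has small order, their number matters only modulo
  that order. So the total weight is given by a function from \<open>D\<close> to the numbers below \<open>block_bound c q\<close>.\<close>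

lemma few_weights:
  assumes Y: "graded Y" and N: "rel_ideal Y N"
    and D: "D \<subseteq> {0..<n}" "card D \<le> extension_bound c q"
    and kill: "\<And>j x. j \<in> {0..<n} - D \<Longrightarrow> x \<in> Y j \<Longrightarrow> br U x \<in> N"
    and block: "\<And>b a x ps. b \<in> D \<Longrightarrow> \<not> small_order c b \<Longrightarrow> x \<in> Y a \<Longrightarrow> homog Y ps \<Longrightarrow> \<forall>p\<in>set ps. fst p = b
        \<Longrightarrow> length ps \<ge> block_bound c q \<Longrightarrow> lc x ps \<in> N"
    and U: "U \<in> Y d"
  shows "\<exists>W. finite W \<and> card W \<le> weight_bound c q \<and>
    (\<forall>ps. homog Y ps \<longrightarrow> lc U ps \<notin> N \<longrightarrow> (d + wt ps) mod n \<in> W)"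
proof -
  let ?K = "block_bound c q"
  have K: "?K \<ge> 1" by (simp add: block_bound_def)
  have finD: "finite D" using D(1) finite_subset by blast
  define W where "W = (\<lambda>k. (d + (\<Sum>b\<in>D. int (k b) * b)) mod n) ` (D \<rightarrow>\<^sub>E {..<?K})"
  have "finite W" using finD by (simp add: W_def finite_PiE)
  moreover have "card W \<le> weight_bound c q"
  proof -
    have "card W \<le> card (D \<rightarrow>\<^sub>E {..<?K})" unfolding W_def by (intro card_image_le finite_PiE finD) simp
    also have "\<dots> = ?K ^ card D" by (simp add: card_PiE finD)
    also have "\<dots> \<le> ?K ^ extension_bound c q" using K D(2) by (intro power_increasing) auto
    finally show ?thesis by (simp add: weight_bound_def)
  qed
  moreover have "(d + wt qs) mod n \<in> W" if qs: "homog Y qs" "lc U qs \<notin> N" for qs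
  proof -
    define P where "P s \<longleftrightarrow> (\<exists>ps. length ps = s \<and> homog Y ps \<and> (d + wt ps) mod n = (d + wt qs) mod n \<and> lc U ps \<notin> N)" for s
    define s where "s = (LEAST s. P s)"
    have "P (length qs)" using qs unfolding P_def by blast
    then have Ps: "P s" unfolding s_def by (rule LeastI)
    have least: "t < s \<Longrightarrow> \<not> P t" for t unfolding s_def by (rule not_less_Least)
    \<comment> \<open>Being a shortest commutator of the given weight outside \<open>N\<close> is stable under permutations.\<close>
    define R where "R ps \<longleftrightarrow> length ps = s \<and> homog Y ps \<and> (d + wt ps) mod n = (d + wt qs) mod n \<and> lc U ps \<notin> N" for ps
    obtain ps where ps: "R ps" using Ps by (auto simp: P_def R_def)
    have perm: "R ps'" if "mset ps = mset ps'" for ps'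
      using _ that ps
    proof (rule adjacent_swap_induct)
      fix as x y bs assume R: "R (as @ x # y # bs)"
      let ?V = "lc U as" and ?m = "((fst x + fst y) mod n, br (snd x) (snd y))"
      have hm: "homog Y (as @ ?m # bs)"
        using R mod_range[of "fst x + fst y"] gradedD(3)[OF Y, of "snd x" "fst x" "snd y" "fst y"]
        by (simp add: R_def graded_mod[OF Y])
      have "(d + wt (as @ ?m # bs)) mod n = (d + wt (as @ x # y # bs)) mod n"
      proof (rule mod_eqI)
        have "n dvd (fst x + fst y) mod n - (fst x + fst y)" by (metis mod_mod_trivial mod_eq_dvd_iff)
        then show "n dvd d + wt (as @ ?m # bs) - (d + wt (as @ x # y # bs))" by (simp add: algebra_simps)
      qed
      then have weq: "(d + wt (as @ ?m # bs)) mod n = (d + wt qs) mod n" using R by (simp add: R_def)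
      have "\<not> P (length (as @ ?m # bs))" by (rule least) (use R in \<open>auto simp: R_def\<close>)
      then have "lc U (as @ ?m # bs) \<in> N" unfolding P_def using hm weq by blast
      then have m: "lnc ?V (br (snd x) (snd y) # map snd bs) \<in> N" by simp
      have sw: "lnc ?V (snd x # snd y # map snd bs) - lnc ?V (snd y # snd x # map snd bs)
        - lnc ?V (br (snd x) (snd y) # map snd bs) \<in> N" using lc_swap rel_idealD(2)[OF N] by blast
      have "lc U (as @ y # x # bs) \<notin> N"
      proof
        assume "lc U (as @ y # x # bs) \<in> N"
        then have "lnc ?V (snd y # snd x # map snd bs) \<in> N" by simp
        with sw m have "lnc ?V (snd x # snd y # map snd bs) \<in> N"
          using add_subgroup_cong[OF rel_idealD(1)[OF N]] by blast
        then show False using R by (simp add: R_def)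
      qed
      then show "R (as @ y # x # bs)" using R unfolding R_def by (auto simp: algebra_simps)
    qed
    have inD: "fst p \<in> D" if pin: "p \<in> set ps" for p
    proof (rule ccontr)
      assume p: "fst p \<notin> D"
      obtain as bs where "ps = as @ p # bs" using pin by (meson split_list)
      then have "R (p # as @ bs)" by (intro perm) simp
      moreover from this have "br U (snd p) \<in> N" using kill[of "fst p" "snd p"] p by (auto simp: R_def)
      ultimately show False using lc_ideal[OF N] by (auto simp: R_def)
    qed
    let ?c = "\<lambda>b. count_list (map fst ps) b"
    have large: "?c b < ?K" if b: "b \<in> D" "\<not> small_order c b" for b
    proof (rule ccontr)
      assume ge: "\<not> ?c b < ?K"
      let ?o = "filter (\<lambda>p. fst p \<noteq> b) ps" and ?b = "filter (\<lambda>p. fst p = b) ps"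
      have "R (?o @ ?b)" by (rule perm) (induction ps, auto)
      then have R: "homog Y ?o" "homog Y ?b" "lc (lc U ?o) ?b \<notin> N" by (auto simp: R_def)
      have "length ?b = ?c b" by (induction ps) auto
      then have "lc (lc U ?o) ?b \<in> N"
        using ge by (intro block[OF b lc_mem[OF Y U R(1)] R(2)]) auto
      then show False using R(3) by simp
    qed
    define k where "k b = (if b \<in> D then (if small_order c b then
        (SOME k. k < ?K \<and> [int (?c b) * b = int k * b] (mod n)) else ?c b) else undefined)" for b
    have small: "\<exists>k. k < ?K \<and> [int t * b = int k * b] (mod n)" if sm: "small_order c b" for b t
    proof -
      obtain m where m: "0 < m" "m \<le> int ?K" "n dvd m * b" using sm by (auto simp: small_order_def)
      have "int t * b - (int t mod m) * b = (int t div m) * (m * b)"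
        by (metis add_diff_cancel_right' div_mult_mod_eq left_diff_distrib mult.assoc)
      then have "n dvd int t * b - int (nat (int t mod m)) * b" using m by simp
      moreover have "nat (int t mod m) < ?K" using m pos_mod_bound[of m "int t"] by linarith
      ultimately show ?thesis by (auto simp: cong_iff_dvd_diff)
    qed
    have k: "k b < ?K \<and> [int (?c b) * b = int (k b) * b] (mod n)" if "b \<in> D" for b
      using that large[of b] someI_ex[OF small[of b "?c b"]] by (simp add: k_def)
    have "wt ps = (\<Sum>b\<in>D. int (?c b) * b)"
      by (rule sum_list_eq_sum_count_list[OF _ finD]) (use inD in auto)
    moreover have "[(\<Sum>b\<in>D. int (?c b) * b) = (\<Sum>b\<in>D. int (k b) * b)] (mod n)"
      by (rule cong_sum) (use k in blast)
    ultimately have "(d + wt ps) mod n = (d + (\<Sum>b\<in>D. int (k b) * b)) mod n"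
      by (metis cong_add_lcancel cong_def)
    moreover have "k \<in> D \<rightarrow>\<^sub>E {..<?K}" using k by (auto simp: k_def)
    ultimately have "(d + wt ps) mod n \<in> W" unfolding W_def by blast
    then show ?thesis using ps by (simp add: R_def)
  qed
  ultimately show ?thesis by blast
qed

text \<open>The elements that centralise the ideal generated by \<open>lc u us\<close>, modulo \<open>N\<close>, form an ideal \<open>C\<close>. A component of
  weight \<open>i\<close> lies in \<open>C\<close> unless \<open>i\<close> is the difference of two weights of that ideal. There are boundedly many such
  differences by \<open>few_weights\<close>, so \<open>kreknin_shalev\<close> puts a derived term of bounded index into \<open>C\<close>.\<close>

lemma independent_commutator_centralised:
  assumes Y: "graded Y" and N: "rel_ideal Y N" and Y0: "Y 0 \<subseteq> N" and S: "selective (Suc c) Y N"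
    and a: "a \<in> {0..<n}" "u \<in> Y a" "homog Y us" "length us = c" "\<not> dependent (a # map fst us)"
    and x: "x \<in> (der ^^ (2 ^ (weight_bound (Suc c) q ^ 2))) Y j"
  shows "br (lc u us) x \<in> N"
proof -
  let ?U = "lc u us"
  note sgN = rel_idealD(1)[OF N]
  define D where "D = {j \<in> {0..<n}. dependent ((a # map fst us) @ [j])}"
  have D: "D \<subseteq> {0..<n}" "card D \<le> extension_bound (Suc c) q"
    using card_dependent_extensions[OF a(5)] a(4) by (auto simp: D_def extension_bound_def)
  have U: "?U \<in> Y (a + wt us)" by (rule lc_mem[OF Y a(2,3)])
  have "\<exists>W. finite W \<and> card W \<le> weight_bound (Suc c) q \<and>
    (\<forall>ps. homog Y ps \<longrightarrow> lc ?U ps \<notin> N \<longrightarrow> (a + wt us + wt ps) mod n \<in> W)"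
  proof (rule few_weights[OF Y N D _ _ U])
    fix j x assume "j \<in> {0..<n} - D" "x \<in> Y j"
    then show "br ?U x \<in> N"
      using selectiveD[OF S a(1,2), of "us @ [(j, x)]"] a by (auto simp: D_def)
  qed (rule long_block[OF Y N S])
  then obtain W where W: "finite W" "card W \<le> weight_bound (Suc c) q"
    "\<And>ps. homog Y ps \<Longrightarrow> lc ?U ps \<notin> N \<Longrightarrow> (a + wt us + wt ps) mod n \<in> W" by blast
  define C where "C = {x. \<forall>ps. homog Y ps \<longrightarrow> br (lc ?U ps) x \<in> N}"
  have C: "rel_ideal Y C"
    unfolding rel_ideal_def
  proof (intro conjI allI ballI)
    show "add_subgroup C" using sgN unfolding add_subgroup_def C_def by (auto simp: br_simps)
    show "Z \<subseteq> C" using rel_idealD(2)[OF N] by (auto simp: C_def intro: Z_right)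
    fix i x y assume x: "x \<in> C" and y: "y \<in> Y i"
    show "br x y \<in> C" unfolding C_def
    proof clarify
      fix ps assume ps: "homog Y ps"
      let ?V = "lc ?U ps"
      have 1: "br (br ?V x) y \<in> N" using x ps y rel_idealD(3)[OF N] by (auto simp: C_def)
      have "homog Y (ps @ [(i mod n, y)])" using ps y mod_range by (simp add: graded_mod[OF Y])
      then have 2: "br (br ?V y) x \<in> N" using x unfolding C_def by fastforce
      have "br (br ?V x) y - br (br ?V y) x - br ?V (br x y) \<in> N"
        using br_leibniz[of ?V x y] rel_idealD(2)[OF N] by (auto simp: algebra_simps)
      then show "br ?V (br x y) \<in> N" using 1 2 add_subgroup_cong[OF sgN] add_subgroup_diff[OF sgN] by blast
    qed
  qed
  define E where "E = {i \<in> {1..<n}. \<exists>w\<in>W. \<exists>w'\<in>W. i = (w' - w) mod n}"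
  have cE: "card E \<le> weight_bound (Suc c) q ^ 2"
  proof -
    have "E \<subseteq> (\<lambda>(w, w'). (w' - w) mod n) ` (W \<times> W)" by (auto simp: E_def)
    then have "card E \<le> card (W \<times> W)" using W(1) by (meson card_image_le card_mono finite_SigmaI finite_imageI order_trans)
    also have "\<dots> \<le> weight_bound (Suc c) q ^ 2"
      by (simp add: card_cartesian_product power2_eq_square W(2) mult_mono)
    finally show ?thesis .
  qed
  have supp: "Y i \<subseteq> C" if i: "i mod n \<notin> E" for i
  proof
    fix x assume x: "x \<in> Y i"
    show "x \<in> C" unfolding C_def
    proof clarify
      fix ps assume ps: "homog Y ps"
      let ?V = "lc ?U ps"
      have V: "?V \<in> Y (a + wt us + wt ps)" by (rule lc_mem[OF Y U ps])
      show "br ?V x \<in> N"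
      proof (rule ccontr)
        assume nN: "br ?V x \<notin> N"
        then have "?V \<notin> N" using rel_idealD(3)[OF N _ x] by blast
        then have w: "(a + wt us + wt ps) mod n \<in> W" using W(3)[OF ps] by blast
        have ps': "homog Y (ps @ [(i mod n, x)])" using ps x mod_range by (simp add: graded_mod[OF Y])
        have "lc ?U (ps @ [(i mod n, x)]) \<notin> N" using nN by simp
        then have w': "(a + wt us + wt (ps @ [(i mod n, x)])) mod n \<in> W" using W(3)[OF ps'] by blast
        have "i mod n = ((a + wt us + wt (ps @ [(i mod n, x)])) mod n - (a + wt us + wt ps) mod n) mod n"
          by (simp add: mod_diff_eq)
        moreover have "i mod n \<noteq> 0"
        proof
          assume "i mod n = 0"
          then have "x \<in> N" using x Y0 graded_mod[OF Y, of i] by auto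
          then show False using nN rel_ideal_right[OF N _ V] by blast
        qed
        then have "i mod n \<in> {1..<n}" using mod_range[of i] by auto
        ultimately have "i mod n \<in> E" using w w' unfolding E_def by blast
        then show False using i by simp
      qed
    qed
  qed
  have "(der ^^ (2 ^ card E - 1)) Y j \<subseteq> C"
    by (rule kreknin_shalev[OF Y C _ supp]) (auto simp: E_def)
  moreover have "2 ^ card E - 1 \<le> (2::nat) ^ (weight_bound (Suc c) q ^ 2)"
    using cE by (meson diff_le_self le_trans one_le_numeral power_increasing)
  ultimately have "x \<in> C" using dern_antimono[OF Y] x by blast
  then have "br (lc ?U []) x \<in> N" unfolding C_def using homog_simps(1) by blast
  then show ?thesis by simp
qed

text \<open>Induction on \<open>c\<close>. Let \<open>Y'\<close> be the derived term that centralises the independent commutators with one entry less,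
  and \<open>N'\<close> the result of adding those of \<open>Y'\<close> to \<open>N\<close>. Then \<open>Y'\<close> satisfies the hypothesis for the smaller \<open>c\<close> modulo \<open>N'\<close>, so
  a derived term of \<open>Y'\<close> lies in \<open>N'\<close>; and \<open>N'\<close> is centralised by \<open>Y'\<close> modulo \<open>N\<close>, so the next derived term lies in \<open>N\<close>.\<close>

theorem selective_solvable:
  assumes "graded Y" "rel_ideal Y N" "Y 0 \<subseteq> N" "selective c Y N"
  shows "(der ^^ derived_bound c q) Y i \<subseteq> N"
  using assms
proof (induction c arbitrary: Y N i)
  case 0
  show ?case
  proof
    fix x assume "x \<in> (der ^^ derived_bound 0 q) Y i"
    then have x: "x \<in> Y (i mod n)" by (simp add: graded_mod[OF 0(1)])
    show "x \<in> N"
    proof (cases "i mod n = 0")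
      case True
      then show ?thesis using x 0(3) by auto
    next
      case False
      then have "\<not> dependent [i mod n]" by (intro independent_singleton) (simp add: dvd_eq_mod_eq_0)
      then show ?thesis using selectiveD[OF 0(4) mod_range x, of "[]"] by simp
    qed
  qed
next
  case (Suc c)
  note Y = Suc.prems(1) and N = Suc.prems(2)
  define Y' where "Y' = (der ^^ (2 ^ (weight_bound (Suc c) q ^ 2))) Y"
  have Y': "graded Y'" "\<And>i. Y' i \<subseteq> Y i" using graded_dern[OF Y] dern_subset[OF Y] by (auto simp: Y'_def)
  define T where "T = {lc u us | a u us. a \<in> {0..<n} \<and> u \<in> Y' a \<and> homog Y' us \<and> length us = c
    \<and> \<not> dependent (a # map fst us)}"
  define N' where "N' = add_span (N \<union> T)"
  have kill: "br z y \<in> N" if "z \<in> N'" "y \<in> Y' i" for z y i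
  proof (rule additive_map_span[OF br_left rel_idealD(1)[OF N] _ that(1)[unfolded N'_def]])
    fix z assume "z \<in> N \<union> T"
    then show "br z y \<in> N"
    proof
      assume "z \<in> N" then show ?thesis using rel_idealD(3)[OF N] that(2) Y'(2) by blast
    next
      assume "z \<in> T"
      then obtain a u us where z: "z = lc u us" "a \<in> {0..<n}" "u \<in> Y' a" "homog Y' us" "length us = c"
        "\<not> dependent (a # map fst us)" by (auto simp: T_def)
      show ?thesis unfolding z(1)
        by (rule independent_commutator_centralised[OF Y N Suc.prems(3,4) z(2) _ _ z(5,6)])
          (use z Y'(2) homog_mono[of Y' us Y] that(2) in \<open>auto simp: Y'_def\<close>)
    qed
  qed
  have N': "rel_ideal Y' N'" unfolding rel_ideal_def
  proof (intro conjI allI ballI)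
    show "add_subgroup N'" by (simp add: N'_def add_subgroup_add_span)
    have "N \<subseteq> N'" by (auto simp: N'_def intro: add_span.base)
    then show "Z \<subseteq> N'" using rel_idealD(2)[OF N] by auto
    show "br z y \<in> N'" if "z \<in> N'" "y \<in> Y' i" for i z y
      using kill[OF that] \<open>N \<subseteq> N'\<close> by auto
  qed
  have sub: "(der ^^ derived_bound c q) Y' i \<subseteq> N'" for i
  proof (rule Suc.IH[OF Y'(1) N'])
    show "Y' 0 \<subseteq> N'" using Y'(2) Suc.prems(3) by (auto simp: N'_def intro: add_span.base)
    show "selective c Y' N'" unfolding selective_def N'_def
      by (intro allI impI add_span.base) (auto simp: T_def)
  qed
  have eq: "(der ^^ derived_bound (Suc c) q) Y = der ((der ^^ derived_bound c q) Y')"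
    by (simp add: Y'_def funpow_add)
  show ?case unfolding eq der_def[of "(der ^^ derived_bound c q) Y'"]
  proof (rule add_span_least[OF rel_idealD(1)[OF N]], clarify)
    fix x y a b assume "x \<in> (der ^^ derived_bound c q) Y' a" "y \<in> (der ^^ derived_bound c q) Y' b"
    then show "br x y \<in> N" using sub kill dern_subset[OF Y'(1)] by blast
  qed
qed

end

section \<open>The metabelian case\<close>

definition nmul :: "nat \<Rightarrow> 'a::ab_group_add \<Rightarrow> 'a"
  where "nmul m x = (\<Sum>_<m. x)"

lemma additive_nmul: "additive_map (nmul m)"
  by (simp add: additive_map_def nmul_def sum_subtractf)

lemma nmul_mult: "nmul (m * k) x = nmul m (nmul k x)"
proof -
  have "nmul (a + b) x = nmul a x + nmul b x" for a b
    by (induction a) (simp_all add: nmul_def add_ac)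
  moreover have "nmul (Suc m) x = x + nmul m x" for m and x :: 'a
    by (simp add: nmul_def add.commute)
  ultimately show ?thesis by (induction m) (simp_all add: nmul_def)
qed

lemma nmul_mem: "add_subgroup S \<Longrightarrow> x \<in> S \<Longrightarrow> nmul m x \<in> S"
  by (simp add: nmul_def add_subgroup_sum)

definition words :: "'h set \<Rightarrow> nat \<Rightarrow> 'h list set"
  where "words H k = {hs. set hs \<subseteq> H \<and> length hs = k}"

lemma words_0 [simp]: "words H 0 = {[]}"
  by (auto simp: words_def)

lemma finite_words: "finite H \<Longrightarrow> finite (words H k)"
  by (simp add: words_def finite_lists_length_eq)

lemma sum_words_Suc:
  "(\<Sum>hs\<in>words H (Suc k). F hs) = (\<Sum>h\<in>H. \<Sum>hs\<in>words H k. F (h # hs))"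
proof -
  have "words H (Suc k) = (\<lambda>(h, hs). h # hs) ` (H \<times> words H k)"
    by (auto simp: words_def length_Suc_conv image_iff)
  moreover have "inj_on (\<lambda>(h, hs). h # hs) (H \<times> words H k)" by (auto simp: inj_on_def)
  ultimately show ?thesis
    by (simp add: sum.reindex sum.cartesian_product case_prod_unfold)
qed

lemma pigeonhole_count_list:
  assumes "set xs \<subseteq> B" "finite B" "B \<noteq> {}" "card B * k \<le> length xs"
  shows "\<exists>b\<in>B. k \<le> count_list xs b"
proof (rule ccontr)
  assume "\<not> ?thesis"
  then have "count_list xs b < k" if "b \<in> B" for b using that by (meson not_le)
  then have "(\<Sum>b\<in>B. count_list xs b) < (\<Sum>b\<in>B. k)"
    by (intro sum_strict_mono assms(2,3))
  then show False using assms sum_count_set[of xs B] by simp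
qed

lemma (in lie_ring_mod) lnc_span:
  assumes "add_subgroup S" "\<And>x ys. x \<in> A \<Longrightarrow> set ys \<subseteq> B \<Longrightarrow> length ys = k \<Longrightarrow> lnc x ys \<in> S"
    and "x \<in> add_span A" "set ys \<subseteq> add_span B" "length ys = k"
  shows "lnc x ys \<in> S"
  using assms(2-5)
proof (induction k arbitrary: A x ys)
  case 0
  then show ?case using add_span_least[OF assms(1), of A] by force
next
  case (Suc k)
  then obtain y zs where ys: "ys = y # zs" by (cases ys) auto
  define A' where "A' = {br x y | x y. x \<in> A \<and> y \<in> B}"
  have "br x y \<in> add_span A'"
    by (rule biadditive_span[OF br_left br_right add_subgroup_add_span _ Suc.prems(2), of B])
      (use Suc.prems ys in \<open>auto simp: A'_def intro: add_span.base\<close>)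
  moreover have "lnc x' ys \<in> S" if h: "x' \<in> A'" "set ys \<subseteq> B" "length ys = k" for x' ys
  proof -
    obtain x y where xy: "x' = br x y" "x \<in> A" "y \<in> B" using h(1) by (auto simp: A'_def)
    show ?thesis using Suc.prems(1)[OF xy(2), of "y # ys"] xy h by simp
  qed
  ultimately have "lnc (br x y) zs \<in> S"
    using Suc.IH[of A' "br x y" zs] Suc.prems ys by auto
  then show ?case by (simp add: ys)
qed

lemma (in lie_ring_mod) lnc_cong:
  assumes "x - x' \<in> Z" "list_all2 (\<lambda>y y'. y - y' \<in> Z) ys ys'"
  shows "lnc x ys - lnc x' ys' \<in> Z"
  using assms(2,1)
proof (induction arbitrary: x x' rule: list_all2_induct)
  case (Cons y ys y' ys')
  have "br (x - x') y + br x' (y - y') \<in> Z"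
    by (intro add_subgroup_add Z_subgroup Z_left Z_right Cons)
  then show ?case using Cons.IH by (simp add: br_simps)
qed simp

lemma (in lie_ring_mod) lnc_sum_expand:
  "lnc x (map (\<lambda>v. \<Sum>h\<in>H. f h v) vs) = (\<Sum>hs\<in>words H (length vs). lnc x (map2 f hs vs))"
proof (induction vs arbitrary: x)
  case (Cons v vs)
  have "lnc x (map (\<lambda>v. \<Sum>h\<in>H. f h v) (v # vs)) = (\<Sum>h\<in>H. lnc (br x (f h v)) (map (\<lambda>v. \<Sum>h\<in>H. f h v) vs))"
    by (simp add: additive_map_sum[OF br_right] additive_map_sum[OF lnc_additive])
  then show ?case by (simp add: Cons.IH sum_words_Suc)
qed simp

text \<open>The situation after adjoining a root of unity \<open>\<omega>\<close>: \<open>om i\<close> is multiplication by \<open>\<omega>^i\<close>, the family \<open>L\<close> consists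
  of the eigenspaces of the kernel, and \<open>homogeneous_identity\<close> is what remains of the nilpotency of the fixed points
  of the complement. By \<open>om_cancel\<close>, \<open>\<omega>\<close> behaves like a primitive \<open>n\<close>-th root of unity in a field whose characteristic
  does not divide \<open>n\<close>.\<close>

locale frobenius_action = frobenius_graded br Z n HG rho
  for br :: "'a::ab_group_add \<Rightarrow> 'a \<Rightarrow> 'a" and Z n and HG :: "'h monoid" and rho +
  fixes act :: "'h \<Rightarrow> 'a \<Rightarrow> 'a" and om :: "int \<Rightarrow> 'a \<Rightarrow> 'a" and L :: "int \<Rightarrow> 'a set" and c :: nat
  assumes act_additive: "h \<in> H \<Longrightarrow> additive_map (act h)"
    and act_br: "h \<in> H \<Longrightarrow> act h (br x y) = br (act h x) (act h y)"
    and act_one: "act \<one>\<^bsub>HG\<^esub> x - x \<in> Z"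
    and act_L: "h \<in> H \<Longrightarrow> x \<in> L i \<Longrightarrow> act h x \<in> L (rho h * i)"
    and om_additive: "additive_map (om i)"
    and om_br_left: "br (om i x) y = om i (br x y)"
    and om_br_right: "br x (om i y) = om i (br x y)"
    and om_Z: "x \<in> Z \<Longrightarrow> om i x \<in> Z"
    and om_zero: "om 0 x = x"
    and om_add: "om (i + j) x = om i (om j x)"
    and om_n: "n dvd i \<Longrightarrow> om i x - x \<in> Z"
    and om_cancel: "\<not> n dvd i \<Longrightarrow> om i x - x \<in> Z \<Longrightarrow> x \<in> Z"
    and om_L: "x \<in> L i \<Longrightarrow> om j x \<in> L i"
    and graded_L: "graded L"
    and L_zero: "L 0 \<subseteq> Z"
    and L_divisible: "x \<in> L i \<Longrightarrow> \<exists>y\<in>L i. x - nmul (nat n) y \<in> Z"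
    and homogeneous_identity:
      "x \<in> L a \<Longrightarrow> homog L ps \<Longrightarrow> length ps = c \<Longrightarrow>
        (\<Sum>(h, hs)\<in>{(h, hs). h \<in> H \<and> hs \<in> words H c \<and>
            [rho h * a + (\<Sum>(h, p)\<leftarrow>zip hs ps. rho h * fst p) = w] (mod n)}.
          lnc (act h x) (map2 (\<lambda>h p. act h (snd p)) hs ps)) \<in> Z"
begin

lemma rel_ideal_Z: "rel_ideal Y Z"
  by (auto simp: rel_ideal_def Z_subgroup intro: Z_left)

lemma om_cong: "[i = j] (mod n) \<Longrightarrow> om i x - om j x \<in> Z"
  using om_n[of "i - j" "om j x"] om_add[of "i - j" j x] by (simp add: cong_iff_dvd_diff)

text \<open>If the weights are independent, then the homogeneous identity in weight \<open>a + wt ps\<close> has only one summand, the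
  commutator itself.\<close>

lemma selective_L: "selective c L Z"
  unfolding selective_def
proof (intro allI impI)
  fix a x ps assume a: "a \<in> {0..<n}" and x: "x \<in> L a" and ps: "homog L ps" "length ps = c"
    and indep: "\<not> dependent (a # map fst ps)"
  let ?S = "{(h, hs). h \<in> H \<and> hs \<in> words H c \<and>
            [rho h * a + (\<Sum>(h, p)\<leftarrow>zip hs ps. rho h * fst p) = a + wt ps] (mod n)}"
  let ?e = "(\<one>\<^bsub>HG\<^esub>, replicate c \<one>\<^bsub>HG\<^esub>)"
  have ones: "[(\<Sum>(h, p)\<leftarrow>zip (replicate (length ps) \<one>\<^bsub>HG\<^esub>) ps. rho h * fst p) = wt ps] (mod n)" for ps :: "(int \<times> 'a) list"
  proof (induction ps)
    case (Cons p ps)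
    have "[rho \<one>\<^bsub>HG\<^esub> * fst p = 1 * fst p] (mod n)" by (intro cong_mult rho_one cong_refl)
    from cong_add[OF this Cons] show ?case by simp
  qed simp
  have "?S = {?e}"
  proof
    have "[rho \<one>\<^bsub>HG\<^esub> * a = 1 * a] (mod n)" by (intro cong_mult rho_one cong_refl)
    from cong_add[OF this ones[of ps]] show "{?e} \<subseteq> ?S" using ps(2) by (auto simp: words_def)
    show "?S \<subseteq> {?e}"
    proof clarify
      fix h hs assume h: "h \<in> H" "hs \<in> words H c"
        and e: "[rho h * a + (\<Sum>(h, p)\<leftarrow>zip hs ps. rho h * fst p) = a + wt ps] (mod n)"
      let ?ps = "zip (h # hs) (a # map fst ps)"
      have len: "length hs = c" "set hs \<subseteq> H" using h(2) by (auto simp: words_def)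
      have f1: "map snd ?ps = a # map fst ps" using len ps(2) by simp
      have f2: "fst ` set ?ps \<subseteq> H" using len h(1) by (auto dest: set_zip_leftD)
      have f3: "(\<Sum>(h, a)\<leftarrow>?ps. rho h * a) = rho h * a + (\<Sum>(h, p)\<leftarrow>zip hs ps. rho h * fst p)"
        by (simp add: zip_map2 case_prod_unfold comp_def)
      have "\<forall>p\<in>set ?ps. fst p = \<one>\<^bsub>HG\<^esub>"
      proof (rule ccontr)
        assume "\<not> ?thesis"
        then have "\<exists>p\<in>set ?ps. fst p \<noteq> \<one>\<^bsub>HG\<^esub>" by blast
        moreover have "[(\<Sum>(h, a)\<leftarrow>?ps. rho h * a) = sum_list (a # map fst ps)] (mod n)"
          unfolding f3 using e by simp
        ultimately have "dependent (a # map fst ps)"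
          unfolding dependent_def by (intro exI[of _ ?ps] conjI f1 f2)
        then show False using indep by simp
      qed
      then have "\<forall>g\<in>set (map fst ?ps). g = \<one>\<^bsub>HG\<^esub>" by auto
      then have "\<forall>g\<in>set (h # hs). g = \<one>\<^bsub>HG\<^esub>" using len ps(2) by simp
      then show "h = \<one>\<^bsub>HG\<^esub> \<and> hs = replicate c \<one>\<^bsub>HG\<^esub>" using len by (auto intro: replicate_eqI)
    qed
  qed
  then have 1: "lnc (act \<one>\<^bsub>HG\<^esub> x) (map2 (\<lambda>h p. act h (snd p)) (replicate c \<one>\<^bsub>HG\<^esub>) ps) \<in> Z"
    using homogeneous_identity[OF x ps, of "a + wt ps"] by simp
  have "lnc (act \<one>\<^bsub>HG\<^esub> x) (map2 (\<lambda>h p. act h (snd p)) (replicate c \<one>\<^bsub>HG\<^esub>) ps) - lc x ps \<in> Z"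
    by (rule lnc_cong[OF act_one]) (auto simp: list_all2_conv_all_nth ps(2) act_one)
  then show "lc x ps \<in> Z" using 1 add_subgroup_cong[OF Z_subgroup] by blast
qed

text \<open>The properties shared by \<open>L\<close> and its derived terms on which the metabelian argument relies.\<close>

definition stable :: "(int \<Rightarrow> 'a set) \<Rightarrow> bool"
  where "stable Y \<longleftrightarrow> graded Y \<and> (\<forall>i. Y i \<subseteq> L i) \<and> (\<forall>h\<in>H. \<forall>i. \<forall>y\<in>Y i. act h y \<in> Y (rho h * i))
    \<and> (\<forall>i j. \<forall>y\<in>Y i. om j y \<in> Y i) \<and> (\<forall>i. \<forall>y\<in>Y i. \<exists>z\<in>Y i. y - nmul (nat n) z \<in> Z)"

lemma stableD:
  assumes "stable Y"
  shows "graded Y" "Y i \<subseteq> L i" "h \<in> H \<Longrightarrow> y \<in> Y i \<Longrightarrow> act h y \<in> Y (rho h * i)"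
    "y \<in> Y i \<Longrightarrow> om j y \<in> Y i" "y \<in> Y i \<Longrightarrow> \<exists>z\<in>Y i. y - nmul (nat n) z \<in> Z"
  using assms unfolding stable_def by blast+

lemma stable_L: "stable L"
  unfolding stable_def by (simp add: graded_L act_L om_L L_divisible)

lemma stable_zero: "stable Y \<Longrightarrow> n dvd i \<Longrightarrow> Y i \<subseteq> Z"
  using stableD(2)[of Y 0] stableD(1)[of Y] L_zero gradedD(2)[of Y i 0] by (auto simp: dvd_eq_mod_eq_0)

lemma stable_der:
  assumes Y: "stable Y" shows "stable (der Y)"
  unfolding stable_def
proof (intro conjI allI ballI)
  note Yg = stableD(1)[OF Y]
  show g: "graded (der Y)" by (rule graded_der[OF Yg])
  show "der Y i \<subseteq> L i" for i using der_subset[OF Yg] stableD(2)[OF Y] by blast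
  note sg = gradedD(1)[OF g]
  show "act h y \<in> der Y (rho h * i)" if h: "h \<in> H" and y: "y \<in> der Y i" for h i y
  proof (rule additive_map_span[OF act_additive[OF h] sg _ y[unfolded der_def]], clarify)
    fix u v a b assume uv: "u \<in> Y a" "v \<in> Y b" "(a + b) mod n = i mod n"
    show "act h (br u v) \<in> der Y (rho h * i)" unfolding act_br[OF h]
    proof (rule der_br[where Y = Y, OF stableD(3)[OF Y h uv(1)] stableD(3)[OF Y h uv(2)]])
      show "(rho h * a + rho h * b) mod n = rho h * i mod n"
        using uv(3) by (metis distrib_left mod_mult_right_eq)
    qed
  qed
  show "om j y \<in> der Y i" if y: "y \<in> der Y i" for i j y
  proof (rule additive_map_span[OF om_additive sg _ y[unfolded der_def]], clarify)
    fix u v a b assume uv: "u \<in> Y a" "v \<in> Y b" "(a + b) mod n = i mod n"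
    show "om j (br u v) \<in> der Y i" unfolding om_br_left[symmetric]
      by (rule der_br[where Y = Y, OF stableD(4)[OF Y uv(1)] uv(2,3)])
  qed
  show "\<exists>z\<in>der Y i. y - nmul (nat n) z \<in> Z" if y: "y \<in> der Y i" for i y
    using y[unfolded der_def]
  proof induction
    case zero
    show ?case using add_subgroup_zero[OF sg] add_subgroup_zero[OF Z_subgroup]
      by (intro bexI[of _ 0]) (auto simp: additive_map_simps[OF additive_nmul])
  next
    case (base x)
    then obtain u v a b where x: "x = br u v" and uv: "u \<in> Y a" "v \<in> Y b" "(a + b) mod n = i mod n" by auto
    obtain z where z: "z \<in> Y a" "u - nmul (nat n) z \<in> Z" using stableD(5)[OF Y uv(1)] by blast
    have "x - nmul (nat n) (br z v) = br (u - nmul (nat n) z) v"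
      by (simp add: x br_simps nmul_def additive_map_sum[OF br_left])
    then show ?case using Z_left[OF z(2)] der_br[OF z(1) uv(2,3)] by metis
  next
    case (diff x y)
    then obtain z w where zw: "z \<in> der Y i" "x - nmul (nat n) z \<in> Z" "w \<in> der Y i" "y - nmul (nat n) w \<in> Z" by blast
    have "x - y - nmul (nat n) (z - w) = (x - nmul (nat n) z) - (y - nmul (nat n) w)"
      by (simp add: additive_map_simps(1)[OF additive_nmul])
    also have "\<dots> \<in> Z" by (intro add_subgroup_diff Z_subgroup zw)
    finally show ?case using add_subgroup_diff[OF sg zw(1,3)] by blast
  qed
qed

definition tot :: "(int \<Rightarrow> 'a set) \<Rightarrow> 'a set"
  where "tot Y = add_span (\<Union>i. Y i)"

lemma tot_base: "y \<in> Y i \<Longrightarrow> y \<in> tot Y"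
  unfolding tot_def by (rule add_span.base) blast

lemma tot_subgroup: "add_subgroup (tot Y)"
  by (simp add: tot_def add_subgroup_add_span)

lemma tot_mono: "(\<And>i. Y i \<subseteq> Y' i) \<Longrightarrow> tot Y \<subseteq> tot Y'"
  unfolding tot_def by (rule add_span_mono) blast

definition modulus :: "(int \<Rightarrow> 'a set) \<Rightarrow> 'a set"
  where "modulus Y = add_span (Z \<union> tot Y)"

lemma modulus_subgroup: "add_subgroup (modulus Y)"
  by (simp add: modulus_def add_subgroup_add_span)

lemma modulus_base: "y \<in> Z \<Longrightarrow> y \<in> modulus Y" "y \<in> tot Y \<Longrightarrow> y \<in> modulus Y"
  by (auto simp: modulus_def intro: add_span.base)

lemma tot_br_der: "x \<in> tot Y \<Longrightarrow> y \<in> tot Y \<Longrightarrow> br x y \<in> tot (der Y)"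
  unfolding tot_def[of Y]
  by (rule biadditive_span[OF br_left br_right tot_subgroup, of "\<Union>i. Y i" "\<Union>i. Y i"])
    (auto intro: tot_base der_br)

lemma tot_der_subset: "graded Y \<Longrightarrow> tot (der Y) \<subseteq> tot Y"
  by (intro tot_mono der_subset)

lemma tot_der_ideal: "graded Y \<Longrightarrow> x \<in> tot (der Y) \<Longrightarrow> y \<in> tot Y \<Longrightarrow> br x y \<in> tot (der Y)"
  using tot_br_der tot_der_subset by blast

lemma second_der_ideal:
  assumes Y: "graded Y" and x: "x \<in> modulus (der (der Y))" and y: "y \<in> tot Y"
  shows "br x y \<in> modulus (der (der Y))"
proof -
  note sg = modulus_subgroup[of "der (der Y)"]
  have 1: "br x y \<in> modulus (der (der Y))" if "x \<in> tot (der (der Y))" for x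
  proof (rule additive_map_span[OF br_left sg _ that[unfolded tot_def]])
    fix x assume "x \<in> (\<Union>i. der (der Y) i)"
    then obtain i where xi: "x \<in> der (der Y) i" by blast
    show "br x y \<in> modulus (der (der Y))"
    proof (rule additive_map_span[OF br_left sg _ xi[unfolded der_def[of "der Y"]]], clarify)
      fix u v a b assume uv: "u \<in> der Y a" "v \<in> der Y b"
      then have t: "u \<in> tot (der Y)" "v \<in> tot (der Y)" by (auto intro: tot_base)
      have "br (br u y) v + br u (br v y) \<in> tot (der (der Y))"
        by (intro add_subgroup_add tot_subgroup tot_br_der t tot_der_ideal[OF Y] y)
      moreover have "br (br u v) y - (br (br u y) v + br u (br v y)) \<in> Z" by (rule br_leibniz)
      ultimately show "br (br u v) y \<in> modulus (der (der Y))"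
        using add_subgroup_cong[OF sg] modulus_base by blast
    qed
  qed
  show ?thesis
    by (rule additive_map_span[OF br_left sg _ x[unfolded modulus_def[of "der (der Y)"]]])
      (use 1 in \<open>auto intro: modulus_base Z_left\<close>)
qed

lemma lnc_second_der:
  "graded Y \<Longrightarrow> x \<in> modulus (der (der Y)) \<Longrightarrow> set ys \<subseteq> tot Y \<Longrightarrow> lnc x ys \<in> modulus (der (der Y))"
  by (induction ys arbitrary: x) (auto intro: second_der_ideal)

text \<open>Two neighbouring factors \<open>y\<close>, \<open>z\<close> behind an element of the derived ring may be swapped modulo the second
  derived ring, because \<open>[[x, y], z] - [[x, z], y] = [x, [y, z]]\<close>.\<close>

lemma metabelian_perm:
  assumes Y: "graded Y" and x: "x \<in> tot (der Y)" and "mset ys = mset zs" "set ys \<subseteq> tot Y"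
    and "lnc x ys \<in> modulus (der (der Y))"
  shows "lnc x zs \<in> modulus (der (der Y))"
proof -
  let ?P = "\<lambda>ys. set ys \<subseteq> tot Y \<and> lnc x ys \<in> modulus (der (der Y))"
  note sg = modulus_subgroup[of "der (der Y)"]
  have "?P zs"
  proof (rule adjacent_swap_induct[where P = ?P, OF _ assms(3)])
    fix as u v bs assume P: "?P (as @ u # v # bs)"
    have "set as \<subseteq> tot Y \<Longrightarrow> x \<in> tot (der Y) \<Longrightarrow> lnc x as \<in> tot (der Y)" for x as
      by (induction as arbitrary: x) (auto intro: tot_der_ideal[OF Y])
    then have V: "lnc x as \<in> tot (der Y)" using P x by auto
    have "br (lnc x as) (br u v) \<in> modulus (der (der Y))"
      using P by (intro modulus_base(2) tot_br_der V) auto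
    then have 1: "lnc (lnc x as) (br u v # bs) \<in> modulus (der (der Y))"
      using P lnc_second_der[OF Y] by simp
    have 2: "lnc (lnc x as) (u # v # bs) - lnc (lnc x as) (v # u # bs) - lnc (lnc x as) (br u v # bs)
        \<in> modulus (der (der Y))"
      by (intro modulus_base(1) lc_swap)
    have 3: "lnc (lnc x as) (u # v # bs) \<in> modulus (der (der Y))" using P by simp
    have "lnc (lnc x as) (u # v # bs) - lnc (lnc x as) (v # u # bs) \<in> modulus (der (der Y))"
      using 1 2 add_subgroup_cong[OF sg] by blast
    then have "lnc (lnc x as) (v # u # bs) \<in> modulus (der (der Y))"
      using 3 add_subgroup_cong[OF sg] by blast
    then show "?P (as @ v # u # bs)" using P by simp
  qed (use assms in auto)
  then show ?thesis by simp
qed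

text \<open>An orbit sum twisted by powers of \<open>\<omega>\<close>. The summand at \<open>h = 1\<close> is \<open>v\<close> for every \<open>t\<close>, so that the other
  summands can be removed by summing over \<open>t\<close>.\<close>

definition avg :: "int \<Rightarrow> int \<Rightarrow> 'a \<Rightarrow> 'a"
  where "avg b t v = (\<Sum>h\<in>H. om (t * ((rho h - 1) * b)) (act h v))"

lemma lnc_om:
  "length hs = length vs \<Longrightarrow> lnc x (map2 (\<lambda>h v. om (f h) (act h v)) hs vs)
    = om (\<Sum>h\<leftarrow>hs. f h) (lnc x (map2 act hs vs))"
proof (induction hs vs arbitrary: x rule: list_induct2)
  case Nil
  show ?case by (simp add: om_zero)
next
  case (Cons h hs v vs)
  have "lnc (om i y) ys = om i (lnc y ys)" for i y ys
    by (induction ys arbitrary: y) (auto simp: om_br_left)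
  moreover have "om (sum_list (map f hs)) (om (f h) y) = om (f h) (om (sum_list (map f hs)) y)" for y
    by (simp add: om_add[symmetric] add.commute)
  ultimately show ?case using Cons by (simp add: om_br_right om_add)
qed

text \<open>Expanding the product gives a sum over words \<open>hs\<close> of the commutators \<open>[x, v\<^sub>1^h\<^sub>1, \<dots>, v\<^sub>c^h\<^sub>c]\<close>, where \<open>\<omega>\<close> is raised to a power
  that depends only on \<open>t\<close> and the weight \<open>(\<Sum> rho h\<^sub>i) b\<close>. So the summands can be grouped by weight. Each group is a homogeneous
  component of the orbit identity: since \<open>a\<close> is not a multiple of \<open>b\<close> modulo \<open>n\<close>, terms with \<open>x^h\<close> for \<open>h \<noteq> 1\<close> have other weights.\<close>

lemma block_average_killed:
  assumes x: "x \<in> L a" and vs: "\<And>v. v \<in> set vs \<Longrightarrow> v \<in> L b" "length vs = c" and b: "b \<in> {0..<n}"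
    and sep: "\<And>k. \<not> n dvd a - k * b"
  shows "lnc x (map (avg b t) vs) \<in> Z"
proof -
  let ?F = "\<lambda>hs. lnc x (map2 act hs vs)"
  let ?g = "\<lambda>hs. ((\<Sum>h\<leftarrow>hs. rho h) * b) mod n"
  define ps where "ps = map (Pair b) vs"
  have ps: "homog L ps" "length ps = c" using vs b by (auto simp: ps_def homog_def)
  have inner: "(\<Sum>hs\<in>{hs \<in> words H c. ?g hs = w}. ?F hs) \<in> Z" if w: "w \<in> ?g ` words H c" for w
  proof -
    obtain k where k: "w = (k * b) mod n" using w by auto
    let ?S = "{(h, hs). h \<in> H \<and> hs \<in> words H c \<and>
            [rho h * a + (\<Sum>(h, p)\<leftarrow>zip hs ps. rho h * fst p) = a + w] (mod n)}"
    have z: "(\<Sum>(h, p)\<leftarrow>zip hs ps. rho h * fst p) = (\<Sum>h\<leftarrow>hs. rho h) * b" if "hs \<in> words H c" for hs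
    proof -
      have "length hs = length vs" using that vs(2) by (simp add: words_def)
      then show ?thesis unfolding ps_def by (induction hs vs rule: list_induct2) (auto simp: algebra_simps)
    qed
    have S: "?S = {\<one>\<^bsub>HG\<^esub>} \<times> {hs \<in> words H c. ?g hs = w}"
    proof (intro equalityI subsetI)
      fix s assume "s \<in> ?S"
      then obtain h hs where s: "s = (h, hs)" "h \<in> H" "hs \<in> words H c"
        "[rho h * a + (\<Sum>h\<leftarrow>hs. rho h) * b = a + w] (mod n)" using z by auto
      have "n dvd w - k * b" by (simp add: k mod_eq_dvd_iff[symmetric])
      then have d: "n dvd (rho h - 1) * a - (k - (\<Sum>h\<leftarrow>hs. rho h)) * b"
      proof -
        have "(rho h - 1) * a - (k - (\<Sum>h\<leftarrow>hs. rho h)) * b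
          = (rho h * a + (\<Sum>h\<leftarrow>hs. rho h) * b - (a + w)) + (w - k * b)" by (simp add: algebra_simps)
        then show ?thesis
          using dvd_add[OF s(4)[unfolded cong_iff_dvd_diff] \<open>n dvd w - k * b\<close>] by simp
      qed
      have "h = \<one>\<^bsub>HG\<^esub>"
      proof (rule ccontr)
        assume "h \<noteq> \<one>\<^bsub>HG\<^esub>"
        then have "coprime (rho h - 1) n" using rho_coprime s by blast
        then obtain r where r: "[(rho h - 1) * r = 1] (mod n)" using cong_solve_coprime_int by blast
        let ?k = "k - (\<Sum>h\<leftarrow>hs. rho h)"
        have "n dvd r * ((rho h - 1) * a - ?k * b) - ((rho h - 1) * r - 1) * a"
          using d r by (intro dvd_diff) (auto simp: cong_iff_dvd_diff)
        moreover have "r * ((rho h - 1) * a - ?k * b) - ((rho h - 1) * r - 1) * a = a - (r * ?k) * b"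
          by (simp add: algebra_simps)
        ultimately show False using sep[of "r * ?k"] by simp
      qed
      moreover have "?g hs = w"
      proof -
        have "[rho h * a = 1 * a] (mod n)" unfolding \<open>h = \<one>\<^bsub>HG\<^esub>\<close> by (intro cong_mult rho_one cong_refl)
        from cong_diff[OF s(4) this] have "[(\<Sum>h\<leftarrow>hs. rho h) * b = w] (mod n)" by simp
        then show ?thesis using k by (simp add: cong_def)
      qed
      ultimately show "s \<in> {\<one>\<^bsub>HG\<^esub>} \<times> {hs \<in> words H c. ?g hs = w}" using s by auto
    next
      fix s assume "s \<in> {\<one>\<^bsub>HG\<^esub>} \<times> {hs \<in> words H c. ?g hs = w}"
      then obtain hs where s: "s = (\<one>\<^bsub>HG\<^esub>, hs)" "hs \<in> words H c" "?g hs = w" by auto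
      have "[rho \<one>\<^bsub>HG\<^esub> * a = 1 * a] (mod n)" by (intro cong_mult rho_one cong_refl)
      moreover have "[(\<Sum>h\<leftarrow>hs. rho h) * b = w] (mod n)" using s(3) k by (auto simp: cong_def)
      ultimately have "[rho \<one>\<^bsub>HG\<^esub> * a + (\<Sum>h\<leftarrow>hs. rho h) * b = 1 * a + w] (mod n)" by (rule cong_add)
      then show "s \<in> ?S" using s z by auto
    qed
    have "(\<Sum>(h, hs)\<in>{\<one>\<^bsub>HG\<^esub>} \<times> {hs \<in> words H c. ?g hs = w}.
        lnc (act h x) (map2 (\<lambda>h p. act h (snd p)) hs ps)) \<in> Z"
      using homogeneous_identity[OF x ps, of "a + w"] unfolding S .
    then have "(\<Sum>hs\<in>{hs \<in> words H c. ?g hs = w}. lnc (act \<one>\<^bsub>HG\<^esub> x) (map2 (\<lambda>h p. act h (snd p)) hs ps)) \<in> Z"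
      by (subst (asm) sum.cartesian_product[symmetric]) simp
    moreover have "map2 (\<lambda>h p. act h (snd p)) hs ps = map2 act hs vs" for hs
      by (simp add: ps_def zip_map2 case_prod_unfold comp_def)
    ultimately have 1: "(\<Sum>hs\<in>{hs \<in> words H c. ?g hs = w}. lnc (act \<one>\<^bsub>HG\<^esub> x) (map2 act hs vs)) \<in> Z" by simp
    have "(\<Sum>hs\<in>{hs \<in> words H c. ?g hs = w}. lnc (act \<one>\<^bsub>HG\<^esub> x) (map2 act hs vs))
       - (\<Sum>hs\<in>{hs \<in> words H c. ?g hs = w}. ?F hs) \<in> Z"
      unfolding sum_subtractf[symmetric]
      by (intro add_subgroup_sum[OF Z_subgroup] lnc_cong act_one)
        (auto simp: list_all2_conv_all_nth add_subgroup_zero[OF Z_subgroup])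
    then show ?thesis using 1 add_subgroup_cong[OF Z_subgroup] by blast
  qed
  have summand: "lnc x (map2 (\<lambda>h v. om (t * ((rho h - 1) * b)) (act h v)) hs vs)
      - om (t * (?g hs - int c * b)) (?F hs) \<in> Z" if hs: "hs \<in> words H c" for hs
  proof -
    have "length hs = length vs" using hs vs(2) by (simp add: words_def)
    then have "lnc x (map2 (\<lambda>h v. om (t * ((rho h - 1) * b)) (act h v)) hs vs)
      = om (\<Sum>h\<leftarrow>hs. t * ((rho h - 1) * b)) (?F hs)" by (rule lnc_om)
    moreover have "(\<Sum>h\<leftarrow>hs. t * ((rho h - 1) * b)) = t * ((\<Sum>h\<leftarrow>hs. rho h) * b - int (length hs) * b)"
      by (induction hs) (auto simp: algebra_simps)
    moreover have "[t * ((\<Sum>h\<leftarrow>hs. rho h) * b - int c * b) = t * (?g hs - int c * b)] (mod n)"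
      by (intro cong_mult cong_diff cong_refl) (simp add: cong_def)
    ultimately show ?thesis using om_cong hs by (simp add: words_def)
  qed
  have "(\<Sum>hs\<in>words H c. om (t * (?g hs - int c * b)) (?F hs))
    = (\<Sum>w\<in>?g ` words H c. \<Sum>hs\<in>{hs \<in> words H c. ?g hs = w}. om (t * (?g hs - int c * b)) (?F hs))"
    by (rule sum.image_gen[OF finite_words[OF finite_H]])
  also have "\<dots> = (\<Sum>w\<in>?g ` words H c. om (t * (w - int c * b)) (\<Sum>hs\<in>{hs \<in> words H c. ?g hs = w}. ?F hs))"
    by (intro sum.cong refl) (simp add: additive_map_sum[OF om_additive])
  also have "\<dots> \<in> Z" by (intro add_subgroup_sum[OF Z_subgroup] om_Z inner)
  finally have 2: "(\<Sum>hs\<in>words H c. om (t * (?g hs - int c * b)) (?F hs)) \<in> Z" .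
  have "lnc x (map (avg b t) vs) = (\<Sum>hs\<in>words H c. lnc x (map2 (\<lambda>h v. om (t * ((rho h - 1) * b)) (act h v)) hs vs))"
    using lnc_sum_expand[of x "\<lambda>h v. om (t * ((rho h - 1) * b)) (act h v)" H vs] vs(2) by (simp add: avg_def[abs_def])
  moreover have "(\<Sum>hs\<in>words H c. lnc x (map2 (\<lambda>h v. om (t * ((rho h - 1) * b)) (act h v)) hs vs))
    - (\<Sum>hs\<in>words H c. om (t * (?g hs - int c * b)) (?F hs)) \<in> Z"
    unfolding sum_subtractf[symmetric] by (intro add_subgroup_sum[OF Z_subgroup] summand)
  ultimately show ?thesis using 2 add_subgroup_cong[OF Z_subgroup] by simp
qed

text \<open>For \<open>h \<noteq> 1\<close> the coefficients of \<open>v^h\<close> form the geometric sum of the powers of \<open>\<omega>^((rho h - 1) b)\<close>, an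
  \<open>m\<close>-th root of unity other than \<open>1\<close>, and cancel.\<close>

lemma sum_avg:
  assumes m: "n dvd m * b" "0 < m" and b: "\<not> n dvd b"
  shows "(\<Sum>t<nat m. avg b (int t) v) - nmul (nat m) v \<in> Z"
proof -
  have other: "(\<Sum>t<nat m. om (int t * i) y) \<in> Z" if i: "\<not> n dvd i" "n dvd m * i" for i y
  proof (rule om_cancel[OF i(1)])
    have "om i (\<Sum>t<nat m. om (int t * i) y) = (\<Sum>t<nat m. om (int (Suc t) * i) y)"
      by (simp add: additive_map_sum[OF om_additive] om_add[symmetric] algebra_simps)
    also have "\<dots> - (\<Sum>t<nat m. om (int t * i) y) = om (int (nat m) * i) y - om (int 0 * i) y"
      unfolding sum_subtractf[symmetric] by (rule sum_lessThan_telescope)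
    also have "\<dots> \<in> Z" by (rule om_cong) (use i m in \<open>simp add: cong_iff_dvd_diff\<close>)
    finally show "om i (\<Sum>t<nat m. om (int t * i) y) - (\<Sum>t<nat m. om (int t * i) y) \<in> Z" .
  qed
  have "(\<Sum>t<nat m. avg b (int t) v) = (\<Sum>h\<in>H. \<Sum>t<nat m. om (int t * ((rho h - 1) * b)) (act h v))"
    unfolding avg_def by (rule sum.swap)
  also have "\<dots> = (\<Sum>t<nat m. om (int t * ((rho \<one>\<^bsub>HG\<^esub> - 1) * b)) (act \<one>\<^bsub>HG\<^esub> v))
     + (\<Sum>h\<in>H - {\<one>\<^bsub>HG\<^esub>}. \<Sum>t<nat m. om (int t * ((rho h - 1) * b)) (act h v))"
    using finite_H by (rule sum.remove) simp
  finally have e: "(\<Sum>t<nat m. avg b (int t) v) = \<dots>" .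
  have 1: "(\<Sum>h\<in>H - {\<one>\<^bsub>HG\<^esub>}. \<Sum>t<nat m. om (int t * ((rho h - 1) * b)) (act h v)) \<in> Z"
  proof (rule add_subgroup_sum[OF Z_subgroup], rule other)
    fix h assume h: "h \<in> H - {\<one>\<^bsub>HG\<^esub>}"
    show "\<not> n dvd (rho h - 1) * b" using rho_cancel[of h b] h b by blast
    show "n dvd m * ((rho h - 1) * b)" using m(1) by (metis dvd_mult mult.left_commute)
  qed
  have "om (int t * ((rho \<one>\<^bsub>HG\<^esub> - 1) * b)) (act \<one>\<^bsub>HG\<^esub> v) - v \<in> Z" for t
  proof -
    have "n dvd int t * ((rho \<one>\<^bsub>HG\<^esub> - 1) * b)" using rho_one by (simp add: cong_iff_dvd_diff)
    from add_subgroup_add[OF Z_subgroup om_n[OF this, of "act \<one>\<^bsub>HG\<^esub> v"] act_one[of v]] show ?thesis by simp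
  qed
  then have "(\<Sum>t<nat m. om (int t * ((rho \<one>\<^bsub>HG\<^esub> - 1) * b)) (act \<one>\<^bsub>HG\<^esub> v)) - nmul (nat m) v \<in> Z"
    unfolding nmul_def sum_subtractf[symmetric] by (intro add_subgroup_sum[OF Z_subgroup])
  from add_subgroup_add[OF Z_subgroup this 1] show ?thesis unfolding e by (simp add: algebra_simps)
qed

end

definition metabelian_block_bound :: "nat \<Rightarrow> nat \<Rightarrow> nat"
  where "metabelian_block_bound c q = block_bound c q * (c + 1)"

text \<open>If at most \<open>extension_bound c q + c\<close> weights occur among so many factors, then one of them occurs
  \<open>metabelian_block_bound c q\<close> times.\<close>

definition metabelian_bound :: "nat \<Rightarrow> nat \<Rightarrow> nat"
  where "metabelian_bound c q = metabelian_block_bound c q * (extension_bound c q + c + 1)"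

text \<open>One step leads into the derived ring \<open>Y'\<close>, and \<open>Suc j * T\<close> steps lead from the \<open>j\<close>-th to the next term of the lower central
  series of \<open>Y'\<close>, whose class is bounded by induction.\<close>

primrec class_bound :: "nat \<Rightarrow> nat \<Rightarrow> nat"
  where
    "class_bound T 0 = 0"
  | "class_bound T (Suc s) = Suc (\<Sum>j<class_bound T s. Suc j * T)"

definition nil_bound :: "nat \<Rightarrow> nat \<Rightarrow> nat"
  where "nil_bound c q = class_bound (metabelian_bound c q) (derived_bound c q)"

context frobenius_action
begin

text \<open>Modulo \<open>Z\<close>, every factor is of the form \<open>m v\<close>, which is the sum of the averages \<open>avg b t v\<close> over \<open>t < m\<close>. In
  the resulting products at least \<open>c\<close> averages belong to the same \<open>t\<close>; move them to the front and apply
  \<open>block_average_killed\<close>.\<close>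

lemma metabelian_small_order:
  assumes Y: "stable Y" and x: "x \<in> der Y a" and b: "b \<in> {0..<n}"
    and vs: "\<And>v. v \<in> set vs \<Longrightarrow> v \<in> Y b" and len: "int (length vs) \<ge> m * int c" "vs \<noteq> []"
    and m: "0 < m" "m dvd n" "n dvd m * b" and sep: "\<And>k. \<not> n dvd a - k * b"
  shows "lnc x vs \<in> modulus (der (der Y))"
proof (cases "n dvd b")
  case True
  then obtain v us where "vs = v # us" "v \<in> Z" using len(2) stable_zero[OF Y] vs by (cases vs) auto
  then show ?thesis by (auto intro: modulus_base(1) lnc_Z Z_right)
next
  case nb: False
  note Yg = stableD(1)[OF Y]
  let ?N = "modulus (der (der Y))"
  note sg = modulus_subgroup[of "der (der Y)"]
  have xt: "x \<in> tot (der Y)" using x by (rule tot_base)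
  have xL: "x \<in> L a" using x stableD(2)[OF stable_der[OF Y]] by blast
  have avg_tot: "avg b t v \<in> tot Y" if "v \<in> Y b" for t v
    unfolding avg_def
    by (rule add_subgroup_sum[OF tot_subgroup])
      (use stableD(3,4)[OF Y] that in \<open>blast intro: tot_base\<close>)
  have full: "lnc x (map (\<lambda>(t, v). avg b t v) tv) \<in> ?N"
    if tv: "\<And>t v. (t, v) \<in> set tv \<Longrightarrow> t \<in> {0..<m} \<and> v \<in> Y b" "int (length tv) \<ge> m * int c" for tv
  proof -
    let ?w = "\<lambda>(t, v). avg b t v"
    have "card {0..<m} * c \<le> length (map fst tv)"
    proof -
      have "int (card {0..<m} * c) = m * int c" using m(1) by simp
      then show ?thesis unfolding length_map using tv(2) by linarith
    qed
    then have "\<exists>t\<in>{0..<m}. c \<le> count_list (map fst tv) t"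
      by (intro pigeonhole_count_list) (use tv(1) m(1) in auto)
    then obtain t where t: "c \<le> count_list (map fst tv) t" by blast
    define p1 p2 where "p1 = filter (\<lambda>p. fst p = t) tv" and "p2 = filter (\<lambda>p. fst p \<noteq> t) tv"
    have mset: "mset tv = mset (p1 @ p2)" by (simp add: p1_def p2_def)
    have "length p1 = count_list (map fst tv) t" unfolding p1_def by (induction tv) auto
    then have l1: "c \<le> length p1" using t by simp
    have s: "set p1 \<subseteq> set tv" "set p2 \<subseteq> set tv" by (auto simp: p1_def p2_def)
    have wt: "set (map ?w zs) \<subseteq> tot Y" if "set zs \<subseteq> set tv" for zs
      using that tv(1) avg_tot by auto
    have "map ?w (take c p1) = map (avg b t) (map snd (take c p1))"
      using set_take_subset[of c p1] by (auto simp: p1_def)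
    moreover have "lnc x (map (avg b t) (map snd (take c p1))) \<in> Z"
    proof (rule block_average_killed[OF xL _ _ b sep])
      show "v \<in> L b" if "v \<in> set (map snd (take c p1))" for v
        using that s(1) tv(1) stableD(2)[OF Y] set_take_subset[of c p1] by fastforce
    qed (use l1 in simp)
    ultimately have "lnc x (map ?w (take c p1)) \<in> ?N" by (simp only: modulus_base(1))
    then have "lnc (lnc x (map ?w (take c p1))) (map ?w (drop c p1 @ p2)) \<in> ?N"
      by (rule lnc_second_der[OF Yg]) (use s set_drop_subset[of c p1] in \<open>intro wt, auto\<close>)
    moreover have "map ?w (p1 @ p2) = map ?w (take c p1) @ map ?w (drop c p1 @ p2)"
      by (metis append.assoc append_take_drop_id map_append)
    ultimately have 1: "lnc x (map ?w (p1 @ p2)) \<in> ?N" by simp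
    have 2: "mset (map ?w (p1 @ p2)) = mset (map ?w tv)" by (metis mset mset_map)
    have 3: "set (map ?w (p1 @ p2)) \<subseteq> tot Y" by (rule wt) (use s in simp)
    show ?thesis by (rule metabelian_perm[OF Yg xt 2 3 1])
  qed
  have partial: "lnc x (map (\<lambda>(t, v). avg b t v) tv @ map (nmul (nat m)) us) \<in> ?N"
    if "\<And>t v. (t, v) \<in> set tv \<Longrightarrow> t \<in> {0..<m} \<and> v \<in> Y b" "set us \<subseteq> Y b"
      "int (length tv + length us) \<ge> m * int c" for tv us
    using that
  proof (induction us arbitrary: tv)
    case Nil
    then show ?case using full by simp
  next
    case (Cons u us)
    let ?V = "lnc x (map (\<lambda>(t, v). avg b t v) tv)" and ?us = "map (nmul (nat m)) us"
    have "(\<Sum>t<nat m. lnc (br ?V (avg b (int t) u)) ?us) \<in> ?N"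
    proof (rule add_subgroup_sum[OF sg])
      fix t assume "t \<in> {..<nat m}"
      then have "lnc x (map (\<lambda>(t, v). avg b t v) (tv @ [(int t, u)]) @ ?us) \<in> ?N"
        using Cons.prems by (intro Cons.IH) auto
      then show "lnc (br ?V (avg b (int t) u)) ?us \<in> ?N" by simp
    qed
    then have 1: "lnc (br ?V (\<Sum>t<nat m. avg b (int t) u)) ?us \<in> ?N"
      by (simp add: additive_map_sum[OF br_right] additive_map_sum[OF lnc_additive])
    have "lnc (br ?V ((\<Sum>t<nat m. avg b (int t) u) - nmul (nat m) u)) ?us \<in> ?N"
      by (intro modulus_base(1) lnc_Z Z_right sum_avg m nb)
    then have "lnc (br ?V (\<Sum>t<nat m. avg b (int t) u)) ?us - lnc (br ?V (nmul (nat m) u)) ?us \<in> ?N"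
      by (simp add: br_simps lnc_simps)
    then show ?case using 1 add_subgroup_cong[OF sg] by simp
  qed
  have "\<exists>z\<in>Y b. v - nmul (nat m) z \<in> Z" if v: "v \<in> set vs" for v
  proof -
    obtain z where z: "z \<in> Y b" "v - nmul (nat n) z \<in> Z" using stableD(5)[OF Y vs[OF v]] by blast
    obtain k where k: "n = m * k" using m(2) by blast
    have "k > 0" using k n_pos m(1) by (simp add: zero_less_mult_iff)
    then have "nat n = nat m * nat k" using k m(1) by (simp add: nat_mult_distrib)
    then have "v - nmul (nat m) (nmul (nat k) z) \<in> Z" using z(2) by (simp add: nmul_mult)
    then show ?thesis using nmul_mem[OF gradedD(1)[OF Yg] z(1)] by blast
  qed
  then obtain f where f: "\<And>v. v \<in> set vs \<Longrightarrow> f v \<in> Y b \<and> v - nmul (nat m) (f v) \<in> Z" by metis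
  have "lnc x (map (nmul (nat m)) (map f vs)) \<in> ?N"
    using partial[of "[]" "map f vs"] f len(1) by auto
  moreover have "lnc x vs - lnc x (map (nmul (nat m)) (map f vs)) \<in> Z"
    by (rule lnc_cong) (auto simp: list_all2_conv_all_nth add_subgroup_zero[OF Z_subgroup] f)
  ultimately show ?thesis using add_subgroup_cong[OF sg] modulus_base(1) by blast
qed

text \<open>If \<open>b\<close> has large order, selective nilpotency suffices. Otherwise, if \<open>a\<close> is not a multiple of \<open>b\<close>, averaging
  applies; and if it is, then the weights \<open>a + s b\<close> pass through \<open>0\<close>, where the component is trivial.\<close>

lemma metabelian_block:
  assumes Y: "stable Y" and x: "x \<in> der Y a" and ps: "homog Y ps" "\<forall>p\<in>set ps. fst p = b"
    and len: "length ps \<ge> metabelian_block_bound c q"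
  shows "lc x ps \<in> modulus (der (der Y))"
proof -
  note Yg = stableD(1)[OF Y]
  have len': "length ps \<ge> block_bound c q" using len by (simp add: metabelian_block_bound_def)
  have psL: "homog L ps" using homog_mono[OF ps(1)] stableD(2)[OF Y] by blast
  have xY: "x \<in> Y a" using x der_subset[OF Yg] by blast
  have ne: "ps \<noteq> []" using len' by (auto simp: block_bound_def)
  then have b: "b \<in> {0..<n}" using ps by (cases ps) auto
  show ?thesis
  proof (cases "small_order c b")
    case False
    have "lc x ps \<in> Z"
      by (rule long_block[OF graded_L rel_ideal_Z selective_L False _ psL ps(2) len'])
        (use xY stableD(2)[OF Y] in blast)
    then show ?thesis by (rule modulus_base(1))
  next
    case True
    then obtain m where m: "0 < m" "m \<le> int (block_bound c q)" "m dvd n" "n dvd m * b"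
      by (auto simp: small_order_def)
    show ?thesis
    proof (cases "\<exists>k. n dvd a - k * b")
      case False
      have "m * int c \<le> int (block_bound c q) * int (c + 1)" using m by (intro mult_mono) auto
      also have "\<dots> \<le> int (length ps)" using len unfolding metabelian_block_bound_def
        by (metis of_nat_le_iff of_nat_mult)
      finally show ?thesis
        using ps False ne by (intro metabelian_small_order[OF Y x b _ _ _ m(1,3,4)]) (auto simp: homog_def)
    next
      case True
      then obtain k where k: "n dvd a - k * b" by blast
      define s where "s = nat ((- k) mod m)"
      have s: "int s = (- k) mod m" "s \<le> length ps"
        unfolding s_def using m(1,2) pos_mod_bound[of m "- k"] pos_mod_sign[of m "- k"] len' by linarith+
      have "n dvd (- k - int s) * b"
      proof -
        have "m dvd - k - int s" by (simp add: s mod_eq_dvd_iff[symmetric])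
        then obtain j where "- k - int s = m * j" by blast
        then have "(- k - int s) * b = (m * b) * j" by simp
        then show ?thesis using m(4) by (metis dvd_mult2)
      qed
      then have "n dvd (a - k * b) - (- k - int s) * b" using k dvd_diff by blast
      then have d: "n dvd a + int s * b" by (simp add: algebra_simps)
      have h: "homog Y (take s ps)" "homog Y (drop s ps)" using ps(1) by (metis append_take_drop_id homog_simps(3))+
      have "map fst (take s ps) = replicate s b"
        using ps(2) s(2) set_take_subset[of s ps] by (intro replicate_eqI) auto
      then have "lc x (take s ps) \<in> Y (a + int s * b)"
        using lc_mem[OF Yg xY h(1)] by (simp add: sum_list_replicate)
      then have "lc x (take s ps) \<in> Z" using stable_zero[OF Y d] by blast
      then have "lc (lc x (take s ps)) (drop s ps) \<in> Z" by (rule lnc_Z)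
      then have "lc x ps \<in> Z"
        by (metis append_take_drop_id foldl_append map_append)
      then show ?thesis by (rule modulus_base(1))
    qed
  qed
qed

lemma homog_tot: "homog Y ps \<Longrightarrow> set (map snd ps) \<subseteq> tot Y"
  by (auto simp: homog_def intro: tot_base)

text \<open>If few different weights occur, one of them occurs often, and its factors can be brought together in a block. If many occur, then
  factors can be selected one by one so that their weights together with \<open>a\<close> stay independent, since each step forbids
  boundedly many weights only; \<open>c\<close> of them annihilate.\<close>

lemma metabelian_homogeneous:
  assumes Y: "stable Y" and x: "x \<in> der Y a" and ps: "homog Y ps" and len: "length ps \<ge> metabelian_bound c q"
  shows "lc x ps \<in> modulus (der (der Y))"
proof (cases "n dvd a")
  case True
  then have "x \<in> Z" using stable_zero[OF stable_der[OF Y]] x by blast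
  then show ?thesis by (intro modulus_base(1) lnc_Z)
next
  case na: False
  note Yg = stableD(1)[OF Y]
  let ?N = "modulus (der (der Y))"
  have xt: "x \<in> tot (der Y)" using x by (rule tot_base)
  have perm: "lc x ps \<in> ?N" if "mset qs = mset ps" "lc x qs \<in> ?N" for qs
    using metabelian_perm[OF Yg xt, of "map snd qs" "map snd ps"] that homog_tot[OF homog_mset[OF ps that(1)]]
    by (simp add: mset_map)
  define B where "B = set (map fst ps)"
  have B: "finite B" "B \<subseteq> {0..<n}" using ps by (auto simp: B_def homog_def)
  have mp: "metabelian_block_bound c q > 0" by (simp add: metabelian_block_bound_def block_bound_def)
  have ne: "ps \<noteq> []" using len mp by (auto simp: metabelian_bound_def)
  show ?thesis
  proof (cases "card B \<le> extension_bound c q + c")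
    case True
    have "card B * metabelian_block_bound c q \<le> length (map fst ps)"
    proof -
      have "card B * metabelian_block_bound c q \<le> (extension_bound c q + c + 1) * metabelian_block_bound c q" using True by (intro mult_right_mono) auto
      then show ?thesis using len by (simp add: metabelian_bound_def mult.commute)
    qed
    then have "\<exists>b\<in>B. metabelian_block_bound c q \<le> count_list (map fst ps) b"
      by (intro pigeonhole_count_list B(1)) (use ne in \<open>auto simp: B_def\<close>)
    then obtain b where b: "metabelian_block_bound c q \<le> count_list (map fst ps) b" by blast
    define p1 p2 where "p1 = filter (\<lambda>p. fst p = b) ps" and "p2 = filter (\<lambda>p. fst p \<noteq> b) ps"
    have mset: "mset (p1 @ p2) = mset ps" by (simp add: p1_def p2_def)
    have "length p1 = count_list (map fst ps) b" unfolding p1_def by (induction ps) auto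
    then have l1: "metabelian_block_bound c q \<le> length p1" using b by simp
    have h: "homog Y p1" "homog Y p2" using homog_mset[OF ps mset] by auto
    have "lc x p1 \<in> ?N" by (rule metabelian_block[OF Y x h(1), of b]) (use l1 in \<open>auto simp: p1_def\<close>)
    then have "lc (lc x p1) p2 \<in> ?N" by (rule lnc_second_der[OF Yg _ homog_tot[OF h(2)]])
    then show ?thesis using perm[OF mset] by simp
  next
    case False
    have greedy: "\<exists>qs rs. mset (qs @ rs) = mset ps \<and> length qs = k \<and> \<not> dependent (a mod n # map fst qs)"
      if "k \<le> c" for k
      using that
    proof (induction k)
      case 0
      have "\<not> dependent [a mod n]" using na by (intro independent_singleton) (simp add: dvd_mod_iff)
      then show ?case by (intro exI[of _ "[]"] exI[of _ ps]) simp
    next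
      case (Suc k)
      then obtain qs rs where q: "mset (qs @ rs) = mset ps" "length qs = k" "\<not> dependent (a mod n # map fst qs)"
        by auto
      let ?D = "{j \<in> {0..<n}. dependent ((a mod n # map fst qs) @ [j])}"
      have finD: "finite ?D" by (rule finite_subset[of _ "{0..<n}"]) auto
      have "card ?D \<le> q ^ Suc (Suc k)" using card_dependent_extensions[OF q(3)] q(2) by simp
      also have "\<dots> \<le> extension_bound c q" unfolding extension_bound_def
        using Suc.prems q_pos by (intro power_increasing) auto
      finally have cD: "card ?D \<le> extension_bound c q" .
      have "\<exists>p\<in>set rs. fst p \<notin> ?D"
      proof (rule ccontr)
        assume "\<not> ?thesis"
        moreover have "set ps = set qs \<union> set rs" using q(1) by (metis set_append set_mset_mset)
        ultimately have "B \<subseteq> fst ` set qs \<union> ?D" by (auto simp: B_def)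
        then have "card B \<le> card (fst ` set qs \<union> ?D)" using finD by (intro card_mono) auto
        also have "\<dots> \<le> card (fst ` set qs) + card ?D" by (rule card_Un_le)
        also have "card (fst ` set qs) \<le> length qs" by (metis card_length length_map list.set_map)
        finally show False using False cD q(2) Suc.prems by simp
      qed
      then obtain p where p: "p \<in> set rs" "fst p \<notin> ?D" by blast
      then obtain r1 r2 where r: "rs = r1 @ p # r2" by (meson split_list)
      have "p \<in> set ps" using q(1) p(1) by (metis Un_iff set_append set_mset_mset)
      then have "fst p \<in> {0..<n}" using ps by (auto simp: homog_def)
      then have "\<not> dependent (a mod n # map fst (qs @ [p]))" using p(2) by simp
      then show ?case using q r by (intro exI[of _ "qs @ [p]"] exI[of _ "r1 @ r2"]) auto
    qed
    obtain qs rs where q: "mset (qs @ rs) = mset ps" "length qs = c" "\<not> dependent (a mod n # map fst qs)"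
      using greedy[of c] by blast
    have h: "homog Y qs" "homog Y rs" using homog_mset[OF ps q(1)] by auto
    have hL: "homog L qs" using homog_mono[OF h(1)] stableD(2)[OF Y] by blast
    have xL: "x \<in> L (a mod n)"
      using x stableD(2)[OF stable_der[OF Y]] graded_mod[OF graded_L] by blast
    have "lc x qs \<in> Z" by (rule selectiveD[OF selective_L mod_range xL hL q(2,3)])
    then have "lc (lc x qs) rs \<in> Z" by (rule lnc_Z)
    then show ?thesis using perm[OF q(1)] modulus_base(1) by simp
  qed
qed

lemma metabelian_nilpotent:
  assumes Y: "stable Y" and x: "x \<in> tot (der Y)" and ys: "set ys \<subseteq> tot Y" "length ys = metabelian_bound c q"
  shows "lnc x ys \<in> modulus (der (der Y))"
proof (rule lnc_span[OF modulus_subgroup _ x[unfolded tot_def] ys[unfolded tot_def]])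
  fix x ys assume x: "x \<in> (\<Union>i. der Y i)" and ys: "set ys \<subseteq> (\<Union>i. Y i)" "length ys = metabelian_bound c q"
  obtain a where a: "x \<in> der Y a" using x by blast
  have "\<forall>y\<in>set ys. \<exists>i. y \<in> Y i" using ys(1) by blast
  then obtain f where f: "\<And>y. y \<in> set ys \<Longrightarrow> y \<in> Y (f y)" by metis
  define ps where "ps = map (\<lambda>y. (f y mod n, y)) ys"
  have "homog Y ps" using f mod_range graded_mod[OF stableD(1)[OF Y]] by (auto simp: ps_def homog_def)
  then have "lc x ps \<in> modulus (der (der Y))"
    by (rule metabelian_homogeneous[OF Y a]) (simp add: ps_def ys(2))
  then show "lnc x ys \<in> modulus (der (der Y))" by (simp add: ps_def comp_def)
qed

section \<open>From soluble to nilpotent\<close>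

text \<open>The lower central series of the derived ring, modulo \<open>Z\<close>.\<close>

primrec central :: "(int \<Rightarrow> 'a set) \<Rightarrow> nat \<Rightarrow> 'a set"
  where
    "central Y 0 = add_span (Z \<union> tot (der Y))"
  | "central Y (Suc j) = add_span (Z \<union> {br u w | u w. u \<in> central Y j \<and> w \<in> tot (der Y)})"

declare central.simps [simp del]

lemma central_subgroup: "add_subgroup (central Y j)"
  by (cases j) (simp_all add: central.simps add_subgroup_add_span)

lemma central_Z: "x \<in> Z \<Longrightarrow> x \<in> central Y j"
  by (cases j) (auto simp: central.simps intro: add_span.base)

lemma central_br: "u \<in> central Y j \<Longrightarrow> w \<in> tot (der Y) \<Longrightarrow> br u w \<in> central Y (Suc j)"
  by (auto simp: central.simps intro: add_span.base)

lemma central_ideal: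
  assumes Y: "graded Y"
  shows "u \<in> central Y j \<Longrightarrow> s \<in> tot Y \<Longrightarrow> br u s \<in> central Y j"
proof (induction j arbitrary: u)
  case 0
  show ?case unfolding central.simps
    by (rule additive_map_span[OF br_left add_subgroup_add_span _ 0(1)[unfolded central.simps]])
      (use 0(2) in \<open>auto intro: add_span.base Z_left tot_der_ideal[OF Y]\<close>)
next
  case (Suc j)
  note sg = central_subgroup[of Y "Suc j"]
  show ?case
  proof (rule additive_map_span[OF br_left sg _ Suc.prems(1)[unfolded central.simps]])
    fix z assume "z \<in> Z \<union> {br u w | u w. u \<in> central Y j \<and> w \<in> tot (der Y)}"
    then consider "z \<in> Z" | u w where "z = br u w" "u \<in> central Y j" "w \<in> tot (der Y)" by blast
    then show "br z s \<in> central Y (Suc j)"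
    proof cases
      case 1
      then show ?thesis by (intro central_Z Z_left)
    next
      case 2
      have "br (br u s) w + br u (br w s) \<in> central Y (Suc j)"
        by (intro add_subgroup_add sg central_br Suc.IH 2 Suc.prems(2) tot_der_ideal[OF Y])
      then show ?thesis using central_Z[OF br_leibniz[of u w s], of Y "Suc j"] add_subgroup_cong[OF sg]
        unfolding 2(1) by blast
    qed
  qed
qed

lemma central_lnc:
  "graded Y \<Longrightarrow> u \<in> central Y j \<Longrightarrow> set ss \<subseteq> tot Y \<Longrightarrow> lnc u ss \<in> central Y j"
  by (induction ss arbitrary: u) (auto intro: central_ideal)

lemma central_step_second_der:
  assumes u: "u \<in> central Y j" and w: "w \<in> modulus (der (der Y))"
  shows "br u w \<in> central Y (Suc (Suc j))"
proof -
  note sg = central_subgroup[of Y "Suc (Suc j)"]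
  have 1: "br u w \<in> central Y (Suc (Suc j))" if "w \<in> tot (der (der Y))" for w
  proof (rule additive_map_span[OF br_right sg _ that[unfolded tot_def]])
    fix w assume "w \<in> (\<Union>i. der (der Y) i)"
    then obtain i where wi: "w \<in> der (der Y) i" by blast
    show "br u w \<in> central Y (Suc (Suc j))"
    proof (rule additive_map_span[OF br_right sg _ wi[unfolded der_def[of "der Y"]]], clarify)
      fix x y a b assume "x \<in> der Y a" "y \<in> der Y b"
      then have xy: "x \<in> tot (der Y)" "y \<in> tot (der Y)" by (auto intro: tot_base)
      have "br (br u x) y - br (br u y) x \<in> central Y (Suc (Suc j))"
        by (intro add_subgroup_diff sg central_br u xy)
      moreover have "br (br u x) y - br (br u y) x - br u (br x y) \<in> central Y (Suc (Suc j))"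
        using central_Z[OF br_leibniz[of u x y]] by (simp add: algebra_simps)
      ultimately show "br u (br x y) \<in> central Y (Suc (Suc j))"
        using add_subgroup_cong[OF sg] by blast
    qed
  qed
  show ?thesis
    by (rule additive_map_span[OF br_right sg _ w[unfolded modulus_def[of "der (der Y)"]]])
      (use 1 in \<open>auto intro: central_Z Z_right\<close>)
qed

text \<open>By the Leibniz rule, the factors \<open>ss\<close> are distributed over \<open>u\<close> and \<open>w\<close> in all possible ways, and of \<open>k + l\<close> factors
  either \<open>k\<close> act on \<open>u\<close> or \<open>l\<close> act on \<open>w\<close>. Both \<open>[central Y (Suc j), Y']\<close> and \<open>[central Y j, Y'']\<close> are contained in the
  required term.\<close>

lemma leibniz_distribution:
  assumes Y: "graded Y"
  shows "u \<in> central Y j \<Longrightarrow> w \<in> tot (der Y) \<Longrightarrow>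
    (\<And>bs. set bs \<subseteq> tot Y \<Longrightarrow> length bs = k \<Longrightarrow> lnc u bs \<in> central Y (Suc j)) \<Longrightarrow>
    (\<And>bs. set bs \<subseteq> tot Y \<Longrightarrow> length bs = l \<Longrightarrow> lnc w bs \<in> modulus (der (der Y))) \<Longrightarrow>
    set ss \<subseteq> tot Y \<Longrightarrow> length ss = k + l \<Longrightarrow> lnc (br u w) ss \<in> central Y (Suc (Suc j))"
proof (induction ss arbitrary: u w k l)
  case Nil
  have "u \<in> central Y (Suc j)" using Nil.prems(3)[of "[]"] Nil.prems(6) by simp
  then show ?case using central_br[OF _ Nil.prems(2)] by simp
next
  case (Cons s ss)
  note sg = central_subgroup[of Y "Suc (Suc j)"]
  have s: "s \<in> tot Y" "set ss \<subseteq> tot Y" using Cons.prems(5) by auto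
  consider "k = 0" | "l = 0" | k' l' where "k = Suc k'" "l = Suc l'" by (metis not0_implies_Suc)
  then show ?case
  proof cases
    case 1
    then have "u \<in> central Y (Suc j)" using Cons.prems(3)[of "[]"] by simp
    then show ?thesis using central_br[OF _ Cons.prems(2)] by (intro central_lnc[OF Y _ Cons.prems(5)])
  next
    case 2
    then have "w \<in> modulus (der (der Y))" using Cons.prems(4)[of "[]"] by simp
    then show ?thesis by (intro central_lnc[OF Y _ Cons.prems(5)] central_step_second_der Cons.prems(1))
  next
    case 3
    have A: "lnc (br (br u s) w) ss \<in> central Y (Suc (Suc j))"
    proof (rule Cons.IH[of _ _ k' l])
      show "lnc (br u s) bs \<in> central Y (Suc j)" if "set bs \<subseteq> tot Y" "length bs = k'" for bs
        using Cons.prems(3)[of "s # bs"] that s 3 by simp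
    qed (use Cons.prems s 3 central_ideal[OF Y] in auto)
    have B: "lnc (br u (br w s)) ss \<in> central Y (Suc (Suc j))"
    proof (rule Cons.IH[of _ _ k l'])
      show "lnc (br w s) bs \<in> modulus (der (der Y))" if "set bs \<subseteq> tot Y" "length bs = l'" for bs
        using Cons.prems(4)[of "s # bs"] that s 3 by simp
    qed (use Cons.prems s 3 tot_der_ideal[OF Y] in auto)
    have "lnc (br (br u w) s - (br (br u s) w + br u (br w s))) ss \<in> central Y (Suc (Suc j))"
      by (intro central_Z lnc_Z br_leibniz)
    then have "lnc (br (br u w) s) ss - (lnc (br (br u s) w) ss + lnc (br u (br w s)) ss) \<in> central Y (Suc (Suc j))"
      by (simp add: lnc_simps)
    then show ?thesis using add_subgroup_add[OF sg A B] add_subgroup_cong[OF sg] by auto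
  qed
qed

lemma central_descent:
  assumes Y: "stable Y"
  shows "u \<in> central Y j \<Longrightarrow> set ss \<subseteq> tot Y \<Longrightarrow> length ss = Suc j * metabelian_bound c q \<Longrightarrow> lnc u ss \<in> central Y (Suc j)"
proof (induction j arbitrary: u ss)
  case 0
  note Yg = stableD(1)[OF Y]
  have sub: "modulus (der (der Y)) \<subseteq> central Y (Suc 0)"
  proof -
    have "tot (der (der Y)) \<subseteq> central Y (Suc 0)" unfolding tot_def
    proof (rule add_span_least[OF central_subgroup], rule UN_least)
      show "der (der Y) i \<subseteq> central Y (Suc 0)" for i
        unfolding der_def[of "der Y"]
        by (rule add_span_least[OF central_subgroup], clarify, rule central_br)
          (auto simp: central.simps intro: tot_base add_span.base)
    qed
    then show ?thesis unfolding modulus_def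
      by (intro add_span_least[OF central_subgroup]) (auto intro: central_Z)
  qed
  show ?case
  proof (rule additive_map_span[OF lnc_additive central_subgroup _ 0(1)[unfolded central.simps]])
    fix x assume "x \<in> Z \<union> tot (der Y)"
    then show "lnc x ss \<in> central Y (Suc 0)"
      using metabelian_nilpotent[OF Y _ 0(2)] 0(3) sub by (auto intro: central_Z lnc_Z)
  qed
next
  case (Suc j)
  note Yg = stableD(1)[OF Y]
  show ?case
  proof (rule additive_map_span[OF lnc_additive central_subgroup _ Suc.prems(1)[unfolded central.simps]])
    fix x assume "x \<in> Z \<union> {br u w | u w. u \<in> central Y j \<and> w \<in> tot (der Y)}"
    then consider "x \<in> Z" | u w where "x = br u w" "u \<in> central Y j" "w \<in> tot (der Y)" by blast
    then show "lnc x ss \<in> central Y (Suc (Suc j))"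
    proof cases
      case 1
      then show ?thesis by (intro central_Z lnc_Z)
    next
      case 2
      show ?thesis unfolding 2(1)
        by (rule leibniz_distribution[OF Yg 2(2,3) _ _ Suc.prems(2), of "Suc j * metabelian_bound c q" "metabelian_bound c q"])
          (use Suc.IH[OF 2(2)] metabelian_nilpotent[OF Y 2(3)] Suc.prems(3) in auto)
    qed
  qed
qed

text \<open>Hall's argument. By induction the derived ring is nilpotent of bounded class, and a bounded number of commutations with arbitrary elements
  leads from each term of its lower central series to the next.\<close>

theorem soluble_nilpotent:
  assumes "stable Y" "\<And>i. (der ^^ s) Y i \<subseteq> Z"
    and "x \<in> tot Y" "set ys \<subseteq> tot Y" "length ys = class_bound (metabelian_bound c q) s"
  shows "lnc x ys \<in> Z"
  using assms
proof (induction s arbitrary: Y x ys)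
  case 0
  then have "tot Y \<subseteq> Z" unfolding tot_def by (intro add_span_least[OF Z_subgroup]) auto
  then show ?case using 0 by auto
next
  case (Suc s)
  note Y = Suc.prems(1) and Yg = stableD(1)[OF Suc.prems(1)]
  let ?e = "class_bound (metabelian_bound c q) s"
  have IH: "lnc w ws \<in> Z" if "w \<in> tot (der Y)" "set ws \<subseteq> tot (der Y)" "length ws = ?e" for w ws
    by (rule Suc.IH[OF stable_der[OF Y] _ that]) (use Suc.prems(2) in \<open>simp add: funpow_swap1\<close>)
  have low: "lnc u ws \<in> Z" if "u \<in> central Y j" "set ws \<subseteq> tot (der Y)" "j + length ws = ?e" for u j ws
    using that
  proof (induction j arbitrary: u ws)
    case 0
    show ?case
      by (rule additive_map_span[OF lnc_additive Z_subgroup _ 0(1)[unfolded central.simps]])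
        (use 0 IH in \<open>auto intro: lnc_Z\<close>)
  next
    case (Suc j)
    show ?case
    proof (rule additive_map_span[OF lnc_additive Z_subgroup _ Suc.prems(1)[unfolded central.simps]])
      fix x assume "x \<in> Z \<union> {br u w | u w. u \<in> central Y j \<and> w \<in> tot (der Y)}"
      then consider "x \<in> Z" | u w where "x = br u w" "u \<in> central Y j" "w \<in> tot (der Y)" by blast
      then show "lnc x ws \<in> Z"
      proof cases
        case 2
        show ?thesis using Suc.IH[OF 2(2), of "w # ws"] Suc.prems 2 by simp
      qed (rule lnc_Z)
    qed
  qed
  have down: "lnc u ss \<in> central Y e" if "u \<in> central Y 0" "set ss \<subseteq> tot Y"
      "length ss = (\<Sum>j<e. Suc j * metabelian_bound c q)" for u ss e
    using that
  proof (induction e arbitrary: ss)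
    case (Suc e)
    let ?l = "\<Sum>j<e. Suc j * metabelian_bound c q"
    have "lnc (lnc u (take ?l ss)) (drop ?l ss) \<in> central Y (Suc e)"
      by (intro central_descent[OF Y] Suc.IH)
        (use Suc.prems set_take_subset[of ?l ss] set_drop_subset[of ?l ss] in auto)
    then show ?case by (metis append_take_drop_id foldl_append)
  qed simp
  obtain y zs where ys: "ys = y # zs" using Suc.prems(5) by (cases ys) auto
  have "br x y \<in> central Y 0" using tot_br_der[of x Y y] Suc.prems(3,4) ys
    by (auto simp: central.simps intro: add_span.base)
  then have "lnc (br x y) zs \<in> central Y ?e" by (rule down) (use Suc.prems(4,5) ys in auto)
  then have "lnc (br x y) zs \<in> Z" using low[of _ ?e "[]"] by simp
  then show ?case by (simp add: ys)
qed

theorem total_nilpotent: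
  assumes "x \<in> tot L" "set ys \<subseteq> tot L" "length ys = nil_bound c q"
  shows "lnc x ys \<in> Z"
  by (rule soluble_nilpotent[OF stable_L _ assms[unfolded nil_bound_def]])
    (rule selective_solvable[OF graded_L rel_ideal_Z L_zero selective_L])

end

section \<open>Adjoining a formal root of unity\<close>

lemma additive_frag_extend: "additive_map (frag_extend f)"
  by (simp add: additive_map_def frag_extend_diff)

lemma frag_induct [case_names zero one diff]:
  assumes "P 0" "\<And>x. P (frag_of x)" "\<And>a b. P a \<Longrightarrow> P b \<Longrightarrow> P (a - b)"
  shows "P u"
  by (rule frag_induction[where S = UNIV]) (use assms in auto)

lemma additive_comp: "additive_map f \<Longrightarrow> additive_map g \<Longrightarrow> additive_map (\<lambda>x. f (g x))"
  by (simp add: additive_map_def)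

lemma additive_add: "additive_map f \<Longrightarrow> additive_map g \<Longrightarrow> additive_map (\<lambda>x. f x + g x)"
  by (simp add: additive_map_def)

lemma additive_subtract: "additive_map f \<Longrightarrow> additive_map g \<Longrightarrow> additive_map (\<lambda>x. f x - g x)"
  by (simp add: additive_map_def)

lemma additive_frag_extend_fun:
  assumes "\<And>a. additive_map (u a)"
  shows "additive_map (\<lambda>g. frag_extend (\<lambda>a. u a g) f)"
  unfolding additive_map_def
proof (intro allI)
  fix x y
  show "frag_extend (\<lambda>a. u a (x - y)) f = frag_extend (\<lambda>a. u a x) f - frag_extend (\<lambda>a. u a y) f"
  proof (induction f rule: frag_induct)
    case (diff a b)
    then show ?case by (simp add: frag_extend_diff)
  qed (use assms in \<open>auto simp: additive_map_def\<close>)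
qed

lemma additive_map_frag_eqI:
  assumes "additive_map f" "additive_map g" "\<And>x. f (frag_of x) = g (frag_of x)"
  shows "f u = g u"
  by (induction u rule: frag_induct)
    (use assms in \<open>auto simp: additive_map_simps\<close>)

lemma additive_map_frag_mem:
  assumes "additive_map f" "add_subgroup S" "\<And>x. f (frag_of x) \<in> S"
  shows "f u \<in> S"
  by (induction u rule: frag_induct)
    (use assms in \<open>auto simp: additive_map_simps add_subgroup_zero add_subgroup_diff\<close>)

text \<open>The coefficient of \<open>\<omega>^j\<close> in the product of the \<open>1 - \<omega>^(n/p)\<close> with \<open>p\<close> in \<open>ps\<close>, computed in the
  integral group ring of the cyclic group of order \<open>n\<close> generated by \<open>\<omega>\<close>.\<close>

primrec mask :: "int \<Rightarrow> int list \<Rightarrow> int \<Rightarrow> int"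
  where
    "mask n [] j = of_bool (n dvd j)"
  | "mask n (p # ps) j = mask n ps j - mask n ps (j - n div p)"

lemma mask_cong: "n dvd i - j \<Longrightarrow> mask n ps i = mask n ps j"
proof (induction ps arbitrary: i j)
  case Nil
  then show ?case by (simp add: dvd_diff_right_iff) (metis dvd_diffD dvd_diff_commute zdvd_zdiffD)
next
  case (Cons p ps)
  have "n dvd (i - n div p) - (j - n div p)" using Cons.prems by simp
  then show ?case using Cons by (metis mask.simps(2))
qed

text \<open>The product contains the factor \<open>1 - \<omega>^(n/p)\<close>, which \<open>\<Sum>\<^sub>t \<omega>^(t n/p)\<close> annihilates.\<close>

lemma mask_sum:
  assumes "p \<in> set ps" "p > 0" "p dvd n"
  shows "(\<Sum>t<nat p. mask n ps (j - int t * (n div p))) = 0"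
  using assms(1)
proof (induction ps arbitrary: j)
  case (Cons q ps)
  show ?case
  proof (cases "q = p")
    case True
    have "(\<Sum>t<nat p. mask n (q # ps) (j - int t * (n div p)))
      = (\<Sum>t<nat p. mask n ps (j - int t * (n div p)) - mask n ps (j - int (Suc t) * (n div p)))"
      by (rule sum.cong) (auto simp: True algebra_simps)
    also have "\<dots> = mask n ps (j - int 0 * (n div p)) - mask n ps (j - int (nat p) * (n div p))"
      by (rule sum_lessThan_telescope')
    also have "\<dots> = 0" using assms(2,3) by (simp add: mask_cong)
    finally show ?thesis .
  next
    case False
    then have IH: "(\<Sum>t<nat p. mask n ps (j - int t * (n div p))) = 0" for j using Cons by auto
    have "(\<Sum>t<nat p. mask n (q # ps) (j - int t * (n div p)))
      = (\<Sum>t<nat p. mask n ps (j - int t * (n div p))) - (\<Sum>t<nat p. mask n ps (j - n div q - int t * (n div p)))"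
      by (simp add: sum_subtractf algebra_simps)
    then show ?thesis using IH by simp
  qed
qed simp

lemma mask_support:
  assumes "d dvd n" "\<And>p. p \<in> set ps \<Longrightarrow> d dvd n div p" "mask n ps j \<noteq> 0"
  shows "d dvd j"
  using assms(2,3)
proof (induction ps arbitrary: j)
  case Nil
  then show ?case using assms(1) by (auto split: if_splits intro: dvd_trans)
next
  case (Cons p ps)
  then have "mask n ps j \<noteq> 0 \<or> mask n ps (j - n div p) \<noteq> 0" by auto
  then have "d dvd j \<or> d dvd j - n div p"
    using Cons.IH[of j] Cons.IH[of "j - n div p"] Cons.prems(1) by auto
  moreover have "d dvd n div p" using Cons.prems by simp
  ultimately show ?case by (metis dvd_diffD diff_add_cancel dvd_add)
qed

text \<open>The exponents occurring in the expanded product are sums of different \<open>n/r\<close>. Such a sum that involves \<open>n/p\<close> is not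
  divisible by the full power of \<open>p\<close> dividing \<open>n\<close>, because all other \<open>n/r\<close> are; so only the empty sum is \<open>0\<close> modulo \<open>n\<close>.\<close>

lemma mask_zero:
  assumes "n > 0" "distinct ps" "\<And>p. p \<in> set ps \<Longrightarrow> normalization_semidom_class.prime p \<and> p dvd n"
  shows "mask n ps 0 = 1"
  using assms(2,3)
proof (induction ps)
  case (Cons p ps)
  then have p: "normalization_semidom_class.prime p" "p dvd n" by auto
  define a where "a = multiplicity p n"
  have pa: "p ^ a dvd n" by (simp add: a_def multiplicity_dvd)
  have "mask n ps (- (n div p)) = 0"
  proof (rule ccontr)
    assume "mask n ps (- (n div p)) \<noteq> 0"
    then have "p ^ a dvd - (n div p)"
    proof (rule mask_support[OF pa, rotated])
      fix r assume r: "r \<in> set ps"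
      then have "normalization_semidom_class.prime r" "r dvd n" "r \<noteq> p" using Cons.prems by auto
      then have "coprime (p ^ a) r" using p(1) by (simp add: primes_coprime)
      moreover have "p ^ a dvd r * (n div r)" using pa \<open>r dvd n\<close> by simp
      ultimately show "p ^ a dvd n div r" by (simp add: coprime_dvd_mult_right_iff)
    qed
    then have "p ^ a dvd n div p" by simp
    then have "p * p ^ a dvd n" using p(2) by (metis dvd_div_mult_self mult.commute mult_dvd_mono dvd_refl)
    then have "p ^ Suc a dvd n" by simp
    then have "Suc a \<le> multiplicity p n"
      using p(1) assms(1) by (intro multiplicity_geI) auto
    then show False by (simp add: a_def)
  qed
  then show ?case using Cons by simp
qed simp

context lie_algebra
begin

text \<open>The homomorphism to \<open>L\<close> from the free abelian group on its carrier. Composing it with a map that sends all other generators to \<open>0\<close>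
  makes the group type itself the domain, which is what the theory of Lie rings modulo a subgroup requires.\<close>

definition ev :: "('l \<Rightarrow>\<^sub>0 int) \<Rightarrow> 'l"
  where "ev = (SOME f. f \<in> Group.hom (free_Abelian_group (carrier L)) (add_monoid L)
    \<and> (\<forall>x\<in>carrier L. f (frag_of x) = x))"

definition restr :: "('l \<Rightarrow> 'b \<Rightarrow>\<^sub>0 int) \<Rightarrow> 'l \<Rightarrow> 'b \<Rightarrow>\<^sub>0 int"
  where "restr f x = (if x \<in> carrier L then f x else 0)"

definition val :: "('l \<Rightarrow>\<^sub>0 int) \<Rightarrow> 'l"
  where "val u = ev (frag_extend (restr frag_of) u)"

lemma restr_carrier: "Poly_Mapping.keys (frag_extend (restr frag_of) u) \<subseteq> carrier L"
  by (rule order_trans[OF keys_frag_extend]) (auto simp: restr_def split: if_splits)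

lemma ev: "ev \<in> Group.hom (free_Abelian_group (carrier L)) (add_monoid L)" "x \<in> carrier L \<Longrightarrow> ev (frag_of x) = x"
proof -
  obtain f where "f \<in> Group.hom (free_Abelian_group (carrier L)) (add_monoid L)"
    "\<And>x. x \<in> carrier L \<Longrightarrow> f (frag_of x) = id x"
    by (rule comm_group.free_Abelian_group_universal[OF M.a_comm_group, of id "carrier L"]) auto
  then have "\<exists>f. f \<in> Group.hom (free_Abelian_group (carrier L)) (add_monoid L)
    \<and> (\<forall>x\<in>carrier L. f (frag_of x) = x)" by auto
  from someI_ex[OF this] show "ev \<in> Group.hom (free_Abelian_group (carrier L)) (add_monoid L)"
    "x \<in> carrier L \<Longrightarrow> ev (frag_of x) = x" unfolding ev_def by auto
qed

lemma val_closed [simp]: "val u \<in> carrier L"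
  using ev(1) restr_carrier[of u] unfolding val_def hom_def by (auto simp: Pi_def)

lemma val_add: "val (u + v) = val u \<oplus>\<^bsub>L\<^esub> val v"
  using ev(1) restr_carrier unfolding val_def hom_def
  by (auto simp: frag_extend_add)

lemma val_zero [simp]: "val 0 = \<zero>\<^bsub>L\<^esub>"
  using val_add[of 0 0] M.add.l_cancel_one[of "val 0" "val 0"] by simp

lemma val_diff: "val (u - v) = val u \<ominus>\<^bsub>L\<^esub> val v"
proof -
  have "val u = val (u - v) \<oplus>\<^bsub>L\<^esub> val v" using val_add[of "u - v" v] by simp
  then show ?thesis
    by (simp add: M.minus_eq M.a_assoc M.r_neg)
qed

lemma val_frag_of: "val (frag_of x) = (if x \<in> carrier L then x else \<zero>\<^bsub>L\<^esub>)"
  using ev(2)[of x] val_zero by (auto simp: val_def restr_def)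

lemma lie_homD:
  assumes "f \<in> lie_hom K L L"
  shows "x \<in> carrier L \<Longrightarrow> f x \<in> carrier L"
    "x \<in> carrier L \<Longrightarrow> y \<in> carrier L \<Longrightarrow> f (x \<oplus>\<^bsub>L\<^esub> y) = f x \<oplus>\<^bsub>L\<^esub> f y"
    "a \<in> carrier K \<Longrightarrow> x \<in> carrier L \<Longrightarrow> f (a \<odot>\<^bsub>L\<^esub> x) = a \<odot>\<^bsub>L\<^esub> f x"
    "x \<in> carrier L \<Longrightarrow> y \<in> carrier L \<Longrightarrow> f (bracket L x y) = bracket L (f x) (f y)"
  using assms by (auto simp: lie_hom_def)

text \<open>Additive on the carrier: unlike \<open>additive_map\<close>, this is about a group that is not a type.\<close>

definition addf :: "('l \<Rightarrow> 'l) \<Rightarrow> bool"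
  where "addf f \<longleftrightarrow> (\<forall>x\<in>carrier L. f x \<in> carrier L)
    \<and> (\<forall>x\<in>carrier L. \<forall>y\<in>carrier L. f (x \<oplus>\<^bsub>L\<^esub> y) = f x \<oplus>\<^bsub>L\<^esub> f y)"

lemma addfD: "addf f \<Longrightarrow> x \<in> carrier L \<Longrightarrow> f x \<in> carrier L"
  "addf f \<Longrightarrow> x \<in> carrier L \<Longrightarrow> y \<in> carrier L \<Longrightarrow> f (x \<oplus>\<^bsub>L\<^esub> y) = f x \<oplus>\<^bsub>L\<^esub> f y"
  by (auto simp: addf_def)

lemma addf_zero: "addf f \<Longrightarrow> f \<zero>\<^bsub>L\<^esub> = \<zero>\<^bsub>L\<^esub>"
  using addfD(2)[of f "\<zero>\<^bsub>L\<^esub>" "\<zero>\<^bsub>L\<^esub>"] addfD(1)[of f "\<zero>\<^bsub>L\<^esub>"] M.add.l_cancel_one[of "f \<zero>\<^bsub>L\<^esub>" "f \<zero>\<^bsub>L\<^esub>"] by simp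

lemma addf_diff: "addf f \<Longrightarrow> x \<in> carrier L \<Longrightarrow> y \<in> carrier L \<Longrightarrow> f (x \<ominus>\<^bsub>L\<^esub> y) = f x \<ominus>\<^bsub>L\<^esub> f y"
proof -
  assume f: "addf f" and xy: "x \<in> carrier L" "y \<in> carrier L"
  have "f x = f (x \<ominus>\<^bsub>L\<^esub> y) \<oplus>\<^bsub>L\<^esub> f y"
    using addfD(2)[OF f, of "x \<ominus>\<^bsub>L\<^esub> y" y] xy by (simp add: M.minus_eq M.a_assoc M.l_neg)
  then show ?thesis using xy addfD(1)[OF f] by (simp add: M.minus_eq M.a_assoc M.r_neg)
qed

lemma addf_lie_hom: "f \<in> lie_hom K L L \<Longrightarrow> addf f"
  by (auto simp: addf_def lie_hom_def)

lemma addf_smult: "a \<in> carrier K \<Longrightarrow> addf (\<lambda>x. a \<odot>\<^bsub>L\<^esub> x)"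
  by (auto simp: addf_def smult_r_distr)

lemma addf_bracket_left: "y \<in> carrier L \<Longrightarrow> addf (\<lambda>x. bracket L x y)"
  by (auto simp: addf_def bracket_add_left bracket_closed)

lemma addf_bracket_right: "y \<in> carrier L \<Longrightarrow> addf (bracket L y)"
  by (auto simp: addf_def bracket_add_right bracket_closed)

lemma val_map: "addf f \<Longrightarrow> f (val u) = val (frag_extend (restr (\<lambda>x. frag_of (f x))) u)"
proof (induction u rule: frag_induct)
  case (one x)
  then show ?case by (auto simp: val_frag_of restr_def addf_zero addfD)
next
  case (diff a b)
  then show ?case by (simp add: val_diff frag_extend_diff addf_diff)
qed (simp_all add: addf_zero)

end

text \<open>The powers of \<open>chi\<close> form a group of order dividing \<open>n\<close>, without non-zero fixed points and normalised by the
  complement, and \<open>n\<close> has the inverse \<open>d\<close> in the field. The multiple of a vector by \<open>n\<close> is written as an iterated sum.\<close>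

locale frobenius_lie = lie_algebra K L + frobenius_weights HG rho n
  for K :: "('k, 'r) ring_scheme" and L :: "('k, 'l, 's) lie_algebra_scheme"
    and HG :: "'h monoid" and rho n +
  fixes chi :: "'l \<Rightarrow> 'l" and hact :: "'h \<Rightarrow> 'l \<Rightarrow> 'l" and d :: 'k and c :: nat
  assumes chi_hom: "chi \<in> lie_hom K L L"
    and chi_pow: "x \<in> carrier L \<Longrightarrow> (chi ^^ nat n) x = x"
    and chi_fixed: "x \<in> carrier L \<Longrightarrow> chi x = x \<Longrightarrow> x = \<zero>\<^bsub>L\<^esub>"
    and hact_hom: "h \<in> carrier HG \<Longrightarrow> hact h \<in> lie_hom K L L"
    and hact_one: "x \<in> carrier L \<Longrightarrow> hact \<one>\<^bsub>HG\<^esub> x = x"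
    and hact_mult: "g \<in> carrier HG \<Longrightarrow> h \<in> carrier HG \<Longrightarrow> x \<in> carrier L
      \<Longrightarrow> hact (g \<otimes>\<^bsub>HG\<^esub> h) x = hact g (hact h x)"
    and chi_hact: "h \<in> carrier HG \<Longrightarrow> x \<in> carrier L \<Longrightarrow> chi (hact h x) = hact h ((chi ^^ nat (rho h)) x)"
    and rho_nonneg: "h \<in> carrier HG \<Longrightarrow> rho h \<ge> 0"
    and d_closed: "d \<in> carrier K"
    and d_inverse: "x \<in> carrier L \<Longrightarrow> ((\<lambda>y. y \<oplus>\<^bsub>L\<^esub> d \<odot>\<^bsub>L\<^esub> x) ^^ nat n) \<zero>\<^bsub>L\<^esub> = x"
    and fix_nilpotent: "nilpotent_class_le K (L\<lparr>carrier := {x \<in> carrier L. \<forall>h\<in>carrier HG. hact h x = x}\<rparr>) c"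
begin

definition plist :: "int list"
  where "plist = (SOME ps. set ps = {p. normalization_semidom_class.prime p \<and> p dvd n} \<and> distinct ps)"

lemma plist: "set plist = {p. normalization_semidom_class.prime p \<and> p dvd n}" "distinct plist"
proof -
  have "finite {p. normalization_semidom_class.prime p \<and> p dvd n}"
    by (rule finite_subset[of _ "{0..n}"]) (auto intro: zdvd_imp_le[OF _ n_pos] prime_ge_0_int)
  from someI_ex[OF finite_distinct_list[OF this]]
  show "set plist = {p. normalization_semidom_class.prime p \<and> p dvd n}" "distinct plist"
    unfolding plist_def by blast+
qed

definition msk :: "int \<Rightarrow> int" where "msk = mask n plist"

text \<open>The generator \<open>(x, i)\<close> stands for \<open>x \<omega>^i\<close>, and \<open>coef j f\<close> is the coefficient of \<open>\<omega>^j\<close> in the product of \<open>f\<close> and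
  \<open>\<Prod> (1 - \<omega>^(n/p))\<close>, the product over all primes dividing \<open>n\<close>.\<close>

definition coef :: "int \<Rightarrow> ('l \<times> int \<Rightarrow>\<^sub>0 int) \<Rightarrow> ('l \<Rightarrow>\<^sub>0 int)"
  where "coef j = frag_extend (\<lambda>(x, i). restr (\<lambda>x. frag_cmul (msk (j - i)) (frag_of x)) x)"

text \<open>The complex \<open>n\<close>-th roots of unity at which no factor \<open>1 - \<omega>^(n/p)\<close> vanishes are the primitive ones. So, \<open>n\<close> being
  invertible, passing to the quotient by \<open>null\<close> amounts to tensoring \<open>L\<close> with the \<open>n\<close>-th cyclotomic ring.\<close>

definition null :: "('l \<times> int \<Rightarrow>\<^sub>0 int) set"
  where "null = {f. \<forall>j. val (coef j f) = \<zero>\<^bsub>L\<^esub>}"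

definition lbr :: "('l \<times> int \<Rightarrow>\<^sub>0 int) \<Rightarrow> ('l \<times> int \<Rightarrow>\<^sub>0 int) \<Rightarrow> ('l \<times> int \<Rightarrow>\<^sub>0 int)"
  where "lbr f g = frag_extend (\<lambda>(x, i). frag_extend (\<lambda>(y, k).
    if x \<in> carrier L \<and> y \<in> carrier L then frag_of (bracket L x y, i + k) else 0) g) f"

definition lift :: "('l \<Rightarrow> 'l) \<Rightarrow> ('l \<times> int \<Rightarrow>\<^sub>0 int) \<Rightarrow> ('l \<times> int \<Rightarrow>\<^sub>0 int)"
  where "lift f = frag_extend (\<lambda>(x, i). restr (\<lambda>x. frag_of (f x, i)) x)"

definition shift :: "int \<Rightarrow> ('l \<times> int \<Rightarrow>\<^sub>0 int) \<Rightarrow> ('l \<times> int \<Rightarrow>\<^sub>0 int)"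
  where "shift i = frag_extend (\<lambda>(x, k). frag_of (x, k + i))"

lemma additive_coef: "additive_map (coef j)" and additive_lift: "additive_map (lift f)"
  and additive_shift: "additive_map (shift i)" and additive_lbr_left: "additive_map (\<lambda>f. lbr f g)"
  by (simp_all add: coef_def lift_def shift_def lbr_def additive_frag_extend)

lemma additive_lbr_right: "additive_map (lbr f)"
  unfolding lbr_def
  using additive_frag_extend_fun[of "\<lambda>(x, i). frag_extend (\<lambda>(y, k).
    if x \<in> carrier L \<and> y \<in> carrier L then frag_of (bracket L x y, i + k) else 0)" f]
  by (simp add: case_prod_unfold additive_frag_extend)

lemma lbr_of: "lbr (frag_of (x, i)) (frag_of (y, k)) =
    (if x \<in> carrier L \<and> y \<in> carrier L then frag_of (bracket L x y, i + k) else 0)"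
  by (simp add: lbr_def)

lemma lift_of: "lift f (frag_of (x, i)) = (if x \<in> carrier L then frag_of (f x, i) else 0)"
  by (simp add: lift_def restr_def)

lemma shift_of: "shift i (frag_of (x, k)) = frag_of (x, k + i)"
  by (simp add: shift_def)

lemma coef_of: "coef j (frag_of (x, i)) = (if x \<in> carrier L then frag_cmul (msk (j - i)) (frag_of x) else 0)"
  by (simp add: coef_def restr_def)

lemma null_subgroup: "add_subgroup null"
  by (auto simp: add_subgroup_def null_def additive_map_simps[OF additive_coef] val_diff M.minus_eq)

lemma nullD: "f \<in> null \<Longrightarrow> val (coef j f) = \<zero>\<^bsub>L\<^esub>"
  by (simp add: null_def)

lemma coef_map: "addf f \<Longrightarrow> val (coef j (lift f u)) = f (val (coef j u))"
proof -
  assume f: "addf f"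
  have "coef j (lift f u) = frag_extend (restr (\<lambda>x. frag_of (f x))) (coef j u)"
  proof (rule additive_map_frag_eqI[OF additive_comp[OF additive_coef additive_lift]
          additive_comp[OF additive_frag_extend additive_coef]])
    fix z :: "'l \<times> int"
    obtain x i where z: "z = (x, i)" by fastforce
    show "coef j (lift f (frag_of z)) = frag_extend (restr (\<lambda>x. frag_of (f x))) (coef j (frag_of z))"
      by (cases "x \<in> carrier L") (simp_all add: z additive_map_simps(2)[OF additive_coef] coef_of frag_extend_cmul restr_def lift_of addfD(1)[OF f])
  qed
  then show ?thesis using val_map[OF f, of "coef j u"] by simp
qed

lemma lift_null: "addf f \<Longrightarrow> u \<in> null \<Longrightarrow> lift f u \<in> null"
  by (simp add: null_def coef_map addf_zero)

lemma coef_shift: "coef j (shift i u) = coef (j - i) u"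
proof (rule additive_map_frag_eqI[OF additive_comp[OF additive_coef additive_shift] additive_coef])
  fix z :: "'l \<times> int"
  obtain x k where z: "z = (x, k)" by fastforce
  have "j - (k + i) = j - i - k" by simp
  then show "coef j (shift i (frag_of z)) = coef (j - i) (frag_of z)"
    by (simp only: z shift_of coef_of)
qed

lemma shift_null: "u \<in> null \<Longrightarrow> shift i u \<in> null"
  by (simp add: null_def coef_shift)

lemma coef_lbr_right:
  assumes "y \<in> carrier L"
  shows "val (coef j (lbr u (frag_of (y, k)))) = bracket L (val (coef (j - k) u)) y"
proof -
  note f = addf_bracket_left[OF assms]
  have "coef j (lbr u (frag_of (y, k))) = frag_extend (restr (\<lambda>x. frag_of (bracket L x y))) (coef (j - k) u)"
  proof (rule additive_map_frag_eqI[OF additive_comp[OF additive_coef additive_lbr_left]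
          additive_comp[OF additive_frag_extend additive_coef]])
    fix z :: "'l \<times> int"
    obtain x i where z: "z = (x, i)" by fastforce
    show "coef j (lbr (frag_of z) (frag_of (y, k))) = frag_extend (restr (\<lambda>x. frag_of (bracket L x y))) (coef (j - k) (frag_of z))"
      by (cases "x \<in> carrier L") (simp_all add: z additive_map_simps(2)[OF additive_coef] coef_of frag_extend_cmul restr_def lbr_of assms bracket_closed diff_diff_eq2 add.commute diff_diff_add)
  qed
  then show ?thesis using val_map[OF f, of "coef (j - k) u"] by simp
qed

lemma coef_lbr_left:
  assumes "y \<in> carrier L"
  shows "val (coef j (lbr (frag_of (y, k)) u)) = bracket L y (val (coef (j - k) u))"
proof -
  note f = addf_bracket_right[OF assms]
  have "coef j (lbr (frag_of (y, k)) u) = frag_extend (restr (\<lambda>x. frag_of (bracket L y x))) (coef (j - k) u)"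
  proof (rule additive_map_frag_eqI[OF additive_comp[OF additive_coef additive_lbr_right]
          additive_comp[OF additive_frag_extend additive_coef]])
    fix z :: "'l \<times> int"
    obtain x i where z: "z = (x, i)" by fastforce
    show "coef j (lbr (frag_of (y, k)) (frag_of z)) = frag_extend (restr (\<lambda>x. frag_of (bracket L y x))) (coef (j - k) (frag_of z))"
      by (cases "x \<in> carrier L") (simp_all add: z additive_map_simps(2)[OF additive_coef] coef_of frag_extend_cmul restr_def lbr_of assms bracket_closed diff_diff_add)
  qed
  then show ?thesis using val_map[OF f, of "coef (j - k) u"] by simp
qed

lemma lbr_junk: "y \<notin> carrier L \<Longrightarrow> lbr u (frag_of (y, k)) = 0" "y \<notin> carrier L \<Longrightarrow> lbr (frag_of (y, k)) u = 0"
proof -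
  assume y: "y \<notin> carrier L"
  show "lbr u (frag_of (y, k)) = 0"
    by (rule additive_map_frag_eqI[OF additive_lbr_left, of "\<lambda>_. 0"]) (use y in \<open>auto simp: lbr_of additive_map_def\<close>)
  show "lbr (frag_of (y, k)) u = 0"
    by (rule additive_map_frag_eqI[OF additive_lbr_right, of "\<lambda>_. 0"]) (use y in \<open>auto simp: lbr_of additive_map_def\<close>)
qed

lemma null_lbr_left: "u \<in> null \<Longrightarrow> lbr u v \<in> null"
proof (rule additive_map_frag_mem[OF additive_lbr_right null_subgroup])
  fix x :: "'l \<times> int" assume u: "u \<in> null"
  obtain y k where x: "x = (y, k)" by fastforce
  show "lbr u (frag_of x) \<in> null"
  proof (cases "y \<in> carrier L")
    case True
    then show ?thesis unfolding x null_def using nullD[OF u] addf_zero[OF addf_bracket_left[OF True]]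
      by (simp add: coef_lbr_right)
  qed (simp add: x lbr_junk add_subgroup_zero[OF null_subgroup])
qed

lemma null_lbr_right: "u \<in> null \<Longrightarrow> lbr v u \<in> null"
proof (rule additive_map_frag_mem[OF additive_lbr_left null_subgroup])
  fix x :: "'l \<times> int" assume u: "u \<in> null"
  obtain y k where x: "x = (y, k)" by fastforce
  show "lbr (frag_of x) u \<in> null"
  proof (cases "y \<in> carrier L")
    case True
    then show ?thesis unfolding x null_def using nullD[OF u] addf_zero[OF addf_bracket_right[OF True]]
      by (simp add: coef_lbr_left)
  qed (simp add: x lbr_junk add_subgroup_zero[OF null_subgroup])
qed

text \<open>Multiplication by an integer in \<open>L\<close>.\<close>

definition scal :: "int \<Rightarrow> 'l \<Rightarrow> 'l" where "scal m x = val (frag_cmul m (frag_of x))"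

lemma coef_of_val: "x \<in> carrier L \<Longrightarrow> val (coef j (frag_of (x, i))) = scal (msk (j - i)) x"
  by (simp add: coef_of scal_def)

lemma scal_additive:
  assumes "x \<in> carrier L" "y \<in> carrier L"
  shows "scal m (x \<oplus>\<^bsub>L\<^esub> y) = scal m x \<oplus>\<^bsub>L\<^esub> scal m y"
proof -
  have succ: "scal (int (Suc k)) z = scal (int k) z \<oplus>\<^bsub>L\<^esub> z" if "z \<in> carrier L" for k z
    using that by (simp add: scal_def frag_cmul_distrib val_add val_frag_of M.a_comm)
  have neg: "scal (- k) z = \<ominus>\<^bsub>L\<^esub> scal k z" for k z
    using val_diff[of 0 "frag_cmul k (frag_of z)"] by (simp add: scal_def M.minus_eq)
  have cl: "scal k z \<in> carrier L" for k z by (simp add: scal_def)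
  have pos: "scal (int k) (x \<oplus>\<^bsub>L\<^esub> y) = scal (int k) x \<oplus>\<^bsub>L\<^esub> scal (int k) y" for k
  proof (induction k)
    case 0
    then show ?case by (simp add: scal_def)
  next
    case (Suc k)
    then show ?case
      using succ[of "x \<oplus>\<^bsub>L\<^esub> y" k] succ[of x k] succ[of y k] assms cl by (simp del: of_nat_Suc add: M.a_ac)
  qed
  show ?thesis
  proof (cases m)
    case (nonneg k)
    then show ?thesis using pos by simp
  next
    case (neg k)
    have "scal (- int (Suc k)) (x \<oplus>\<^bsub>L\<^esub> y) = scal (- int (Suc k)) x \<oplus>\<^bsub>L\<^esub> scal (- int (Suc k)) y"
      unfolding \<open>\<And>k z. scal (- k) z = \<ominus>\<^bsub>L\<^esub> scal k z\<close> pos by (simp add: cl M.minus_add)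
    then show ?thesis using neg by simp
  qed
qed

lemma addf_scal: "addf (scal m)"
  by (simp add: addf_def scal_additive) (simp add: scal_def)

lemma null_sum: "x \<in> carrier L \<Longrightarrow> y \<in> carrier L \<Longrightarrow>
    frag_of (x \<oplus>\<^bsub>L\<^esub> y, i) - (frag_of (x, i) + frag_of (y, i)) \<in> null"
  by (auto simp: null_def additive_map_simps[OF additive_coef] val_diff val_add coef_of_val scal_additive
      M.minus_eq M.r_neg addfD(1)[OF addf_scal])

lemma null_zero: "frag_of (\<zero>\<^bsub>L\<^esub>, i) \<in> null"
  by (simp add: null_def coef_of_val addf_zero[OF addf_scal])

lemma lbr_antisym: "lbr f g + lbr g f \<in> null"
proof -
  have 1: "lbr (frag_of (x, i)) (frag_of (y, k)) + lbr (frag_of (y, k)) (frag_of (x, i)) \<in> null" for x i y k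
  proof (cases "x \<in> carrier L \<and> y \<in> carrier L")
    case True
    have z: "bracket L x y \<oplus>\<^bsub>L\<^esub> bracket L y x = \<zero>\<^bsub>L\<^esub>"
    proof -
      have "bracket L (x \<oplus>\<^bsub>L\<^esub> y) (x \<oplus>\<^bsub>L\<^esub> y)
        = (bracket L x x \<oplus>\<^bsub>L\<^esub> bracket L y x) \<oplus>\<^bsub>L\<^esub> (bracket L x y \<oplus>\<^bsub>L\<^esub> bracket L y y)"
        using True by (simp only: bracket_add_left bracket_add_right bracket_closed M.add.m_closed)
      then show ?thesis using True bracket_self[of "x \<oplus>\<^bsub>L\<^esub> y"] bracket_self[of x] bracket_self[of y]
        by (simp add: bracket_closed M.a_comm)
    qed
    have "frag_of (bracket L x y \<oplus>\<^bsub>L\<^esub> bracket L y x, i + k)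
        - (frag_of (bracket L x y, i + k) + frag_of (bracket L y x, i + k)) \<in> null"
      using True by (intro null_sum bracket_closed) auto
    then have "frag_of (bracket L x y, i + k) + frag_of (bracket L y x, i + k) \<in> null"
      using null_zero[of "i + k"] z add_subgroup_cong[OF null_subgroup] by auto
    then show ?thesis using True by (simp add: lbr_of add.commute)
  qed (auto simp: lbr_of add_subgroup_zero[OF null_subgroup])
  have 2: "lbr (frag_of (x, i)) g + lbr g (frag_of (x, i)) \<in> null" for x i
    by (rule additive_map_frag_mem[OF additive_add[OF additive_lbr_right additive_lbr_left] null_subgroup])
      (use 1 in auto)
  show ?thesis
    by (rule additive_map_frag_mem[OF additive_add[OF additive_lbr_left additive_lbr_right] null_subgroup])
      (use 2 in auto)
qed

lemma lbr_self: "lbr f f \<in> null"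
proof (induction f rule: frag_induct)
  case (one x)
  obtain y k where "x = (y, k)" by fastforce
  then show ?case by (auto simp: lbr_of bracket_self null_zero add_subgroup_zero[OF null_subgroup])
next
  case (diff a b)
  have "lbr (a - b) (a - b) = lbr a a + lbr b b - (lbr a b + lbr b a)"
    by (simp add: additive_map_simps[OF additive_lbr_left] additive_map_simps[OF additive_lbr_right] algebra_simps)
  then show ?case using diff lbr_antisym add_subgroup_add[OF null_subgroup] add_subgroup_diff[OF null_subgroup] by metis
qed (simp_all add: additive_map_simps[OF additive_lbr_left] add_subgroup_zero[OF null_subgroup])

definition jac :: "('l \<times> int \<Rightarrow>\<^sub>0 int) \<Rightarrow> ('l \<times> int \<Rightarrow>\<^sub>0 int) \<Rightarrow> ('l \<times> int \<Rightarrow>\<^sub>0 int) \<Rightarrow> ('l \<times> int \<Rightarrow>\<^sub>0 int)"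
  where "jac f g h = lbr (lbr f g) h + lbr (lbr g h) f + lbr (lbr h f) g"

lemma lbr_jacobi: "jac f g h \<in> null"
proof -
  note L1 = additive_map_simps(1)[OF additive_lbr_left] additive_map_simps(1)[OF additive_lbr_right]
  have add1: "additive_map (\<lambda>f. jac f g h)" for g h by (simp add: additive_map_def jac_def L1)
  have add2: "additive_map (\<lambda>g. jac f g h)" for f h by (simp add: additive_map_def jac_def L1)
  have add3: "additive_map (\<lambda>h. jac f g h)" for f g by (simp add: additive_map_def jac_def L1)
  have 1: "jac (frag_of a) (frag_of b) (frag_of c) \<in> null" for a b c
  proof -
    obtain x i y j z k where e: "a = (x, i)" "b = (y, j)" "c = (z, k)" by (metis surj_pair)
    show ?thesis
    proof (cases "x \<in> carrier L \<and> y \<in> carrier L \<and> z \<in> carrier L")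
      case True
      let ?A = "bracket L (bracket L x y) z" and ?B = "bracket L (bracket L y z) x" and ?C = "bracket L (bracket L z x) y"
      let ?s = "i + j + k"
      have cl: "?A \<in> carrier L" "?B \<in> carrier L" "?C \<in> carrier L" using True by (auto intro: bracket_closed)
      have "frag_of (?A \<oplus>\<^bsub>L\<^esub> ?B \<oplus>\<^bsub>L\<^esub> ?C, ?s) - (frag_of (?A \<oplus>\<^bsub>L\<^esub> ?B, ?s) + frag_of (?C, ?s)) \<in> null"
        using cl by (intro null_sum) auto
      moreover have "frag_of (?A \<oplus>\<^bsub>L\<^esub> ?B \<oplus>\<^bsub>L\<^esub> ?C, ?s) \<in> null" using jacobi[of x y z] True null_zero by simp
      ultimately have "frag_of (?A \<oplus>\<^bsub>L\<^esub> ?B, ?s) + frag_of (?C, ?s) \<in> null"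
        using add_subgroup_cong[OF null_subgroup] by blast
      moreover have "frag_of (?A \<oplus>\<^bsub>L\<^esub> ?B, ?s) - (frag_of (?A, ?s) + frag_of (?B, ?s)) \<in> null"
        using cl by (intro null_sum) auto
      ultimately have "(frag_of (?A \<oplus>\<^bsub>L\<^esub> ?B, ?s) + frag_of (?C, ?s))
        - (frag_of (?A \<oplus>\<^bsub>L\<^esub> ?B, ?s) - (frag_of (?A, ?s) + frag_of (?B, ?s))) \<in> null"
        by (rule add_subgroup_diff[OF null_subgroup])
      then show ?thesis using True by (simp add: e jac_def lbr_of bracket_closed algebra_simps)
    qed (auto simp: e jac_def lbr_of additive_map_simps[OF additive_lbr_left] add_subgroup_zero[OF null_subgroup])
  qed
  have 2: "jac (frag_of a) (frag_of b) h \<in> null" for a b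
    by (rule additive_map_frag_mem[OF add3 null_subgroup 1])
  have 3: "jac (frag_of a) g h \<in> null" for a
    by (rule additive_map_frag_mem[OF add2 null_subgroup 2])
  show ?thesis by (rule additive_map_frag_mem[OF add1 null_subgroup 3])
qed

sublocale loop: frobenius_graded lbr null n HG rho
proof
  show "additive_map (\<lambda>x. lbr x y)" for y by (rule additive_lbr_left)
  show "additive_map (lbr x)" for x by (rule additive_lbr_right)
  show "add_subgroup null" by (rule null_subgroup)
  show "lbr x y \<in> null" if "x \<in> null" for x y by (rule null_lbr_left[OF that])
  show "lbr x y \<in> null" if "y \<in> null" for x y by (rule null_lbr_right[OF that])
  show "lbr x x \<in> null" for x by (rule lbr_self)
  show "lbr (lbr x y) z + lbr (lbr y z) x + lbr (lbr z x) y \<in> null" for x y z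
    using lbr_jacobi[of x y z] by (simp add: jac_def)
qed (rule n_pos)

end

lemma add_subgroup_int_mult: "add_subgroup S \<Longrightarrow> s \<in> S \<Longrightarrow> k * s \<in> S" for s k :: int
proof (induction k rule: int_induct[where k = 0])
  case base
  then show ?case by (simp add: add_subgroup_zero)
next
  case (step1 i)
  then show ?case using add_subgroup_add[of S "i * s" s] by (simp add: algebra_simps)
next
  case (step2 i)
  then show ?case using add_subgroup_diff[of S "i * s" s] by (simp add: algebra_simps)
qed

lemma nmul_Suc: "nmul (Suc k) x = nmul k x + x"
  by (simp add: nmul_def)

lemma additive_map_nmul: "additive_map f \<Longrightarrow> f (nmul k x) = nmul k (f x)"
  by (simp add: nmul_def additive_map_sum)

lemma add_subgroup_vimage: "additive_map f \<Longrightarrow> add_subgroup S \<Longrightarrow> add_subgroup {x. f x \<in> S}"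
  by (auto simp: add_subgroup_def additive_map_simps)

lemma (in lie_algebra) val_nmul: "val (nmul k u) = ((\<lambda>y. y \<oplus>\<^bsub>L\<^esub> val u) ^^ k) \<zero>\<^bsub>L\<^esub>"
  by (induction k) (simp_all add: nmul_Suc val_add, simp add: nmul_def)

context frobenius_lie
begin

lemma zero_null [simp]: "0 \<in> null"
  by (rule add_subgroup_zero[OF null_subgroup])

lemma null_cong: "x - y \<in> null \<Longrightarrow> x \<in> null \<longleftrightarrow> y \<in> null"
  by (rule add_subgroup_cong[OF null_subgroup])

lemma null_refl: "x - x \<in> null"
  by (simp add: add_subgroup_zero[OF null_subgroup])

lemma null_trans: "x - y \<in> null \<Longrightarrow> y - z \<in> null \<Longrightarrow> x - z \<in> null"
  using add_subgroup_add[OF null_subgroup, of "x - y" "y - z"] by simp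

lemma null_sym: "x - y \<in> null \<Longrightarrow> y - x \<in> null"
  using add_subgroup_uminus[OF null_subgroup, of "x - y"] by simp

lemma shift_zero: "shift 0 u = u"
proof (rule additive_map_frag_eqI[OF additive_shift, of "\<lambda>u. u"])
  show "shift 0 (frag_of z) = frag_of z" for z by (cases z) (simp add: shift_of)
qed (simp add: additive_map_def)

lemma shift_add: "shift (i + j) u = shift i (shift j u)"
proof (rule additive_map_frag_eqI[OF additive_shift additive_comp[OF additive_shift additive_shift]])
  show "shift (i + j) (frag_of z) = shift i (shift j (frag_of z))" for z
    by (cases z) (simp add: shift_of algebra_simps)
qed

lemma lift_shift: "lift f (shift i u) = shift i (lift f u)"
proof (rule additive_map_frag_eqI[OF additive_comp[OF additive_lift additive_shift] additive_comp[OF additive_shift additive_lift]])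
  show "lift f (shift i (frag_of z)) = shift i (lift f (frag_of z))" for z
    by (cases z) (simp add: shift_of lift_of additive_map_simps(2)[OF additive_shift])
qed

lemma shift_lbr_left: "lbr (shift i u) v = shift i (lbr u v)"
proof -
  have 1: "lbr (shift i (frag_of z)) (frag_of w) = shift i (lbr (frag_of z) (frag_of w))" for z w
    by (cases z; cases w) (simp add: shift_of lbr_of algebra_simps additive_map_simps(2)[OF additive_shift])
  have 2: "lbr (shift i (frag_of z)) v = shift i (lbr (frag_of z) v)" for z
    by (rule additive_map_frag_eqI[OF additive_lbr_right additive_comp[OF additive_shift additive_lbr_right] 1])
  show ?thesis
    by (rule additive_map_frag_eqI[OF additive_comp[OF additive_lbr_left additive_shift] additive_comp[OF additive_shift additive_lbr_left] 2])
qed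

lemma shift_lbr_right: "lbr u (shift i v) = shift i (lbr u v)"
proof -
  have 1: "lbr (frag_of w) (shift i (frag_of z)) = shift i (lbr (frag_of w) (frag_of z))" for z w
    by (cases z; cases w) (simp add: shift_of lbr_of algebra_simps additive_map_simps(2)[OF additive_shift])
  have 2: "lbr (frag_of w) (shift i v) = shift i (lbr (frag_of w) v)" for w
    by (rule additive_map_frag_eqI[OF additive_comp[OF additive_lbr_right additive_shift] additive_comp[OF additive_shift additive_lbr_right] 1])
  show ?thesis
    by (rule additive_map_frag_eqI[OF additive_lbr_left additive_comp[OF additive_shift additive_lbr_left] 2])
qed

lemma lift_lbr:
  assumes "f \<in> lie_hom K L L"
  shows "lift f (lbr u v) = lbr (lift f u) (lift f v)"
proof -
  have 1: "lift f (lbr (frag_of z) (frag_of w)) = lbr (lift f (frag_of z)) (lift f (frag_of w))" for z w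
  proof -
    obtain x i y k where e: "z = (x, i)" "w = (y, k)" by (metis surj_pair)
    show ?thesis
      by (cases "x \<in> carrier L"; cases "y \<in> carrier L")
        (simp_all add: e lift_of lbr_of lie_homD[OF assms] bracket_closed additive_map_simps(2)[OF additive_lift]
          additive_map_simps(2)[OF additive_lbr_left] additive_map_simps(2)[OF additive_lbr_right])
  qed
  have 2: "lift f (lbr (frag_of z) v) = lbr (lift f (frag_of z)) (lift f v)" for z
    by (rule additive_map_frag_eqI[OF additive_comp[OF additive_lift additive_lbr_right] additive_comp[OF additive_lbr_right additive_lift] 1])
  show ?thesis
    by (rule additive_map_frag_eqI[OF additive_comp[OF additive_lift additive_lbr_left] additive_comp[OF additive_lbr_left additive_lift] 2])
qed

lemma msk_cong: "n dvd i - j \<Longrightarrow> msk i = msk j"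
  by (simp add: msk_def mask_cong)

lemma shift_period: "n dvd i \<Longrightarrow> shift i u - u \<in> null"
proof (rule additive_map_frag_mem[OF additive_subtract[OF additive_shift, of "\<lambda>u. u"] null_subgroup])
  fix z :: "'l \<times> int" assume "n dvd i"
  obtain x k where z: "z = (x, k)" by fastforce
  have "msk (j - (k + i)) = msk (j - k)" for j by (rule msk_cong) (use \<open>n dvd i\<close> in simp)
  then have "coef j (shift i (frag_of z)) = coef j (frag_of z)" for j by (simp add: z shift_of coef_of)
  then show "shift i (frag_of z) - frag_of z \<in> null"
    by (simp add: null_def additive_map_simps(1)[OF additive_coef])
qed (simp add: additive_map_def)

abbreviation divn :: "('l \<times> int \<Rightarrow>\<^sub>0 int) \<Rightarrow> ('l \<times> int \<Rightarrow>\<^sub>0 int)"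
  where "divn \<equiv> lift (\<lambda>x. d \<odot>\<^bsub>L\<^esub> x)"

lemma null_diffI: "(\<And>j. val (coef j u) = val (coef j v)) \<Longrightarrow> u - v \<in> null"
  by (simp add: null_def additive_map_simps(1)[OF additive_coef] val_diff M.minus_eq M.r_neg)

lemma nmul_divn: "u - nmul (nat n) (divn u) \<in> null"
proof (rule null_diffI)
  fix j
  have "val (coef j (divn u)) = d \<odot>\<^bsub>L\<^esub> val (coef j u)" by (rule coef_map[OF addf_smult[OF d_closed]])
  then show "val (coef j u) = val (coef j (nmul (nat n) (divn u)))"
    by (simp add: additive_map_nmul[OF additive_coef] val_nmul d_inverse)
qed

lemma nmul_null: "u \<in> null \<Longrightarrow> nmul k u \<in> null"
  by (rule nmul_mem[OF null_subgroup])

lemma nmul_torsion: "nmul (nat n) u \<in> null \<Longrightarrow> u \<in> null"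
  using lift_null[OF addf_smult[OF d_closed], of "nmul (nat n) u"] nmul_divn[of u] null_cong
  by (simp add: additive_map_nmul[OF additive_lift])

lemma frag_cmul_sum_scalars: "frag_cmul (\<Sum>t\<in>I. m t) a = (\<Sum>t\<in>I. frag_cmul (m t) a)"
  by (induction I rule: infinite_finite_induct) (simp_all add: frag_cmul_distrib)

text \<open>The exponents \<open>s\<close> with \<open>\<omega>^s f = f\<close> form a group that contains \<open>i\<close> and \<open>n\<close>, hence \<open>n/p\<close> for some prime \<open>p\<close>
  dividing \<open>n\<close>. Therefore \<open>p f = \<Sum>\<^sub>t \<omega>^(t n/p) f\<close>, which is \<open>0\<close> by \<open>mask_sum\<close>; and \<open>p\<close> is invertible.\<close>

lemma shift_cancel:
  assumes i: "\<not> n dvd i" and f: "shift i f - f \<in> null"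
  shows "f \<in> null"
proof -
  define P where "P = {s. shift s f - f \<in> null}"
  have P: "add_subgroup P" unfolding add_subgroup_def
  proof (intro conjI ballI)
    show "0 \<in> P" by (simp add: P_def shift_zero null_refl)
    fix s t assume st: "s \<in> P" "t \<in> P"
    have e: "shift (s - t) (shift t f) = shift s f" by (simp flip: shift_add)
    have "shift (s - t) (shift t f - f) \<in> null" by (rule shift_null) (use st in \<open>simp add: P_def\<close>)
    then have "shift s f - shift (s - t) f \<in> null" by (simp add: e additive_map_simps(1)[OF additive_shift])
    then show "s - t \<in> P" using st null_trans[OF null_sym, of "shift s f"] by (auto simp: P_def)
  qed
  have nP: "n \<in> P" "i \<in> P" using shift_period[of n f] f by (auto simp: P_def)
  define g where "g = gcd i n"
  have g: "g dvd n" "g > 0" using n_pos by (auto simp: g_def)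
  have "g \<noteq> n" using i unfolding g_def by (metis gcd_dvd1)
  then have "n div g \<noteq> 1" using g by (metis dvd_div_mult_self mult_1)
  moreover have "n div g > 0" using g n_pos by (simp add: pos_imp_zdiv_pos_iff zdvd_imp_le)
  ultimately obtain p where p: "normalization_semidom_class.prime p" "p dvd n div g"
    using prime_divisor_exists[of "n div g"] by (auto simp: zdvd1_eq)
  have pn: "p dvd n" using p(2) g by (metis dvd_div_mult_self dvd_mult2)
  have p0: "p > 0" using p(1) by (simp add: prime_gt_0_int)
  have "n div p \<in> P"
  proof -
    obtain k where k: "n div g = p * k" using p(2) by blast
    then have "n = p * (k * g)" using g by (metis dvd_div_mult_self mult.assoc)
    then have "n div p = k * g" using p0 by (metis nonzero_mult_div_cancel_left order_less_irrefl)
    moreover obtain u v where "u * i + v * n = g" using bezout_int[of i n] g_def by auto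
    then have "g \<in> P" using add_subgroup_add[OF P add_subgroup_int_mult[OF P nP(2), of u] add_subgroup_int_mult[OF P nP(1), of v]] by simp
    ultimately show ?thesis using add_subgroup_int_mult[OF P] by simp
  qed
  then have per: "shift (int t * (n div p)) f - f \<in> null" for t
    using add_subgroup_int_mult[OF P, of "n div p" "int t"] by (simp add: P_def)
  have "(\<Sum>t<nat p. coef (j - int t * (n div p)) f) = 0" for j
  proof (rule additive_map_frag_eqI[where f = "\<lambda>f. \<Sum>t<nat p. coef (j - int t * (n div p)) f" and g = "\<lambda>_. 0"])
    show "additive_map (\<lambda>f. \<Sum>t<nat p. coef (j - int t * (n div p)) f)"
      by (simp add: additive_map_def additive_map_simps(1)[OF additive_coef] sum_subtractf)
    fix z :: "'l \<times> int"
    obtain x k where z: "z = (x, k)" by fastforce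
    have "(\<Sum>t<nat p. msk (j - k - int t * (n div p))) = 0"
      unfolding msk_def by (rule mask_sum) (use p pn p0 plist(1) in auto)
    moreover have "(\<Sum>t<nat p. msk (j - int t * (n div p) - k)) = (\<Sum>t<nat p. msk (j - k - int t * (n div p)))"
      by (rule sum.cong) (simp_all add: algebra_simps)
    ultimately show "(\<Sum>t<nat p. coef (j - int t * (n div p)) (frag_of z)) = 0"
      by (cases "x \<in> carrier L") (simp_all add: z coef_of flip: frag_cmul_sum_scalars)
  qed (simp add: additive_map_def)
  then have "(\<Sum>t<nat p. shift (int t * (n div p)) f) \<in> null"
    by (simp add: null_def additive_map_sum[OF additive_coef] coef_shift)
  moreover have "(\<Sum>t<nat p. shift (int t * (n div p)) f) - nmul (nat p) f \<in> null"
    unfolding nmul_def sum_subtractf[symmetric] by (intro add_subgroup_sum[OF null_subgroup] per)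
  ultimately have "nmul (nat p) f \<in> null" using null_cong by blast
  then have "nmul (nat (n div p)) (nmul (nat p) f) \<in> null" by (rule nmul_null)
  moreover have "nat n = nat (n div p) * nat p"
    using p0 pn n_pos by (metis dvd_div_mult_self nat_mult_distrib pos_imp_zdiv_nonneg_iff order_less_imp_le)
  ultimately have "nmul (nat n) f \<in> null" by (simp only: nmul_mult)
  then show ?thesis by (rule nmul_torsion)
qed

lemma shift_geometric:
  assumes "\<not> n dvd i" shows "(\<Sum>t<nat n. shift (int t * i) y) \<in> null"
proof (rule shift_cancel[OF assms])
  have "shift i (\<Sum>t<nat n. shift (int t * i) y) = (\<Sum>t<nat n. shift (int (Suc t) * i) y)"
    by (simp add: additive_map_sum[OF additive_shift] shift_add[symmetric] algebra_simps)
  also have "\<dots> - (\<Sum>t<nat n. shift (int t * i) y) = shift (int (nat n) * i) y - shift (int 0 * i) y"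
    unfolding sum_subtractf[symmetric] by (rule sum_lessThan_telescope)
  also have "\<dots> \<in> null" using n_pos shift_period[of "n * i" y] by (simp add: shift_zero)
  finally show "shift i (\<Sum>t<nat n. shift (int t * i) y) - (\<Sum>t<nat n. shift (int t * i) y) \<in> null" .
qed

text \<open>The eigenspace of \<open>chi\<close> for the eigenvalue \<open>\<omega>^i\<close>.\<close>

definition eig :: "int \<Rightarrow> ('l \<times> int \<Rightarrow>\<^sub>0 int) set"
  where "eig i = {f. lift chi f - shift i f \<in> null}"

lemma shift_cong: "n dvd i - j \<Longrightarrow> shift i u - shift j u \<in> null"
  using shift_period[of "i - j" "shift j u"] by (simp flip: shift_add)

lemma eig_iff_cong: "n dvd i - j \<Longrightarrow> f \<in> eig i \<longleftrightarrow> f \<in> eig j"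
  unfolding eig_def using shift_cong[of i j f] null_trans null_sym by blast

lemma additive_eig_map: "additive_map (\<lambda>f. lift chi f - shift i f)"
  by (intro additive_subtract additive_lift additive_shift)

lemma eig_subgroup: "add_subgroup (eig i)"
  unfolding eig_def by (rule add_subgroup_vimage[OF additive_eig_map null_subgroup])

lemma chi_addf: "addf chi" and hact_addf: "h \<in> H \<Longrightarrow> addf (hact h)"
  using addf_lie_hom chi_hom hact_hom by auto

lemma eig_lbr: "u \<in> eig i \<Longrightarrow> v \<in> eig j \<Longrightarrow> lbr u v \<in> eig (i + j)"
proof -
  assume "u \<in> eig i" "v \<in> eig j"
  then have uv: "lift chi u - shift i u \<in> null" "lift chi v - shift j v \<in> null" by (auto simp: eig_def)
  have "lbr (lift chi u - shift i u) (lift chi v) + lbr (shift i u) (lift chi v - shift j v) \<in> null"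
    by (intro add_subgroup_add null_subgroup null_lbr_left null_lbr_right uv)
  moreover have "lbr (shift i u) (shift j v) = shift (i + j) (lbr u v)"
    unfolding shift_lbr_left shift_lbr_right shift_add[symmetric] by (simp add: add.commute)
  ultimately show ?thesis
    by (simp add: eig_def lift_lbr[OF chi_hom] additive_map_simps(1)[OF additive_lbr_left] additive_map_simps(1)[OF additive_lbr_right])
qed

lemma graded_eig: "loop.graded eig"
  unfolding loop.graded_def
  using eig_iff_cong eig_subgroup eig_lbr by (auto simp: mod_eq_dvd_iff)

lemma null_eig: "u \<in> null \<Longrightarrow> u \<in> eig i"
  by (simp add: eig_def add_subgroup_diff[OF null_subgroup] lift_null[OF chi_addf] shift_null)

lemma eig_zero: "eig 0 \<subseteq> null"
proof
  fix f assume "f \<in> eig 0"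
  then have f: "lift chi f - f \<in> null" by (simp add: eig_def shift_zero)
  show "f \<in> null" unfolding null_def
  proof (intro CollectI allI)
    fix j
    have "chi (val (coef j f)) \<ominus>\<^bsub>L\<^esub> val (coef j f) = \<zero>\<^bsub>L\<^esub>"
      using nullD[OF f, of j] by (simp add: additive_map_simps(1)[OF additive_coef] val_diff coef_map[OF chi_addf])
    then have "chi (val (coef j f)) = val (coef j f)"
    proof -
      let ?v = "val (coef j f)"
      have "chi ?v \<ominus>\<^bsub>L\<^esub> ?v = \<zero>\<^bsub>L\<^esub>" by fact
      moreover have "chi ?v = (chi ?v \<ominus>\<^bsub>L\<^esub> ?v) \<oplus>\<^bsub>L\<^esub> ?v"
        using lie_homD(1)[OF chi_hom, of ?v] by (simp add: M.minus_eq M.a_assoc M.l_neg)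
      ultimately show ?thesis by simp
    qed
    then show "val (coef j f) = \<zero>\<^bsub>L\<^esub>" using chi_fixed by simp
  qed
qed

lemma funpow_chi_closed: "x \<in> carrier L \<Longrightarrow> (chi ^^ t) x \<in> carrier L"
  by (induction t) (auto intro: lie_homD(1)[OF chi_hom])

lemma funpow_lift_of: "x \<in> carrier L \<Longrightarrow> (lift chi ^^ t) (frag_of (x, i)) = frag_of ((chi ^^ t) x, i)"
  by (induction t) (simp_all add: lift_of funpow_chi_closed)

lemma additive_funpow: "additive_map (lift chi ^^ t)"
  by (induction t) (simp_all add: additive_map_def additive_map_simps(1)[OF additive_lift])

lemma lift_chi_period: "(lift chi ^^ nat n) u - u \<in> null"
proof (rule additive_map_frag_mem[OF additive_subtract[OF additive_funpow, of "\<lambda>u. u"] null_subgroup])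
  fix z :: "'l \<times> int"
  obtain x k where z: "z = (x, k)" by fastforce
  show "(lift chi ^^ nat n) (frag_of z) - frag_of z \<in> null"
  proof (cases "x \<in> carrier L")
    case True
    then show ?thesis by (simp add: z funpow_lift_of chi_pow null_refl)
  next
    case False
    then have "frag_of z \<in> null" by (simp add: z null_def coef_of)
    moreover have "(lift chi ^^ t) u \<in> null" if "u \<in> null" for t u
      by (induction t) (simp_all add: that lift_null[OF chi_addf])
    ultimately show ?thesis by (simp add: add_subgroup_diff[OF null_subgroup])
  qed
qed (simp add: additive_map_def)

lemma lift_chi_hact:
  assumes h: "h \<in> H"
  shows "lift chi (lift (hact h) u) = lift (hact h) ((lift chi ^^ nat (rho h)) u)"
proof (rule additive_map_frag_eqI[OF additive_comp[OF additive_lift additive_lift] additive_comp[OF additive_lift additive_funpow]])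
  fix z :: "'l \<times> int"
  obtain x k where z: "z = (x, k)" by fastforce
  show "lift chi (lift (hact h) (frag_of z)) = lift (hact h) ((lift chi ^^ nat (rho h)) (frag_of z))"
  proof (cases "x \<in> carrier L")
    case True
    then show ?thesis
      by (simp add: z lift_of funpow_lift_of funpow_chi_closed chi_hact[OF h] lie_homD(1)[OF hact_hom[OF h]])
  next
    case False
    have "(lift chi ^^ t) (frag_of z) = (if t = 0 then frag_of z else 0)" for t
      by (induction t) (simp_all add: z lift_of False additive_map_simps(2)[OF additive_lift])
    then show ?thesis using False by (simp add: z lift_of additive_map_simps(2)[OF additive_lift])
  qed
qed

lemma funpow_lift_eig:
  assumes "f \<in> eig i" shows "(lift chi ^^ t) f - shift (i * int t) f \<in> null"
proof (induction t)
  case 0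
  then show ?case by (simp add: shift_zero null_refl)
next
  case (Suc t)
  have 1: "lift chi ((lift chi ^^ t) f) - lift chi (shift (i * int t) f) \<in> null"
    using lift_null[OF chi_addf Suc] by (simp add: additive_map_simps(1)[OF additive_lift])
  have "shift (i * int t) (lift chi f - shift i f) \<in> null"
    using assms by (intro shift_null) (simp add: eig_def)
  moreover have "i * int (Suc t) = i * int t + i" by (simp add: algebra_simps)
  ultimately have "lift chi (shift (i * int t) f) - shift (i * int (Suc t)) f \<in> null"
    by (simp only: additive_map_simps(1)[OF additive_shift] lift_shift shift_add)
  with 1 show ?case using null_trans by simp
qed

lemma hact_eig:
  assumes "h \<in> H" "f \<in> eig i" shows "lift (hact h) f \<in> eig (rho h * i)"
proof -
  have "lift (hact h) ((lift chi ^^ nat (rho h)) f - shift (i * int (nat (rho h))) f) \<in> null"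
    by (intro lift_null hact_addf funpow_lift_eig assms)
  then show ?thesis using rho_nonneg[OF assms(1)]
    by (simp add: eig_def lift_chi_hact[OF assms(1)] additive_map_simps(1)[OF additive_lift] lift_shift mult.commute)
qed

text \<open>The projection to the eigenspace of \<open>\<omega>^w\<close>, multiplied by \<open>n\<close>.\<close>

definition proj :: "int \<Rightarrow> ('l \<times> int \<Rightarrow>\<^sub>0 int) \<Rightarrow> ('l \<times> int \<Rightarrow>\<^sub>0 int)"
  where "proj w f = (\<Sum>t<nat n. shift (- w * int t) ((lift chi ^^ t) f))"

lemma additive_proj: "additive_map (proj w)"
  by (simp add: additive_map_def proj_def additive_map_simps(1)[OF additive_funpow]
      additive_map_simps(1)[OF additive_shift] sum_subtractf)

lemma proj_null: "f \<in> null \<Longrightarrow> proj w f \<in> null"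
proof -
  assume f: "f \<in> null"
  have "(lift chi ^^ t) f \<in> null" for t by (induction t) (simp_all add: f lift_null[OF chi_addf])
  then show ?thesis unfolding proj_def by (intro add_subgroup_sum[OF null_subgroup] shift_null)
qed

lemma proj_eig:
  assumes f: "f \<in> eig i"
  shows "n dvd i - w \<Longrightarrow> proj w f - nmul (nat n) f \<in> null" "\<not> n dvd i - w \<Longrightarrow> proj w f \<in> null"
proof -
  have 1: "proj w f - (\<Sum>t<nat n. shift (int t * (i - w)) f) \<in> null"
    unfolding proj_def sum_subtractf[symmetric]
  proof (rule add_subgroup_sum[OF null_subgroup])
    fix t
    have "shift (- w * int t) ((lift chi ^^ t) f - shift (i * int t) f) \<in> null"
      by (intro shift_null funpow_lift_eig f)
    then show "shift (- w * int t) ((lift chi ^^ t) f) - shift (int t * (i - w)) f \<in> null"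
      by (simp add: additive_map_simps(1)[OF additive_shift] shift_add[symmetric] algebra_simps)
  qed
  show "proj w f - nmul (nat n) f \<in> null" if "n dvd i - w"
  proof -
    have "(\<Sum>t<nat n. shift (int t * (i - w)) f) - nmul (nat n) f \<in> null"
      unfolding nmul_def sum_subtractf[symmetric]
      by (intro add_subgroup_sum[OF null_subgroup] shift_period) (use that in simp)
    with 1 show ?thesis by (rule null_trans)
  qed
  show "proj w f \<in> null" if "\<not> n dvd i - w"
    using 1 shift_geometric[OF that] null_cong by blast
qed

text \<open>The eigenspaces are independent modulo \<open>null\<close>: apply \<open>proj w\<close> and divide by \<open>n\<close>.\<close>

lemma homogeneous_part_null:
  assumes "finite S" "\<And>s. s \<in> S \<Longrightarrow> z s \<in> eig (g s)" "(\<Sum>s\<in>S. z s) \<in> null"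
  shows "(\<Sum>s\<in>{s \<in> S. n dvd g s - w}. z s) \<in> null"
proof (rule nmul_torsion)
  let ?T = "{s \<in> S. n dvd g s - w}"
  have "(\<Sum>s\<in>S. proj w (z s)) \<in> null"
    using proj_null[OF assms(3)] by (simp add: additive_map_sum[OF additive_proj])
  moreover have "(\<Sum>s\<in>S. proj w (z s)) = (\<Sum>s\<in>?T. proj w (z s)) + (\<Sum>s\<in>S - ?T. proj w (z s))"
    using assms(1) by (subst add.commute, intro sum.subset_diff) auto
  moreover have "(\<Sum>s\<in>S - ?T. proj w (z s)) \<in> null"
    by (rule add_subgroup_sum[OF null_subgroup]) (use proj_eig(2) assms(2) in auto)
  ultimately have 1: "(\<Sum>s\<in>?T. proj w (z s)) \<in> null"
    using null_cong[of "(\<Sum>s\<in>S. proj w (z s))" "(\<Sum>s\<in>?T. proj w (z s))"] by simp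
  have "(\<Sum>s\<in>?T. proj w (z s)) - (\<Sum>s\<in>?T. nmul (nat n) (z s)) \<in> null"
    unfolding sum_subtractf[symmetric]
    by (rule add_subgroup_sum[OF null_subgroup]) (use proj_eig(1) assms(2) in auto)
  then show "nmul (nat n) (\<Sum>s\<in>?T. z s) \<in> null"
    using 1 null_cong by (simp add: additive_map_sum[OF additive_nmul])
qed

lemma proj_mem: "proj w g \<in> eig w"
proof -
  define F where "F t = shift (- w * (int t - 1)) ((lift chi ^^ t) g)" for t
  have "lift chi (proj w g) - shift w (proj w g) = (\<Sum>t<nat n. F (Suc t) - F t)"
    by (simp add: proj_def F_def additive_map_sum[OF additive_lift] additive_map_sum[OF additive_shift]
        lift_shift shift_add[symmetric] sum_subtractf algebra_simps)
  also have "\<dots> = F (nat n) - F 0" by (rule sum_lessThan_telescope)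
  also have "\<dots> \<in> null"
  proof -
    have "shift (- w * (n - 1)) ((lift chi ^^ nat n) g - g) \<in> null"
      by (intro shift_null lift_chi_period)
    then have "F (nat n) - shift (- w * (n - 1)) g \<in> null"
      using n_pos by (simp add: F_def additive_map_simps(1)[OF additive_shift])
    moreover have "shift (- w * (n - 1)) g - F 0 \<in> null"
      unfolding F_def by (simp, rule shift_cong) (simp add: algebra_simps)
    ultimately show ?thesis by (rule null_trans)
  qed
  finally show ?thesis by (simp add: eig_def)
qed

lemma sum_proj: "(\<Sum>w<nat n. proj (int w) g) - nmul (nat n) g \<in> null"
proof -
  have "(\<Sum>w<nat n. proj (int w) g) = (\<Sum>t<nat n. \<Sum>w<nat n. shift (int w * (- int t)) ((lift chi ^^ t) g))"
    unfolding proj_def by (subst sum.swap) (simp add: mult.commute)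
  also have "\<dots> = (\<Sum>w<nat n. shift (int w * (- int 0)) ((lift chi ^^ 0) g))
      + (\<Sum>t\<in>{..<nat n} - {0}. \<Sum>w<nat n. shift (int w * (- int t)) ((lift chi ^^ t) g))"
    using n_pos by (intro sum.remove) auto
  also have "\<dots> - nmul (nat n) g = (\<Sum>t\<in>{..<nat n} - {0}. \<Sum>w<nat n. shift (int w * (- int t)) ((lift chi ^^ t) g))"
    by (simp add: shift_zero nmul_def)
  also have "\<dots> \<in> null"
  proof (rule add_subgroup_sum[OF null_subgroup], rule shift_geometric)
    fix t assume "t \<in> {..<nat n} - {0}"
    then show "\<not> n dvd - int t" by (auto dest: zdvd_imp_le)
  qed
  finally show ?thesis .
qed

lemma fixed_lnc:
  defines "LF \<equiv> L\<lparr>carrier := {x \<in> carrier L. \<forall>h\<in>H. hact h x = x}\<rparr>"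
  assumes x: "x \<in> null \<union> {frag_of (y, k) | y k. y \<in> lower_central K LF m}"
    and ys: "set ys \<subseteq> null \<union> {frag_of (y, k) | y k. y \<in> carrier LF}"
  shows "loop.lnc x ys \<in> null \<union> {frag_of (y, k) | y k. y \<in> lower_central K LF (m + length ys)}"
  using x ys
proof (induction ys arbitrary: x m)
  case (Cons v ys)
  have "lbr x v \<in> null \<union> {frag_of (y, k) | y k. y \<in> lower_central K LF (Suc m)}"
  proof (cases "x \<in> null \<or> v \<in> null")
    case True
    then show ?thesis using null_lbr_left null_lbr_right by blast
  next
    case False
    then obtain y k z l where e: "x = frag_of (y, k)" "y \<in> lower_central K LF m" "v = frag_of (z, l)" "z \<in> carrier LF"
      using Cons.prems by auto
    have "bracket LF y z \<in> lower_central K LF (Suc m)"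
      using e by (auto simp: lin_span_def)
    then have b: "bracket L y z \<in> lower_central K LF (Suc m)" by (simp add: LF_def)
    show ?thesis
    proof (cases "y \<in> carrier L \<and> z \<in> carrier L")
      case True
      then show ?thesis using b by (auto simp: e lbr_of)
    qed (auto simp: e lbr_of add_subgroup_zero[OF null_subgroup])
  qed
  from Cons.IH[OF this] show ?case using Cons.prems by simp
qed simp

text \<open>The extension of the fixed-point subalgebra of the complement by \<open>\<omega>\<close>.\<close>

definition fixed_span :: "('l \<times> int \<Rightarrow>\<^sub>0 int) set"
  where "fixed_span = add_span (null \<union> {frag_of (y, k) | y k. y \<in> carrier L \<and> (\<forall>h\<in>H. hact h y = y)})"

lemma fixed_span_lnc:
  assumes "x \<in> fixed_span" "set ys \<subseteq> fixed_span" "length ys = c"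
  shows "loop.lnc x ys \<in> null"
proof (rule loop.lnc_span[OF null_subgroup _ assms[unfolded fixed_span_def]])
  let ?LF = "L\<lparr>carrier := {x \<in> carrier L. \<forall>h\<in>H. hact h x = x}\<rparr>"
  let ?B = "null \<union> {frag_of (y, k) | y k. y \<in> carrier L \<and> (\<forall>h\<in>H. hact h y = y)}"
  fix x ys assume "x \<in> ?B" "set ys \<subseteq> ?B" "length ys = c"
  then have "loop.lnc x ys \<in> null \<union> {frag_of (y, k) | y k. y \<in> lower_central K ?LF (0 + c)}"
    using fixed_lnc[of x 0 ys] by auto
  then show "loop.lnc x ys \<in> null"
    using fix_nilpotent null_zero by (auto simp: nilpotent_class_le_def)
qed

text \<open>On a generator \<open>x \<omega>^k\<close>, the orbit sum is \<open>(\<Sum>\<^sub>h x^h) \<omega>^k\<close> up to relations of \<open>L\<close>, and \<open>\<Sum>\<^sub>h x^h\<close> is fixed.\<close>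

lemma orbit_sum_fixed: "(\<Sum>h\<in>H. lift (hact h) u) \<in> fixed_span"
proof (rule additive_map_frag_mem[where f = "\<lambda>u. \<Sum>h\<in>H. lift (hact h) u"])
  show "additive_map (\<lambda>u. \<Sum>h\<in>H. lift (hact h) u)"
    by (simp add: additive_map_def additive_map_simps(1)[OF additive_lift] sum_subtractf)
  show sg: "add_subgroup fixed_span" by (simp add: fixed_span_def add_subgroup_add_span)
  fix z :: "'l \<times> int"
  obtain x k where z: "z = (x, k)" by fastforce
  show "(\<Sum>h\<in>H. lift (hact h) (frag_of z)) \<in> fixed_span"
  proof (cases "x \<in> carrier L")
    case False
    then show ?thesis by (simp add: z lift_of add_subgroup_zero[OF sg])
  next
    case x: True
    define s where "s = finsum L (\<lambda>h. hact h x) H"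
    have cl: "(\<lambda>h. hact h x) \<in> H \<rightarrow> carrier L" using x lie_homD(1)[OF hact_hom] by auto
    have fs: "f (finsum L y I) = finsum L (\<lambda>i. f (y i)) I" if "addf f" "finite I" "y \<in> I \<rightarrow> carrier L" for f y and I :: "'h set"
      using that(2,3)
    proof (induction I rule: finite_induct)
      case (insert i I)
      then have "f (finsum L y I) = finsum L (\<lambda>i. f (y i)) I" "finsum L y I \<in> carrier L"
        "(\<lambda>i. f (y i)) \<in> I \<rightarrow> carrier L" using addfD(1)[OF that(1)] by auto
      then show ?case using insert addfD[OF that(1)] by (simp add: M.finsum_insert Pi_iff)
    qed (simp add: addf_zero[OF that(1)])
    have "s \<in> carrier L" unfolding s_def using cl by (rule M.finsum_closed)
    moreover have "hact g s = s" if g: "g \<in> H" for g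
    proof -
      have "hact g s = finsum L (\<lambda>h. hact g (hact h x)) H"
        unfolding s_def by (rule fs[OF hact_addf[OF g] finite_H cl])
      also have "\<dots> = finsum L (\<lambda>h. hact (g \<otimes>\<^bsub>HG\<^esub> h) x) H"
        using x g cl lie_homD(1)[OF hact_hom] by (intro M.finsum_cong') (auto simp: hact_mult)
      also have "\<dots> = finsum L (\<lambda>h. hact h x) ((\<lambda>h. g \<otimes>\<^bsub>HG\<^esub> h) ` H)"
        using g cl HG.inj_on_cmult by (intro M.finsum_reindex[symmetric]) auto
      also have "(\<lambda>h. g \<otimes>\<^bsub>HG\<^esub> h) ` H = H" using g HG.surj_const_mult by auto
      finally show ?thesis by (simp add: s_def)
    qed
    ultimately have 1: "frag_of (s, k) \<in> fixed_span" unfolding fixed_span_def by (intro add_span.base) auto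
    have "frag_of (finsum L y I, k) - (\<Sum>i\<in>I. frag_of (y i, k)) \<in> null" if "finite I" "y \<in> I \<rightarrow> carrier L" for y and I :: "'h set"
      using that
    proof (induction I rule: finite_induct)
      case (insert i I)
      then have c: "y i \<in> carrier L" "finsum L y I \<in> carrier L" "y \<in> I \<rightarrow> carrier L" by auto
      have "frag_of (y i \<oplus>\<^bsub>L\<^esub> finsum L y I, k) - (frag_of (y i, k) + frag_of (finsum L y I, k)) \<in> null"
        using c by (intro null_sum)
      from add_subgroup_add[OF null_subgroup this insert.IH[OF c(3)]]
      show ?case using insert c by (simp add: M.finsum_insert algebra_simps)
    qed (simp add: null_zero)
    from this[OF finite_H cl] have 2: "frag_of (s, k) - (\<Sum>h\<in>H. lift (hact h) (frag_of z)) \<in> fixed_span"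
      unfolding fixed_span_def by (intro add_span.base) (simp add: s_def z lift_of x)
    show ?thesis using 1 2 add_subgroup_cong[OF sg] by blast
  qed
qed

text \<open>The sum over all \<open>(h, hs)\<close> is a commutator of \<open>c + 1\<close> orbit sums. It vanishes since the fixed points are nilpotent
  of class at most \<open>c\<close>. The condition in the index set picks out the part of weight \<open>w\<close>.\<close>

lemma homogeneous_orbit_identity:
  assumes x: "x \<in> eig a" and ps: "loop.homog eig ps" "length ps = c"
  shows "(\<Sum>(h, hs)\<in>{(h, hs). h \<in> H \<and> hs \<in> words H c \<and>
            [rho h * a + (\<Sum>(h, p)\<leftarrow>zip hs ps. rho h * fst p) = w] (mod n)}.
          loop.lnc (lift (hact h) x) (map2 (\<lambda>h p. lift (hact h) (snd p)) hs ps)) \<in> null"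
proof -
  let ?S = "H \<times> words H c"
  let ?z = "\<lambda>(h, hs). loop.lnc (lift (hact h) x) (map2 (\<lambda>h p. lift (hact h) (snd p)) hs ps)"
  let ?g = "\<lambda>(h, hs). rho h * a + (\<Sum>(h, p)\<leftarrow>zip hs ps. rho h * fst p)"
  have fin: "finite ?S" using finite_H finite_words by blast
  have "(\<Sum>s\<in>?S. ?z s) \<in> null"
  proof -
    have "loop.lnc (\<Sum>h\<in>H. lift (hact h) x) (map (\<lambda>p. \<Sum>h\<in>H. lift (hact h) p) (map snd ps)) \<in> null"
      by (rule fixed_span_lnc) (use orbit_sum_fixed ps(2) in auto)
    also have "loop.lnc (\<Sum>h\<in>H. lift (hact h) x) (map (\<lambda>p. \<Sum>h\<in>H. lift (hact h) p) (map snd ps))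
      = (\<Sum>h\<in>H. \<Sum>hs\<in>words H c. loop.lnc (lift (hact h) x) (map2 (\<lambda>h. lift (hact h)) hs (map snd ps)))"
      by (simp only: additive_map_sum[OF loop.lnc_additive] loop.lnc_sum_expand length_map ps(2)) (rule sum.swap)
    also have "\<dots> = (\<Sum>s\<in>?S. ?z s)"
      by (simp add: sum.cartesian_product zip_map2 case_prod_unfold o_def)
    finally show ?thesis .
  qed
  moreover have "?z s \<in> eig (?g s)" if "s \<in> ?S" for s
  proof -
    obtain h hs where s: "s = (h, hs)" "h \<in> H" "hs \<in> words H c" using \<open>s \<in> ?S\<close> by auto
    define qs where "qs = map (\<lambda>(h, p). ((rho h * fst p) mod n, lift (hact h) (snd p))) (zip hs ps)"
    have hs: "set hs \<subseteq> H" using s(3) by (simp add: words_def)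
    have "loop.homog eig qs" unfolding loop.homog_def
    proof
      fix q assume "q \<in> set qs"
      then obtain h p where q: "(h, p) \<in> set (zip hs ps)" "q = ((rho h * fst p) mod n, lift (hact h) (snd p))"
        by (auto simp: qs_def)
      have "h \<in> H" "p \<in> set ps" using q(1) hs by (auto dest: set_zip_leftD set_zip_rightD)
      then have "lift (hact h) (snd p) \<in> eig (rho h * fst p)"
        using ps(1) by (intro hact_eig) (auto simp: loop.homog_def)
      then show "fst q \<in> {0..<n} \<and> snd q \<in> eig (fst q)"
        using q(2) n_pos eig_iff_cong[of "rho h * fst p" "(rho h * fst p) mod n"]
        by (simp add: minus_mod_eq_mult_div)
    qed
    from loop.lc_mem[OF graded_eig hact_eig[OF s(2) x] this]
    have 1: "loop.lnc (lift (hact h) x) (map snd qs) \<in> eig (rho h * a + sum_list (map fst qs))" .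
    have 2: "map snd qs = map2 (\<lambda>h p. lift (hact h) (snd p)) hs ps"
      by (simp add: qs_def case_prod_unfold o_def)
    have 3: "n dvd (rho h * a + (\<Sum>(h, p)\<leftarrow>zs. rho h * fst p))
      - (rho h * a + sum_list (map fst (map (\<lambda>(h, p). ((rho h * fst p) mod n, lift (hact h) (snd p))) zs)))" for zs
    proof (induction zs)
      case (Cons z zs)
      have "n dvd rho (fst z) * fst (snd z) - (rho (fst z) * fst (snd z)) mod n" by (simp add: minus_mod_eq_mult_div)
      from dvd_add[OF this Cons] show ?case by (simp add: case_prod_unfold algebra_simps)
    qed simp
    show ?thesis
      using eig_iff_cong[OF 3[of "zip hs ps", folded qs_def]] 1[unfolded 2] unfolding s(1) prod.case by blast
  qed
  ultimately have "(\<Sum>s\<in>{s \<in> ?S. n dvd ?g s - w}. ?z s) \<in> null"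
    using homogeneous_part_null[OF fin, of ?z ?g w] by blast
  moreover have "{s \<in> ?S. n dvd ?g s - w} = {(h, hs). h \<in> H \<and> hs \<in> words H c \<and>
            [rho h * a + (\<Sum>(h, p)\<leftarrow>zip hs ps. rho h * fst p) = w] (mod n)}"
    by (auto simp: cong_iff_dvd_diff)
  ultimately show ?thesis by simp
qed

sublocale fa: frobenius_action lbr null n HG rho "\<lambda>h. lift (hact h)" shift eig c
proof
  show "h \<in> H \<Longrightarrow> additive_map (lift (hact h))" for h by (rule additive_lift)
  show "lift (hact h) (lbr x y) = lbr (lift (hact h) x) (lift (hact h) y)" if "h \<in> H" for h x y
    by (rule lift_lbr[OF hact_hom[OF that]])
  show "lift (hact \<one>\<^bsub>HG\<^esub>) x - x \<in> null" for x
    by (rule null_diffI) (simp add: coef_map[OF hact_addf[OF HG.one_closed]] hact_one)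
  show "lift (hact h) x \<in> eig (rho h * i)" if "h \<in> H" "x \<in> eig i" for h x i
    using hact_eig that .
  show "additive_map (shift i)" for i by (rule additive_shift)
  show "lbr (shift i x) y = shift i (lbr x y)" for i x y by (rule shift_lbr_left)
  show "lbr x (shift i y) = shift i (lbr x y)" for i x y by (rule shift_lbr_right)
  show "shift i x \<in> null" if "x \<in> null" for x i using shift_null that .
  show "shift 0 x = x" for x by (rule shift_zero)
  show "shift (i + j) x = shift i (shift j x)" for i j x by (rule shift_add)
  show "shift i x - x \<in> null" if "n dvd i" for i x using shift_period that .
  show "x \<in> null" if "\<not> n dvd i" "shift i x - x \<in> null" for i x using shift_cancel that .
  show "shift j x \<in> eig i" if "x \<in> eig i" for x i j
  proof -
    have "shift j (lift chi x - shift i x) \<in> null" using that by (intro shift_null) (simp add: eig_def)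
    then show ?thesis
      by (simp add: eig_def lift_shift additive_map_simps(1)[OF additive_shift] shift_add[symmetric] add.commute)
  qed
  show "loop.graded eig" by (rule graded_eig)
  show "eig 0 \<subseteq> null" by (rule eig_zero)
  show "\<exists>y\<in>eig i. x - nmul (nat n) y \<in> null" if "x \<in> eig i" for x i
  proof (rule bexI[of _ "divn x"])
    show "x - nmul (nat n) (divn x) \<in> null" by (rule nmul_divn)
    have "lift chi (divn x) = divn (lift chi x)"
    proof (rule additive_map_frag_eqI[OF additive_comp[OF additive_lift additive_lift] additive_comp[OF additive_lift additive_lift]])
      fix z :: "'l \<times> int"
      obtain y k where z: "z = (y, k)" by fastforce
      show "lift chi (divn (frag_of z)) = divn (lift chi (frag_of z))"
        by (cases "y \<in> carrier L")
          (simp_all add: z lift_of d_closed lie_homD[OF chi_hom] additive_map_simps(2)[OF additive_lift])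
    qed
    moreover have "divn (lift chi x - shift i x) \<in> null"
      using that by (intro lift_null addf_smult d_closed) (simp add: eig_def)
    ultimately show "divn x \<in> eig i"
      by (simp add: eig_def additive_map_simps(1)[OF additive_lift] lift_shift)
  qed
  show "(\<Sum>(h, hs)\<in>{(h, hs). h \<in> H \<and> hs \<in> words H c \<and>
            [rho h * a + (\<Sum>(h, p)\<leftarrow>zip hs ps. rho h * fst p) = w] (mod n)}.
          loop.lnc (lift (hact h) x) (map2 (\<lambda>h p. lift (hact h) (snd p)) hs ps)) \<in> null"
    if "x \<in> eig a" "loop.homog eig ps" "length ps = c" for x a ps w
    using homogeneous_orbit_identity that .
qed

text \<open>The projections sum up to multiplication by \<open>n\<close>, which \<open>divn\<close> inverts.\<close>

lemma total_eig: "u \<in> fa.tot eig"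
proof -
  have sub: "null \<subseteq> fa.tot eig" using null_eig fa.tot_base by blast
  have "(\<Sum>w<nat n. proj (int w) (divn u)) \<in> fa.tot eig"
    by (rule add_subgroup_sum[OF fa.tot_subgroup]) (rule fa.tot_base, rule proj_mem)
  moreover have "u - (\<Sum>w<nat n. proj (int w) (divn u)) \<in> fa.tot eig"
    using null_trans[OF nmul_divn null_sym[OF sum_proj]] sub by blast
  ultimately show ?thesis using add_subgroup_cong[OF fa.tot_subgroup] by blast
qed

text \<open>A commutator of elements of \<open>L\<close>, seen as a formal sum with the exponent \<open>0\<close> only, lies in \<open>null\<close>. It is itself
  the coefficient at \<open>0\<close>, as \<open>mask_zero\<close> shows.\<close>

theorem commutator_vanishes:
  assumes "x \<in> carrier L" "set ys \<subseteq> carrier L" "length ys = nil_bound c q"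
  shows "foldl (bracket L) x ys = \<zero>\<^bsub>L\<^esub>"
proof -
  have e: "loop.lnc (frag_of (x, 0)) (map (\<lambda>y. frag_of (y, 0)) ys) = frag_of (foldl (bracket L) x ys, 0)
      \<and> foldl (bracket L) x ys \<in> carrier L" if "x \<in> carrier L" "set ys \<subseteq> carrier L" for x ys
    using that by (induction ys arbitrary: x) (auto simp: lbr_of bracket_closed)
  have "loop.lnc (frag_of (x, 0)) (map (\<lambda>y. frag_of (y, 0)) ys) \<in> null"
    by (rule fa.total_nilpotent) (use assms(3) total_eig in auto)
  then have "val (coef 0 (frag_of (foldl (bracket L) x ys, 0))) = \<zero>\<^bsub>L\<^esub>" using e[OF assms(1,2)] nullD by metis
  moreover have "msk 0 = 1" unfolding msk_def
    by (rule mask_zero[OF n_pos plist(2)]) (simp add: plist(1))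
  ultimately show ?thesis using e[OF assms(1,2)] by (simp add: coef_of val_frag_of)
qed

end

section \<open>Reduction to an order prime to the characteristic\<close>

primrec rnat :: "('k, 'r) ring_scheme \<Rightarrow> nat \<Rightarrow> 'k"
  where
    "rnat R 0 = \<zero>\<^bsub>R\<^esub>"
  | "rnat R (Suc m) = rnat R m \<oplus>\<^bsub>R\<^esub> \<one>\<^bsub>R\<^esub>"

context field
begin

lemma rnat_closed [simp]: "rnat R m \<in> carrier R"
  by (induction m) auto

lemma rnat_add: "rnat R (a + b) = rnat R a \<oplus> rnat R b"
  by (induction b) (simp_all add: a_assoc)

lemma rnat_mult: "rnat R (a * b) = rnat R a \<otimes> rnat R b"
  by (induction a) (simp_all add: rnat_add l_distr a_comm)

lemma rnat_prime_divisor: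
  "0 < N \<Longrightarrow> rnat R N = \<zero> \<Longrightarrow> \<exists>p. normalization_semidom_class.prime p \<and> p dvd N \<and> rnat R p = \<zero>"
proof (induction N rule: less_induct)
  case (less N)
  have "N \<noteq> 1" using less.prems by auto
  then obtain p where p: "normalization_semidom_class.prime p" "p dvd N"
    using prime_factor_nat by blast
  obtain m where m: "N = p * m" using p(2) by blast
  have "m < N" "0 < m" using less.prems(1) m prime_gt_1_nat[OF p(1)] by auto
  have "rnat R p = \<zero> \<or> rnat R m = \<zero>" using less.prems(2) integral by (simp add: m rnat_mult)
  then show ?case
  proof
    assume "rnat R m = \<zero>"
    then obtain p' where "normalization_semidom_class.prime p'" "p' dvd m" "rnat R p' = \<zero>"
      using less.IH[OF \<open>m < N\<close> \<open>0 < m\<close>] by blast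
    then show ?thesis using m by (metis dvd_mult)
  qed (use p in blast)
qed

text \<open>The factor \<open>p^k\<close> is the power of the characteristic in \<open>N\<close>. If \<open>N\<close> is invertible in the field, take \<open>k = 0\<close> and \<open>p = 1\<close>,
  which is coprime to everything.\<close>

lemma characteristic_part:
  assumes "0 < N"
  obtains p k n where "N = p ^ k * n" "coprime p n" "rnat R n \<noteq> \<zero>"
    "k = 0 \<or> normalization_semidom_class.prime p \<and> rnat R p = \<zero>"
proof (cases "rnat R N = \<zero>")
  case False
  then show ?thesis using that[of 1 0 N] by simp
next
  case True
  then obtain p where p: "normalization_semidom_class.prime p" "p dvd N" "rnat R p = \<zero>"
    using rnat_prime_divisor assms by blast
  define k where "k = multiplicity p N"
  obtain n where n: "N = p ^ k * n" unfolding k_def using multiplicity_dvd by blast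
  have "\<not> is_unit p" "N \<noteq> 0" using p(1) assms by auto
  then have "\<not> p dvd n"
    using n multiplicity_decompose[of N p] unfolding k_def
    by (metis assms mult_cancel_left nonzero_mult_div_cancel_left power_not_zero p(1) not_prime_0)
  then have c: "coprime p n" using p(1) by (simp add: prime_imp_coprime)
  have "rnat R n \<noteq> \<zero>"
  proof
    assume "rnat R n = \<zero>"
    moreover have "p \<noteq> 0" using p(1) by auto
    then obtain x y where "p * x = n * y + 1" using bezout_nat[of p n] c by (auto simp: coprime_iff_gcd_eq_1)
    ultimately have "rnat R p \<otimes> rnat R x = \<zero> \<otimes> rnat R y \<oplus> \<one>"
      by (metis One_nat_def add_0 rnat.simps rnat_add rnat_closed rnat_mult l_zero one_closed)
    then show False using p(3) by simp
  qed
  then show ?thesis using that[OF n c] p by blast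
qed

end

text \<open>The binomial theorem for \<open>T = 1 + S\<close>.\<close>

lemma binomial_operator:
  fixes T :: "'a::ab_group_add \<Rightarrow> 'a"
  assumes T: "additive_map T"
  defines "S \<equiv> \<lambda>x. T x - x"
  shows "(T ^^ j) u = (\<Sum>i\<le>j. nmul (j choose i) ((S ^^ i) u))"
proof (induction j)
  case 0
  then show ?case by (simp add: nmul_def)
next
  case (Suc j)
  let ?a = "\<lambda>i. (S ^^ i) u"
  have na: "nmul (a + b) x = nmul a x + nmul b x" for a b and x :: 'a
    by (induction b) (simp_all add: nmul_Suc add.assoc, simp add: nmul_def)
  have nd: "nmul k (x + y) = nmul k x + nmul k y" for k and x y :: 'a
    by (rule additive_map_simps(4)[OF additive_nmul])
  have "(T ^^ Suc j) u = (\<Sum>i\<le>j. nmul (j choose i) (T (?a i)))"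
    by (simp add: Suc additive_map_sum[OF T] additive_map_nmul[OF T])
  also have "\<dots> = (\<Sum>i\<le>j. nmul (j choose i) (?a i + ?a (Suc i)))"
    by (simp add: S_def)
  also have "\<dots> = (\<Sum>i\<le>j. nmul (j choose i) (?a i)) + (\<Sum>i\<le>j. nmul (j choose i) (?a (Suc i)))"
    by (simp only: nd sum.distrib)
  also have "(\<Sum>i\<le>j. nmul (j choose i) (?a i)) = (\<Sum>i\<le>Suc j. nmul (j choose i) (?a i))"
    by (simp add: nmul_def binomial_eq_0)
  also have "\<dots> = nmul 1 (?a 0) + (\<Sum>i\<le>j. nmul (j choose Suc i) (?a (Suc i)))"
    by (subst sum.atMost_Suc_shift) simp
  finally have "(T ^^ Suc j) u = nmul 1 (?a 0) + (\<Sum>i\<le>j. nmul (Suc j choose Suc i) (?a (Suc i)))"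
    by (simp add: na sum.distrib add_ac)
  also have "\<dots> = (\<Sum>i\<le>Suc j. nmul (Suc j choose i) (?a i))"
    unfolding sum.atMost_Suc_shift by simp
  finally show ?case .
qed

context lie_algebra
begin

lemma rnat_smult: "x \<in> carrier L \<Longrightarrow> rnat K m \<odot>\<^bsub>L\<^esub> x = ((\<lambda>y. y \<oplus>\<^bsub>L\<^esub> x) ^^ m) \<zero>\<^bsub>L\<^esub>"
  by (induction m) (simp_all add: smult_l_distr)

lemma val_nmul_char: "rnat K p = \<zero>\<^bsub>K\<^esub> \<Longrightarrow> val (nmul p u) = \<zero>\<^bsub>L\<^esub>"
  using rnat_smult[of "val u" p] by (simp add: val_nmul)

text \<open>In characteristic \<open>p\<close>, an operator \<open>t\<close> with \<open>t^p = 1\<close> satisfies \<open>(t - 1)^p = 0\<close>, as the inner binomial coefficients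
  vanish. So a non-zero \<open>x\<close> in \<open>A\<close> leads, by repeated application of \<open>t - 1\<close>, to a non-zero fixed point of \<open>t\<close> in \<open>A\<close>. The operator
  \<open>t\<close> is \<open>f^(p^k)\<close>, so that induction on \<open>k\<close> gives a fixed point of \<open>f\<close>.\<close>

lemma unipotent_fixed_point:
  assumes p: "normalization_semidom_class.prime p" "rnat K p = \<zero>\<^bsub>K\<^esub>" and f: "addf f"
    and A: "A \<subseteq> carrier L" "\<And>x. x \<in> A \<Longrightarrow> f x \<in> A" "\<And>x y. x \<in> A \<Longrightarrow> y \<in> A \<Longrightarrow> x \<ominus>\<^bsub>L\<^esub> y \<in> A"
    and fixed: "\<And>x. x \<in> A \<Longrightarrow> f x = x \<Longrightarrow> x = \<zero>\<^bsub>L\<^esub>"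
  shows "x \<in> A \<Longrightarrow> (f ^^ (p ^ k)) x = x \<Longrightarrow> x = \<zero>\<^bsub>L\<^esub>"
proof (induction k arbitrary: x)
  case 0
  then show ?case using fixed by simp
next
  case (Suc k)
  define t where "t = f ^^ (p ^ k)"
  have addf_pow: "addf (f ^^ m)" for m
  proof (induction m)
    case 0
    then show ?case by (simp add: addf_def)
  next
    case (Suc m)
    then show ?case using f by (auto simp: addf_def)
  qed
  have A_pow: "(f ^^ m) y \<in> A" if "y \<in> A" for m y using that A(2) by (induction m) auto
  define s where "s y = t y \<ominus>\<^bsub>L\<^esub> y" for y
  have sA: "(s ^^ i) y \<in> A" if "y \<in> A" for i y
    using that by (induction i) (auto simp: s_def t_def A_pow A(3))
  define T where "T = frag_extend (restr (\<lambda>x. frag_of (t x)))"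
  define S where "S = (\<lambda>u. T u - u)"
  have T: "additive_map T" by (simp add: T_def additive_frag_extend)
  have tval: "val (T u) = t (val u)" for u
    using val_map[OF addf_pow[of "p ^ k"], of u] by (simp add: T_def t_def)
  have Tpow: "val ((T ^^ j) u) = (t ^^ j) (val u)" for j u by (induction j) (simp_all add: tval)
  have Spow: "val ((S ^^ j) u) = (s ^^ j) (val u)" for j u
    by (induction j) (simp_all add: S_def s_def val_diff tval)
  have xL: "x \<in> carrier L" using Suc.prems A(1) by blast
  have p0: "p > 0" using p(1) by (simp add: prime_gt_0_nat)
  let ?u = "frag_of x"
  have "(T ^^ p) ?u = (\<Sum>i\<le>p. nmul (p choose i) ((S ^^ i) ?u))"
    unfolding S_def by (rule binomial_operator[OF T])
  also have "{..p} = insert 0 (insert p {0<..<p})" using p0 by auto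
  also have "(\<Sum>i\<in>insert 0 (insert p {0<..<p}). nmul (p choose i) ((S ^^ i) ?u))
    = ?u + ((S ^^ p) ?u + (\<Sum>i\<in>{0<..<p}. nmul (p choose i) ((S ^^ i) ?u)))"
    using p0 by (simp add: nmul_def)
  finally have "val ((T ^^ p) ?u) = x \<oplus>\<^bsub>L\<^esub> (val ((S ^^ p) ?u) \<oplus>\<^bsub>L\<^esub> val (\<Sum>i\<in>{0<..<p}. nmul (p choose i) ((S ^^ i) ?u)))"
    by (simp add: val_add val_frag_of xL)
  moreover have "val (\<Sum>i\<in>I. nmul (p choose i) ((S ^^ i) ?u)) = \<zero>\<^bsub>L\<^esub>" if "I \<subseteq> {0<..<p}" for I
  proof -
    have "finite I" using that finite_subset by blast
    then show ?thesis using that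
    proof (induction I rule: finite_induct)
      case (insert i I)
      then have "p dvd (p choose i)" using p(1) by (intro dvd_choose_prime) auto
      then obtain m where "p choose i = p * m" by blast
      then have "val (nmul (p choose i) ((S ^^ i) ?u)) = \<zero>\<^bsub>L\<^esub>"
        by (simp add: nmul_mult val_nmul_char[OF p(2)])
      then show ?case using insert by (simp add: val_add)
    qed simp
  qed
  moreover have "val ((T ^^ p) ?u) = x"
    using Suc.prems(2) by (simp add: Tpow val_frag_of xL t_def funpow_mult mult.commute)
  moreover have sc: "(s ^^ p) x \<in> carrier L" using sA[OF Suc.prems(1)] A(1) by blast
  ultimately have "x = x \<oplus>\<^bsub>L\<^esub> (s ^^ p) x" by (simp add: Spow val_frag_of xL)
  then have sp: "(s ^^ p) x = \<zero>\<^bsub>L\<^esub>" using xL sc by (metis M.add.r_cancel_one' M.a_comm)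
  have "(s ^^ i) x = \<zero>\<^bsub>L\<^esub> \<Longrightarrow> x = \<zero>\<^bsub>L\<^esub>" for i
  proof (induction i)
    case (Suc i)
    let ?y = "(s ^^ i) x"
    have y: "?y \<in> A" "?y \<in> carrier L" "t ?y \<in> carrier L" using sA[OF \<open>x \<in> A\<close>] A(1) A_pow t_def by blast+
    have "t ?y = (t ?y \<ominus>\<^bsub>L\<^esub> ?y) \<oplus>\<^bsub>L\<^esub> ?y" using y by (simp add: M.minus_eq M.a_assoc M.l_neg)
    moreover have "s ?y = \<zero>\<^bsub>L\<^esub>" using Suc.prems by simp
    ultimately have "t ?y = ?y" using y unfolding s_def[of ?y] by simp
    then have "?y = \<zero>\<^bsub>L\<^esub>" using \<open>\<And>x. x \<in> A \<Longrightarrow> (f ^^ (p ^ k)) x = x \<Longrightarrow> x = \<zero>\<^bsub>L\<^esub>\<close> y by (simp add: t_def)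
    then show ?case by (rule Suc.IH)
  qed simp
  then show ?case using sp by blast
qed

lemma lin_span_least: "submodule N K L \<Longrightarrow> S \<subseteq> N \<Longrightarrow> lin_span K L S \<subseteq> N"
  by (auto simp: lin_span_def)

lemma zero_in_lin_span: "\<zero>\<^bsub>L\<^esub> \<in> lin_span K L S"
  unfolding lin_span_def using submodule.axioms(1) subgroup.one_closed by fastforce

lemma foldl_bracket_closed: "x \<in> carrier L \<Longrightarrow> set ys \<subseteq> carrier L \<Longrightarrow> foldl (bracket L) x ys \<in> carrier L"
  by (induction ys arbitrary: x) (auto simp: bracket_closed)

lemma foldl_bracket_add: "x \<in> carrier L \<Longrightarrow> y \<in> carrier L \<Longrightarrow> set ys \<subseteq> carrier L \<Longrightarrow>
  foldl (bracket L) (x \<oplus>\<^bsub>L\<^esub> y) ys = foldl (bracket L) x ys \<oplus>\<^bsub>L\<^esub> foldl (bracket L) y ys"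
  by (induction ys arbitrary: x y) (auto simp: bracket_closed bracket_add_left)

lemma foldl_bracket_smult: "a \<in> carrier K \<Longrightarrow> x \<in> carrier L \<Longrightarrow> set ys \<subseteq> carrier L \<Longrightarrow>
  foldl (bracket L) (a \<odot>\<^bsub>L\<^esub> x) ys = a \<odot>\<^bsub>L\<^esub> foldl (bracket L) x ys"
  by (induction ys arbitrary: x) (auto simp: bracket_closed bracket_smult_left)

lemma submodule_annihilated:
  assumes "\<And>ys. P ys \<Longrightarrow> set ys \<subseteq> carrier L"
  shows "submodule {x \<in> carrier L. \<forall>ys. P ys \<longrightarrow> foldl (bracket L) x ys = \<zero>\<^bsub>L\<^esub>} K L"
proof (rule submoduleI)
  have z: "foldl (bracket L) \<zero>\<^bsub>L\<^esub> ys = \<zero>\<^bsub>L\<^esub>" if "P ys" for ys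
    using foldl_bracket_smult[of "\<zero>\<^bsub>K\<^esub>" "\<zero>\<^bsub>L\<^esub>" ys] assms[OF that] foldl_bracket_closed[of "\<zero>\<^bsub>L\<^esub>" ys] by simp
  then show "\<zero>\<^bsub>L\<^esub> \<in> {x \<in> carrier L. \<forall>ys. P ys \<longrightarrow> foldl (bracket L) x ys = \<zero>\<^bsub>L\<^esub>}" by simp
  show "\<ominus>\<^bsub>L\<^esub> a \<in> {x \<in> carrier L. \<forall>ys. P ys \<longrightarrow> foldl (bracket L) x ys = \<zero>\<^bsub>L\<^esub>}"
    if a: "a \<in> {x \<in> carrier L. \<forall>ys. P ys \<longrightarrow> foldl (bracket L) x ys = \<zero>\<^bsub>L\<^esub>}" for a
  proof -
    have "foldl (bracket L) (\<ominus>\<^bsub>L\<^esub> a) ys = \<zero>\<^bsub>L\<^esub>" if "P ys" for ys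
    proof -
      have c: "foldl (bracket L) (\<ominus>\<^bsub>L\<^esub> a) ys \<in> carrier L"
        using a assms[OF that] by (intro foldl_bracket_closed) auto
      have "foldl (bracket L) (\<ominus>\<^bsub>L\<^esub> a \<oplus>\<^bsub>L\<^esub> a) ys = foldl (bracket L) (\<ominus>\<^bsub>L\<^esub> a) ys \<oplus>\<^bsub>L\<^esub> foldl (bracket L) a ys"
        using a assms[OF that] by (intro foldl_bracket_add) auto
      then show ?thesis using a that z[OF that] c by (simp add: M.l_neg)
    qed
    then show ?thesis using a by simp
  qed
qed (auto simp: foldl_bracket_add foldl_bracket_smult assms)

lemma nilpotent_if_commutators_vanish:
  assumes van: "\<And>x ys. x \<in> carrier L \<Longrightarrow> set ys \<subseteq> carrier L \<Longrightarrow> length ys = N \<Longrightarrow> foldl (bracket L) x ys = \<zero>\<^bsub>L\<^esub>"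
  shows "nilpotent_class_le K L N"
proof -
  have "lower_central K L m \<subseteq> {x \<in> carrier L. \<forall>ys. set ys \<subseteq> carrier L \<and> m + length ys = N \<longrightarrow> foldl (bracket L) x ys = \<zero>\<^bsub>L\<^esub>}" for m
  proof (induction m)
    case 0
    then show ?case using van by auto
  next
    case (Suc m)
    show ?case unfolding lower_central.simps
    proof (rule lin_span_least)
      show "submodule {x \<in> carrier L. \<forall>ys. set ys \<subseteq> carrier L \<and> Suc m + length ys = N \<longrightarrow> foldl (bracket L) x ys = \<zero>\<^bsub>L\<^esub>} K L"
        by (rule submodule_annihilated) simp
      show "{bracket L x y |x y. x \<in> lower_central K L m \<and> y \<in> carrier L}
        \<subseteq> {x \<in> carrier L. \<forall>ys. set ys \<subseteq> carrier L \<and> Suc m + length ys = N \<longrightarrow> foldl (bracket L) x ys = \<zero>\<^bsub>L\<^esub>}"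
      proof clarify
        fix x y assume x: "x \<in> lower_central K L m" and y: "y \<in> carrier L"
        have xc: "x \<in> carrier L" and
          v: "\<And>ys. set ys \<subseteq> carrier L \<Longrightarrow> m + length ys = N \<Longrightarrow> foldl (bracket L) x ys = \<zero>\<^bsub>L\<^esub>"
          using x Suc.IH by auto
        show "bracket L x y \<in> carrier L \<and> (\<forall>ys. set ys \<subseteq> carrier L \<and> Suc m + length ys = N
          \<longrightarrow> foldl (bracket L) (bracket L x y) ys = \<zero>\<^bsub>L\<^esub>)"
        proof (intro conjI allI impI)
          show "bracket L x y \<in> carrier L" using xc y by (rule bracket_closed)
          fix ys assume "set ys \<subseteq> carrier L \<and> Suc m + length ys = N"
          then show "foldl (bracket L) (bracket L x y) ys = \<zero>\<^bsub>L\<^esub>" using v[of "y # ys"] y by simp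
        qed
      qed
    qed
  qed
  from this[of N] have "lower_central K L N \<subseteq> {\<zero>\<^bsub>L\<^esub>}"
    by (auto dest!: subsetD spec[of _ "[]"])
  moreover have "\<zero>\<^bsub>L\<^esub> \<in> lower_central K L N" by (cases N) (auto simp: zero_in_lin_span)
  ultimately show ?thesis by (auto simp: nilpotent_class_le_def)
qed

end

text \<open>Write the order of the kernel as \<open>p^k n\<close>, where \<open>p\<close> is the characteristic and \<open>n\<close> is invertible in the field. The power
  \<open>chi\<close> of the generator has order dividing \<open>n\<close>, and the fixed points of \<open>chi\<close> are acted upon by the \<open>p\<close>-part of the kernel;
  if they were non-zero, so would be those of the whole kernel.\<close>

theorem frobenius_nilpotent:
  fixes G :: "'g monoid" and F H :: "'g set"
    and K :: "'k ring" and L :: "('k, 'l) lie_algebra"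
  assumes fr: "frobenius_group G F H"
    and cyc: "cyclic_group (G\<lparr>carrier := F\<rparr>)" and q: "card H = q"
    and lie: "lie_algebra K L"
    and acts: "acts_by_lie_automorphisms G K L \<phi>"
    and fixF: "fixed_points L \<phi> F = {\<zero>\<^bsub>L\<^esub>}"
    and nil: "nilpotent_class_le K (L\<lparr>carrier := fixed_points L \<phi> H\<rparr>) c"
  shows "nilpotent_class_le K L (nil_bound c q)"
proof -
  interpret G: group G using fr by (simp add: frobenius_group_def)
  interpret F: normal F G using fr by (simp add: frobenius_group_def)
  interpret lie_algebra K L by (rule lie)
  interpret A: group_action G "carrier L" \<phi> using acts by (simp add: acts_by_lie_automorphisms_def)
  have H: "subgroup H G" and fin: "finite (carrier G)"
    and free: "\<And>h f. h \<in> H \<Longrightarrow> h \<noteq> \<one>\<^bsub>G\<^esub> \<Longrightarrow> f \<in> F \<Longrightarrow> f \<otimes>\<^bsub>G\<^esub> h = h \<otimes>\<^bsub>G\<^esub> f \<Longrightarrow> f = \<one>\<^bsub>G\<^esub>"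
    using fr by (auto simp: frobenius_group_def)
  have hom: "g \<in> carrier G \<Longrightarrow> \<phi> g \<in> lie_hom K L L" for g
    using acts by (simp add: acts_by_lie_automorphisms_def)
  have one: "x \<in> carrier L \<Longrightarrow> \<phi> \<one>\<^bsub>G\<^esub> x = x" for x
    using A.id_eq_one by (metis restrict_apply')
  note mult = A.composition_rule
  have HG: "h \<in> H \<Longrightarrow> h \<in> carrier G" for h using H subgroup.subset by blast
  have FG: "f \<in> F \<Longrightarrow> f \<in> carrier G" for f using F.subset by blast
  interpret FF: group "G\<lparr>carrier := F\<rparr>" by (rule G.subgroup_imp_group[OF F.subgroup_axioms])
  obtain f0 where f0: "f0 \<in> F" "F = range (\<lambda>n::int. f0 [^]\<^bsub>G\<lparr>carrier := F\<rparr>\<^esub> n)"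
    using cyc FF.cyclic_group by auto
  have f0G: "f0 \<in> carrier G" using f0 FG by blast
  have Fpow: "F = range (\<lambda>n::int. f0 [^]\<^bsub>G\<^esub> n)"
    using f0 G.int_pow_consistent[OF F.subgroup_axioms f0(1)] by simp
  define N where "N = G.ord f0"
  have N: "N > 0" using G.ord_ge_1[OF fin f0G] by (simp add: N_def)
  have Fnat: "\<exists>r::nat. f = f0 [^]\<^bsub>G\<^esub> r" if "f \<in> F" for f
  proof -
    have "f \<in> generate G {f0}" using that Fpow G.generate_pow[OF f0G] by auto
    then show ?thesis using G.generate_pow_nat[OF f0G] N by (auto simp: N_def)
  qed
  have pow_eq: "f0 [^]\<^bsub>G\<^esub> a = f0 [^]\<^bsub>G\<^esub> b \<longleftrightarrow> [int a = int b] (mod int N)" for a b :: nat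
    using G.int_pow_eq[OF f0G, of "int a" "int b"]
    by (simp add: int_pow_int N_def cong_iff_dvd_diff dvd_diff_commute)
  have "\<exists>r::nat. f0 \<otimes>\<^bsub>G\<^esub> h = h \<otimes>\<^bsub>G\<^esub> f0 [^]\<^bsub>G\<^esub> r" if h: "h \<in> H" for h
  proof -
    obtain r :: nat where "inv\<^bsub>G\<^esub> h \<otimes>\<^bsub>G\<^esub> f0 \<otimes>\<^bsub>G\<^esub> h = f0 [^]\<^bsub>G\<^esub> r"
      using Fnat[OF F.inv_op_closed1[OF HG[OF h] f0(1)]] by blast
    then have "h \<otimes>\<^bsub>G\<^esub> (inv\<^bsub>G\<^esub> h \<otimes>\<^bsub>G\<^esub> f0 \<otimes>\<^bsub>G\<^esub> h) = h \<otimes>\<^bsub>G\<^esub> f0 [^]\<^bsub>G\<^esub> r" by simp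
    then have "f0 \<otimes>\<^bsub>G\<^esub> h = h \<otimes>\<^bsub>G\<^esub> f0 [^]\<^bsub>G\<^esub> r"
      using HG[OF h] f0G by (simp flip: G.m_assoc)
    then show ?thesis by blast
  qed
  then obtain r :: "'g \<Rightarrow> nat" where r: "\<And>h. h \<in> H \<Longrightarrow> f0 \<otimes>\<^bsub>G\<^esub> h = h \<otimes>\<^bsub>G\<^esub> f0 [^]\<^bsub>G\<^esub> r h" by metis
  have conj: "f0 [^]\<^bsub>G\<^esub> t \<otimes>\<^bsub>G\<^esub> h = h \<otimes>\<^bsub>G\<^esub> f0 [^]\<^bsub>G\<^esub> (r h * t)" if h: "h \<in> H" for h and t :: nat
  proof (induction t)
    case 0
    then show ?case using HG[OF h] by simp
  next
    case (Suc t)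
    have "f0 [^]\<^bsub>G\<^esub> Suc t \<otimes>\<^bsub>G\<^esub> h = f0 [^]\<^bsub>G\<^esub> t \<otimes>\<^bsub>G\<^esub> (f0 \<otimes>\<^bsub>G\<^esub> h)"
      using HG[OF h] f0G by (simp add: G.m_assoc)
    also have "\<dots> = (f0 [^]\<^bsub>G\<^esub> t \<otimes>\<^bsub>G\<^esub> h) \<otimes>\<^bsub>G\<^esub> f0 [^]\<^bsub>G\<^esub> r h"
      using HG[OF h] f0G by (simp add: r[OF h] G.m_assoc)
    also have "\<dots> = h \<otimes>\<^bsub>G\<^esub> (f0 [^]\<^bsub>G\<^esub> (r h * t) \<otimes>\<^bsub>G\<^esub> f0 [^]\<^bsub>G\<^esub> r h)"
      using HG[OF h] f0G by (simp add: Suc G.m_assoc)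
    finally show ?case using f0G by (simp add: G.nat_pow_mult add.commute)
  qed
  have r_mult: "[int (r (g \<otimes>\<^bsub>G\<^esub> h)) = int (r g) * int (r h)] (mod int N)" if g: "g \<in> H" and h: "h \<in> H" for g h
  proof -
    have gh: "g \<otimes>\<^bsub>G\<^esub> h \<in> H" using subgroup.m_closed[OF H g h] .
    have "(g \<otimes>\<^bsub>G\<^esub> h) \<otimes>\<^bsub>G\<^esub> f0 [^]\<^bsub>G\<^esub> r (g \<otimes>\<^bsub>G\<^esub> h) = (f0 \<otimes>\<^bsub>G\<^esub> g) \<otimes>\<^bsub>G\<^esub> h"
      using HG[OF g] HG[OF h] f0G by (simp add: G.m_assoc flip: r[OF gh])
    also have "\<dots> = g \<otimes>\<^bsub>G\<^esub> (f0 [^]\<^bsub>G\<^esub> r g \<otimes>\<^bsub>G\<^esub> h)"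
      using HG[OF g] HG[OF h] f0G by (simp add: G.m_assoc r[OF g])
    also have "\<dots> = (g \<otimes>\<^bsub>G\<^esub> h) \<otimes>\<^bsub>G\<^esub> f0 [^]\<^bsub>G\<^esub> (r h * r g)"
      using HG[OF g] HG[OF h] f0G by (simp add: G.m_assoc conj[OF h])
    finally have "f0 [^]\<^bsub>G\<^esub> r (g \<otimes>\<^bsub>G\<^esub> h) = f0 [^]\<^bsub>G\<^esub> (r h * r g)"
      using HG[OF gh] f0G by simp
    then show ?thesis by (simp add: pow_eq mult.commute)
  qed
  have r_one: "[int (r \<one>\<^bsub>G\<^esub>) = 1] (mod int N)"
  proof -
    have "f0 [^]\<^bsub>G\<^esub> r \<one>\<^bsub>G\<^esub> = f0 [^]\<^bsub>G\<^esub> (1::nat)" using r[OF subgroup.one_closed[OF H]] f0G by simp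
    then show ?thesis unfolding pow_eq by simp
  qed
  \<comment> \<open>If \<open>g\<close> divides both \<open>r h - 1\<close> and \<open>N = g t\<close>, then \<open>h\<close> commutes with \<open>f0^t\<close>, which is therefore trivial; so \<open>N\<close> divides \<open>t\<close>.\<close>
  have r_coprime: "coprime (int (r h) - 1) (int N)" if h: "h \<in> H" "h \<noteq> \<one>\<^bsub>G\<^esub>" for h
  proof -
    define g where "g = gcd (int (r h) - 1) (int N)"
    have g: "g > 0" "g dvd int N" using N by (auto simp: g_def gcd_pos_int)
    obtain s where s: "int N = g * s" using g(2) by blast
    have s0: "s > 0" using s N g(1) by (metis of_nat_0_less_iff zero_less_mult_pos)
    define t where "t = nat s"
    have t: "int t = s" using s0 by (simp add: t_def)
    obtain u where u: "int (r h) - 1 = g * u" using g_def by (metis gcd_dvd1 dvdE)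
    have "int (r h * t) - int t = int N * u" using u s by (simp add: t algebra_simps)
    then have "f0 [^]\<^bsub>G\<^esub> (r h * t) = f0 [^]\<^bsub>G\<^esub> t" unfolding pow_eq by (simp add: cong_iff_dvd_diff)
    then have "f0 [^]\<^bsub>G\<^esub> t \<otimes>\<^bsub>G\<^esub> h = h \<otimes>\<^bsub>G\<^esub> f0 [^]\<^bsub>G\<^esub> t" using conj[OF h(1), of t] by simp
    moreover have "f0 [^]\<^bsub>G\<^esub> t \<in> F" using Fpow by (metis int_pow_int rangeI)
    ultimately have "f0 [^]\<^bsub>G\<^esub> t = \<one>\<^bsub>G\<^esub>" using free[OF h] by blast
    then have "N dvd t" using G.pow_eq_id[OF f0G] by (simp add: N_def)
    then have "int N dvd s" unfolding t[symmetric] by simp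
    then have "g * s \<le> s" using zdvd_imp_le[OF _ s0] s by simp
    then have "g \<le> 1" using s0 by (simp add: mult_le_cancel_right1)
    then have "g = 1" using g(1) by simp
    then show ?thesis by (simp add: g_def coprime_iff_gcd_eq_1)
  qed
  obtain p k n where pkn: "N = p ^ k * n" "coprime p n" "rnat K n \<noteq> \<zero>\<^bsub>K\<^esub>"
    "k = 0 \<or> normalization_semidom_class.prime p \<and> rnat K p = \<zero>\<^bsub>K\<^esub>"
    using characteristic_part[OF N] by blast
  have n: "n > 0" using N pkn(1) by (cases n) auto
  have nN: "int n dvd int N" using pkn(1) by simp
  define d where "d = inv\<^bsub>K\<^esub> (rnat K n)"
  have d: "d \<in> carrier K" "rnat K n \<otimes>\<^bsub>K\<^esub> d = \<one>\<^bsub>K\<^esub>"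
    using pkn(3) by (auto simp: d_def field_Units)
  define chi where "chi = \<phi> (f0 [^]\<^bsub>G\<^esub> (p ^ k))"
  have pow: "(\<phi> g ^^ t) x = \<phi> (g [^]\<^bsub>G\<^esub> t) x" if "g \<in> carrier G" "x \<in> carrier L" for g x and t :: nat
    using that by (induction t) (simp_all add: one mult[symmetric] flip: G.nat_pow_Suc2)
  have chi_fixed: "x = \<zero>\<^bsub>L\<^esub>" if x: "x \<in> carrier L" "chi x = x" for x
  proof -
    \<comment> \<open>The exponents \<open>p^k\<close> and \<open>n\<close> are coprime, so a vector fixed by both powers of \<open>f0\<close> is fixed by \<open>f0\<close>.\<close>
    have gen: "y = \<zero>\<^bsub>L\<^esub>" if y: "y \<in> carrier L" "chi y = y" "k = 0 \<or> \<phi> (f0 [^]\<^bsub>G\<^esub> n) y = y" for y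
    proof -
      define S where "S = {a :: int. \<phi> (f0 [^]\<^bsub>G\<^esub> a) y = y}"
      have S: "add_subgroup S" unfolding add_subgroup_def
      proof (intro conjI ballI)
        show "0 \<in> S" using y one by (simp add: S_def)
        fix a b assume ab: "a \<in> S" "b \<in> S"
        have "\<phi> (f0 [^]\<^bsub>G\<^esub> (a - b)) y = \<phi> (f0 [^]\<^bsub>G\<^esub> (a - b)) (\<phi> (f0 [^]\<^bsub>G\<^esub> b) y)" using ab by (simp add: S_def)
        also have "\<dots> = \<phi> (f0 [^]\<^bsub>G\<^esub> (a - b) \<otimes>\<^bsub>G\<^esub> f0 [^]\<^bsub>G\<^esub> b) y"
          using f0G y(1) by (simp add: mult)
        also have "f0 [^]\<^bsub>G\<^esub> (a - b) \<otimes>\<^bsub>G\<^esub> f0 [^]\<^bsub>G\<^esub> b = f0 [^]\<^bsub>G\<^esub> a"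
          using G.int_pow_mult[OF f0G, of "a - b" b] by simp
        also have "\<phi> (f0 [^]\<^bsub>G\<^esub> a) y = y" using ab by (simp add: S_def)
        finally show "a - b \<in> S" by (simp add: S_def)
      qed
      have "int (p ^ k) \<in> S" using y(2) unfolding chi_def S_def by (simp add: int_pow_int del: of_nat_power)
      moreover have "k = 0 \<or> int n \<in> S" using y(3) by (auto simp: S_def int_pow_int)
      moreover have "coprime (int (p ^ k)) (int n)" using pkn(2) by simp
      then obtain u v where "u * int (p ^ k) + v * int n = 1" using bezout_int[of "int (p ^ k)" "int n"] by auto
      ultimately have 1: "1 \<in> S"
        using add_subgroup_add[OF S add_subgroup_int_mult[OF S, of "int (p ^ k)" u] add_subgroup_int_mult[OF S, of "int n" v]]
        by auto
      have "a \<in> S" for a using add_subgroup_int_mult[OF S 1, of a] by simp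
      then have "y \<in> fixed_points L \<phi> F" using y(1) Fpow by (auto simp: fixed_points_def S_def)
      then show ?thesis using fixF by simp
    qed
    show ?thesis
    proof (cases "k = 0")
      case True
      then show ?thesis using gen x by blast
    next
      case False
      then have p: "normalization_semidom_class.prime p" "rnat K p = \<zero>\<^bsub>K\<^esub>" using pkn(4) by auto
      let ?t = "\<phi> (f0 [^]\<^bsub>G\<^esub> n)"
      have cG: "f0 [^]\<^bsub>G\<^esub> m \<in> carrier G" for m :: nat using f0G by simp
      note th = lie_homD[OF hom[OF cG]]
      show ?thesis
      proof (rule unipotent_fixed_point[OF p, of ?t "{x \<in> carrier L. chi x = x}" x k])
        show "addf ?t" by (rule addf_lie_hom[OF hom[OF cG]])
        show "?t y \<in> {x \<in> carrier L. chi x = x}" if "y \<in> {x \<in> carrier L. chi x = x}" for y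
        proof -
          have y: "y \<in> carrier L" "chi y = y" using that by auto
          have "chi (?t y) = ?t (chi y)" unfolding chi_def
            using f0G y(1) by (simp add: G.nat_pow_mult add.commute flip: mult)
          then show ?thesis using y th(1) by simp
        qed
        show "y \<ominus>\<^bsub>L\<^esub> z \<in> {x \<in> carrier L. chi x = x}"
          if "y \<in> {x \<in> carrier L. chi x = x}" "z \<in> {x \<in> carrier L. chi x = x}" for y z
          using that addf_diff[OF addf_lie_hom[OF hom[OF cG]]] by (simp add: chi_def)
        show "y = \<zero>\<^bsub>L\<^esub>" if "y \<in> {x \<in> carrier L. chi x = x}" "?t y = y" for y
          using gen that by auto
        have "(?t ^^ (p ^ k)) x = \<phi> (f0 [^]\<^bsub>G\<^esub> N) x"
          using x(1) cG f0G by (simp add: pow G.nat_pow_pow pkn(1) mult.commute)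
        then show "(?t ^^ (p ^ k)) x = x" using x(1) f0G one by (simp add: N_def G.pow_ord_eq_1)
      qed (use x in auto)
    qed
  qed
  let ?HG = "G\<lparr>carrier := H\<rparr>"
  interpret fl: frobenius_lie K L ?HG "\<lambda>h. int (r h)" "int n" chi \<phi> d c
  proof (intro frobenius_lie.intro frobenius_weights.intro frobenius_weights_axioms.intro frobenius_lie_axioms.intro)
    show "lie_algebra K L" by (rule lie)
    show "group ?HG" by (rule G.subgroup_imp_group[OF H])
    show "int n > 0" using n by simp
    show "finite (carrier ?HG)" using H fin subgroup.subset finite_subset by fastforce
    show "[int (r \<one>\<^bsub>?HG\<^esub>) = 1] (mod int n)" using r_one nN cong_dvd_modulus by fastforce
    show "[int (r (g \<otimes>\<^bsub>?HG\<^esub> h)) = int (r g) * int (r h)] (mod int n)"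
      if "g \<in> carrier ?HG" "h \<in> carrier ?HG" for g h
      using r_mult[of g h] that nN cong_dvd_modulus by fastforce
    show "coprime (int (r h) - 1) (int n)" if "h \<in> carrier ?HG" "h \<noteq> \<one>\<^bsub>?HG\<^esub>" for h
      using r_coprime[of h] that pkn(1) by auto
    show "chi \<in> lie_hom K L L" unfolding chi_def using f0G by (intro hom) simp
    show "(chi ^^ nat (int n)) x = x" if "x \<in> carrier L" for x
      unfolding chi_def using that f0G one by (simp add: pow G.nat_pow_pow G.pow_ord_eq_1 flip: pkn(1) N_def) (simp add: N_def G.pow_ord_eq_1)
    show "x = \<zero>\<^bsub>L\<^esub>" if "x \<in> carrier L" "chi x = x" for x by (rule chi_fixed[OF that])
    show "\<phi> h \<in> lie_hom K L L" if "h \<in> carrier ?HG" for h using that HG hom by simp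
    show "\<phi> \<one>\<^bsub>?HG\<^esub> x = x" if "x \<in> carrier L" for x using one that by simp
    show "\<phi> (g \<otimes>\<^bsub>?HG\<^esub> h) x = \<phi> g (\<phi> h x)" if "g \<in> carrier ?HG" "h \<in> carrier ?HG" "x \<in> carrier L" for g h x
      using mult[of x g h] that HG by simp
    show "chi (\<phi> h x) = \<phi> h ((chi ^^ nat (int (r h))) x)" if "h \<in> carrier ?HG" "x \<in> carrier L" for h x
    proof -
      have h: "h \<in> H" "h \<in> carrier G" using that HG by auto
      have "chi (\<phi> h x) = \<phi> (h \<otimes>\<^bsub>G\<^esub> f0 [^]\<^bsub>G\<^esub> (r h * p ^ k)) x"
        unfolding chi_def using that(2) h(2) f0G by (simp flip: mult conj[OF h(1)])
      also have "\<dots> = \<phi> h ((chi ^^ r h) x)"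
        unfolding chi_def using that(2) h(2) f0G by (simp add: mult pow G.nat_pow_pow mult.commute)
      finally show ?thesis by simp
    qed
    show "d \<in> carrier K" by (rule d(1))
    show "((\<lambda>y. y \<oplus>\<^bsub>L\<^esub> d \<odot>\<^bsub>L\<^esub> x) ^^ nat (int n)) \<zero>\<^bsub>L\<^esub> = x" if "x \<in> carrier L" for x
      using that d rnat_smult[of "d \<odot>\<^bsub>L\<^esub> x" n] smult_assoc1[of "rnat K n" d x] by simp
    show "nilpotent_class_le K (L\<lparr>carrier := {x \<in> carrier L. \<forall>h\<in>carrier ?HG. \<phi> h x = x}\<rparr>) c"
      using nil by (simp add: fixed_points_def)
  qed simp
  show ?thesis
    by (rule nilpotent_if_commutators_vanish) (use fl.commutator_vanishes q in simp)
qed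

section \<open>Reduction to countable algebras\<close>

text \<open>Terms name the elements of the prime field and of the subalgebra generated over it by countably many elements under the
  action of a countable group; being countable themselves, they show that these are countable.\<close>

datatype field_term = FZero | FOne | FAdd field_term field_term | FMult field_term field_term
  | FMinus field_term | FInv field_term

datatype lie_term = LGen nat | LZero | LAdd lie_term lie_term
  | LSmult field_term lie_term | LBracket lie_term lie_term | LAct nat lie_term

instance field_term :: countable by countable_datatype
instance lie_term :: countable by countable_datatype

primrec field_val :: "('k, 'r) ring_scheme \<Rightarrow> field_term \<Rightarrow> 'k"
  where
    "field_val R FZero = \<zero>\<^bsub>R\<^esub>"
  | "field_val R FOne = \<one>\<^bsub>R\<^esub>"
  | "field_val R (FAdd s t) = field_val R s \<oplus>\<^bsub>R\<^esub> field_val R t"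
  | "field_val R (FMult s t) = field_val R s \<otimes>\<^bsub>R\<^esub> field_val R t"
  | "field_val R (FMinus t) = \<ominus>\<^bsub>R\<^esub> field_val R t"
  | "field_val R (FInv t) = (if field_val R t = \<zero>\<^bsub>R\<^esub> then \<zero>\<^bsub>R\<^esub> else inv\<^bsub>R\<^esub> field_val R t)"

primrec lie_val :: "('k, 'r) ring_scheme \<Rightarrow> ('k, 'l, 's) lie_algebra_scheme \<Rightarrow> (nat \<Rightarrow> 'l \<Rightarrow> 'l) \<Rightarrow> (nat \<Rightarrow> 'l)
    \<Rightarrow> lie_term \<Rightarrow> 'l"
  where
    "lie_val R L \<psi> gen (LGen i) = gen i"
  | "lie_val R L \<psi> gen LZero = \<zero>\<^bsub>L\<^esub>"
  | "lie_val R L \<psi> gen (LAdd s t) = lie_val R L \<psi> gen s \<oplus>\<^bsub>L\<^esub> lie_val R L \<psi> gen t"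
  | "lie_val R L \<psi> gen (LSmult a t) = field_val R a \<odot>\<^bsub>L\<^esub> lie_val R L \<psi> gen t"
  | "lie_val R L \<psi> gen (LBracket s t) = bracket L (lie_val R L \<psi> gen s) (lie_val R L \<psi> gen t)"
  | "lie_val R L \<psi> gen (LAct i t) = \<psi> i (lie_val R L \<psi> gen t)"

text \<open>The structure of \<open>S \<subseteq> R\<close> transported along the injection \<open>f\<close>, with \<open>g\<close> a left inverse of \<open>f\<close> on \<open>S\<close>.\<close>

definition copy_ring :: "('a \<Rightarrow> 'b) \<Rightarrow> ('b \<Rightarrow> 'a) \<Rightarrow> 'a set \<Rightarrow> ('a, 'm) ring_scheme \<Rightarrow> 'b ring"
  where "copy_ring f g S R = \<lparr>carrier = f ` S, monoid.mult = \<lambda>a b. f (g a \<otimes>\<^bsub>R\<^esub> g b), one = f \<one>\<^bsub>R\<^esub>,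
    ring.zero = f \<zero>\<^bsub>R\<^esub>, ring.add = \<lambda>a b. f (g a \<oplus>\<^bsub>R\<^esub> g b)\<rparr>"

lemma copy_ring_simps [simp]:
  "carrier (copy_ring f g S R) = f ` S" "a \<otimes>\<^bsub>copy_ring f g S R\<^esub> b = f (g a \<otimes>\<^bsub>R\<^esub> g b)"
  "\<one>\<^bsub>copy_ring f g S R\<^esub> = f \<one>\<^bsub>R\<^esub>" "\<zero>\<^bsub>copy_ring f g S R\<^esub> = f \<zero>\<^bsub>R\<^esub>"
  "a \<oplus>\<^bsub>copy_ring f g S R\<^esub> b = f (g a \<oplus>\<^bsub>R\<^esub> g b)"
  by (simp_all add: copy_ring_def)

lemma field_copy:
  assumes "field R" and gf: "\<And>x. x \<in> S \<Longrightarrow> g (f x) = x" and S: "S \<subseteq> carrier R"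
    and cl: "\<zero>\<^bsub>R\<^esub> \<in> S" "\<one>\<^bsub>R\<^esub> \<in> S" "\<And>x y. x \<in> S \<Longrightarrow> y \<in> S \<Longrightarrow> x \<oplus>\<^bsub>R\<^esub> y \<in> S"
      "\<And>x y. x \<in> S \<Longrightarrow> y \<in> S \<Longrightarrow> x \<otimes>\<^bsub>R\<^esub> y \<in> S" "\<And>x. x \<in> S \<Longrightarrow> \<ominus>\<^bsub>R\<^esub> x \<in> S"
      "\<And>x. x \<in> S \<Longrightarrow> x \<noteq> \<zero>\<^bsub>R\<^esub> \<Longrightarrow> inv\<^bsub>R\<^esub> x \<in> S"
  shows "field (copy_ring f g S R)"
proof -
  interpret field R by (rule assms(1))
  have sub: "x \<in> S \<Longrightarrow> x \<in> carrier R" for x using S by blast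
  have "cring (copy_ring f g S R)"
  proof (rule cringI)
    show "abelian_group (copy_ring f g S R)"
    proof (rule abelian_groupI)
      show "\<exists>y\<in>carrier (copy_ring f g S R). y \<oplus>\<^bsub>copy_ring f g S R\<^esub> x = \<zero>\<^bsub>copy_ring f g S R\<^esub>"
        if "x \<in> carrier (copy_ring f g S R)" for x
      proof -
        obtain s where "s \<in> S" "x = f s" using \<open>x \<in> carrier (copy_ring f g S R)\<close> by auto
        then show ?thesis using cl(5) by (intro bexI[of _ "f (\<ominus>\<^bsub>R\<^esub> s)"]) (simp_all add: gf sub l_neg)
      qed
    qed (auto simp: gf cl sub a_ac)
    show "comm_monoid (copy_ring f g S R)"
      by (rule comm_monoidI) (auto simp: gf cl sub m_ac)
  qed (auto simp: gf cl sub l_distr)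
  then interpret C: cring "copy_ring f g S R" .
  show ?thesis
  proof (rule C.cring_fieldI2)
    show "\<zero>\<^bsub>copy_ring f g S R\<^esub> \<noteq> \<one>\<^bsub>copy_ring f g S R\<^esub>"
      using gf[OF cl(1)] gf[OF cl(2)] by (metis copy_ring_simps(3,4) zero_not_one)
    fix a assume a: "a \<in> carrier (copy_ring f g S R)" "a \<noteq> \<zero>\<^bsub>copy_ring f g S R\<^esub>"
    then obtain s where s: "s \<in> S" "a = f s" "s \<noteq> \<zero>\<^bsub>R\<^esub>" by auto
    then have "s \<otimes>\<^bsub>R\<^esub> inv\<^bsub>R\<^esub> s = \<one>\<^bsub>R\<^esub>" using sub[OF s(1)] by (simp add: field_Units)
    then show "\<exists>b\<in>carrier (copy_ring f g S R). a \<otimes>\<^bsub>copy_ring f g S R\<^esub> b = \<one>\<^bsub>copy_ring f g S R\<^esub>"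
      using s cl(6) by (intro bexI[of _ "f (inv\<^bsub>R\<^esub> s)"]) (simp_all add: gf)
  qed
qed

text \<open>The multiplication and the unit carry no meaning in a Lie algebra; they receive arbitrary values.\<close>

definition copy_lie :: "('k \<Rightarrow> 'm) \<Rightarrow> ('m \<Rightarrow> 'k) \<Rightarrow> ('l \<Rightarrow> 'n) \<Rightarrow> ('n \<Rightarrow> 'l) \<Rightarrow> 'l set
    \<Rightarrow> ('k, 'l, 's) lie_algebra_scheme \<Rightarrow> ('m, 'n) lie_algebra"
  where "copy_lie fK gK f g S L = \<lparr>carrier = f ` S, monoid.mult = \<lambda>a b. a, one = f \<zero>\<^bsub>L\<^esub>,
    ring.zero = f \<zero>\<^bsub>L\<^esub>, ring.add = \<lambda>a b. f (g a \<oplus>\<^bsub>L\<^esub> g b), module.smult = \<lambda>k a. f (gK k \<odot>\<^bsub>L\<^esub> g a),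
    bracket = \<lambda>a b. f (bracket L (g a) (g b))\<rparr>"

lemma copy_lie_simps [simp]:
  "carrier (copy_lie fK gK f g S L) = f ` S" "\<zero>\<^bsub>copy_lie fK gK f g S L\<^esub> = f \<zero>\<^bsub>L\<^esub>"
  "a \<oplus>\<^bsub>copy_lie fK gK f g S L\<^esub> b = f (g a \<oplus>\<^bsub>L\<^esub> g b)"
  "k \<odot>\<^bsub>copy_lie fK gK f g S L\<^esub> a = f (gK k \<odot>\<^bsub>L\<^esub> g a)"
  "bracket (copy_lie fK gK f g S L) a b = f (bracket L (g a) (g b))"
  by (simp_all add: copy_lie_def)

lemma lie_algebra_copy:
  assumes "lie_algebra K L"
    and KC: "field (copy_ring fK gK S K)" and gfK: "\<And>x. x \<in> S \<Longrightarrow> gK (fK x) = x" and S: "S \<subseteq> carrier K"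
    and clK: "\<one>\<^bsub>K\<^esub> \<in> S" "\<And>x y. x \<in> S \<Longrightarrow> y \<in> S \<Longrightarrow> x \<oplus>\<^bsub>K\<^esub> y \<in> S"
      "\<And>x y. x \<in> S \<Longrightarrow> y \<in> S \<Longrightarrow> x \<otimes>\<^bsub>K\<^esub> y \<in> S" "\<And>x. x \<in> S \<Longrightarrow> \<ominus>\<^bsub>K\<^esub> x \<in> S"
    and gf: "\<And>x. x \<in> T \<Longrightarrow> g (f x) = x" and T: "T \<subseteq> carrier L"
    and cl: "\<zero>\<^bsub>L\<^esub> \<in> T" "\<And>x y. x \<in> T \<Longrightarrow> y \<in> T \<Longrightarrow> x \<oplus>\<^bsub>L\<^esub> y \<in> T"
      "\<And>a x. a \<in> S \<Longrightarrow> x \<in> T \<Longrightarrow> a \<odot>\<^bsub>L\<^esub> x \<in> T" "\<And>x y. x \<in> T \<Longrightarrow> y \<in> T \<Longrightarrow> bracket L x y \<in> T"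
  shows "lie_algebra (copy_ring fK gK S K) (copy_lie fK gK f g T L)"
proof -
  interpret lie_algebra K L by (rule assms(1))
  interpret C: field "copy_ring fK gK S K" by (rule KC)
  let ?L = "copy_lie fK gK f g T L"
  have sub: "x \<in> T \<Longrightarrow> x \<in> carrier L" "a \<in> S \<Longrightarrow> a \<in> carrier K" for x a using S T by blast+
  have minus: "\<ominus>\<^bsub>L\<^esub> x = (\<ominus>\<^bsub>K\<^esub> \<one>\<^bsub>K\<^esub>) \<odot>\<^bsub>L\<^esub> x" if "x \<in> T" for x
    using sub(1)[OF that] by (simp add: smult_l_minus)
  have "module (copy_ring fK gK S K) ?L"
  proof (rule moduleI)
    show "cring (copy_ring fK gK S K)" by (rule C.is_cring)
    show "abelian_group ?L"
    proof (rule abelian_groupI)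
      show "\<exists>y\<in>carrier ?L. y \<oplus>\<^bsub>?L\<^esub> x = \<zero>\<^bsub>?L\<^esub>" if x: "x \<in> carrier ?L" for x
      proof -
        obtain s where s: "s \<in> T" "x = f s" using x by auto
        then have "\<ominus>\<^bsub>L\<^esub> s \<in> T" using cl(3) clK by (simp add: minus)
        then show ?thesis using s by (intro bexI[of _ "f (\<ominus>\<^bsub>L\<^esub> s)"]) (simp_all add: gf sub M.l_neg)
      qed
    qed (auto simp: gf cl sub M.a_ac)
  qed (auto simp: gf gfK cl clK sub smult_l_distr smult_r_distr smult_assoc1)
  moreover have "lie_algebra_axioms (copy_ring fK gK S K) ?L"
    by (rule lie_algebra_axioms.intro)
      (auto simp: gf gfK cl clK sub bracket_add_left bracket_add_right bracket_smult_left bracket_smult_right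
        bracket_self jacobi)
  ultimately show ?thesis using KC by (intro lie_algebra.intro)
qed

definition copy_group :: "('a \<Rightarrow> 'b) \<Rightarrow> ('b \<Rightarrow> 'a) \<Rightarrow> ('a, 'm) monoid_scheme \<Rightarrow> 'b monoid"
  where "copy_group f g G = \<lparr>carrier = f ` carrier G, monoid.mult = \<lambda>a b. f (g a \<otimes>\<^bsub>G\<^esub> g b), one = f \<one>\<^bsub>G\<^esub>\<rparr>"

lemma copy_group_simps [simp]:
  "carrier (copy_group f g G) = f ` carrier G" "a \<otimes>\<^bsub>copy_group f g G\<^esub> b = f (g a \<otimes>\<^bsub>G\<^esub> g b)"
  "\<one>\<^bsub>copy_group f g G\<^esub> = f \<one>\<^bsub>G\<^esub>"
  by (simp_all add: copy_group_def)

lemma copy_group_iso: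
  assumes "group G" and gf: "\<And>x. x \<in> carrier G \<Longrightarrow> g (f x) = x"
  shows "group (copy_group f g G)" "f \<in> iso G (copy_group f g G)"
proof -
  interpret group G by (rule assms(1))
  show "group (copy_group f g G)"
  proof (rule groupI)
    show "\<exists>y\<in>carrier (copy_group f g G). y \<otimes>\<^bsub>copy_group f g G\<^esub> x = \<one>\<^bsub>copy_group f g G\<^esub>"
      if "x \<in> carrier (copy_group f g G)" for x
    proof -
      obtain s where "s \<in> carrier G" "x = f s" using \<open>x \<in> carrier (copy_group f g G)\<close> by auto
      then show ?thesis by (intro bexI[of _ "f (inv\<^bsub>G\<^esub> s)"]) (simp_all add: gf)
    qed
  qed (auto simp: gf m_assoc)
  have "inj_on f (carrier G)" by (rule inj_on_inverseI) (rule gf)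
  then show "f \<in> iso G (copy_group f g G)" by (auto simp: iso_def hom_def bij_betw_def gf)
qed

lemma frobenius_group_copy:
  assumes fr: "frobenius_group G F H" and gf: "\<And>x. x \<in> carrier G \<Longrightarrow> g (f x) = x"
    and cyc: "cyclic_group (G\<lparr>carrier := F\<rparr>)"
  shows "frobenius_group (copy_group f g G) (f ` F) (f ` H)" "cyclic_group ((copy_group f g G)\<lparr>carrier := f ` F\<rparr>)"
    "card (f ` H) = card H"
proof -
  let ?C = "copy_group f g G"
  interpret G: group G using fr by (simp add: frobenius_group_def)
  interpret F: normal F G using fr by (simp add: frobenius_group_def)
  have fr': "finite (carrier G)" "subgroup H G" "F \<noteq> {\<one>\<^bsub>G\<^esub>}" "H \<noteq> {\<one>\<^bsub>G\<^esub>}" "F <#>\<^bsub>G\<^esub> H = carrier G"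
    "F \<inter> H = {\<one>\<^bsub>G\<^esub>}"
    "\<And>h f. h \<in> H \<Longrightarrow> h \<noteq> \<one>\<^bsub>G\<^esub> \<Longrightarrow> f \<in> F \<Longrightarrow> f \<otimes>\<^bsub>G\<^esub> h = h \<otimes>\<^bsub>G\<^esub> f \<Longrightarrow> f = \<one>\<^bsub>G\<^esub>"
    using fr by (auto simp: frobenius_group_def)
  note C = copy_group_iso[where G = G and f = f and g = g, OF G.is_group gf]
  interpret C: group ?C by (rule C(1))
  have h: "group_hom G ?C f"
    using C G.is_group by (intro group_hom.intro group_hom_axioms.intro) (auto simp: iso_def)
  have sub: "x \<in> F \<Longrightarrow> x \<in> carrier G" "y \<in> H \<Longrightarrow> y \<in> carrier G" for x y
    using F.subset subgroup.subset[OF fr'(2)] by auto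
  have inj: "inj_on f (carrier G)" using C(2) by (simp add: iso_def bij_betw_def)
  have eq: "f x = f y \<longleftrightarrow> x = y" if "x \<in> carrier G" "y \<in> carrier G" for x y
    using inj that by (auto dest: inj_onD)
  have img1: "f ` S \<noteq> {f \<one>\<^bsub>G\<^esub>}" if "S \<noteq> {\<one>\<^bsub>G\<^esub>}" "S \<subseteq> carrier G" for S
  proof
    assume e: "f ` S = {f \<one>\<^bsub>G\<^esub>}"
    have "x = \<one>\<^bsub>G\<^esub>" if x: "x \<in> S" for x
    proof -
      have "f x = f \<one>\<^bsub>G\<^esub>" using e x by blast
      moreover have "x \<in> carrier G" using x \<open>S \<subseteq> carrier G\<close> by blast
      ultimately show ?thesis using eq[of x "\<one>\<^bsub>G\<^esub>"] by simp
    qed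
    moreover have "S \<noteq> {}" using e by blast
    ultimately have "S = {\<one>\<^bsub>G\<^esub>}" by blast
    then show False using that(1) by simp
  qed
  show "frobenius_group ?C (f ` F) (f ` H)"
    unfolding frobenius_group_def
  proof (intro conjI ballI impI)
    show "group ?C" by (rule C(1))
    show "finite (carrier ?C)" using fr'(1) by simp
    show "f ` F \<lhd> ?C" by (rule iso_normal_subgroup[OF C(2) G.is_group C(1) F.normal_axioms])
    show "subgroup (f ` H) ?C" by (rule group_hom.subgroup_img_is_subgroup[OF h fr'(2)])
    show "f ` F \<noteq> {\<one>\<^bsub>?C\<^esub>}" "f ` H \<noteq> {\<one>\<^bsub>?C\<^esub>}" 
      using img1[OF fr'(3)] img1[OF fr'(4)] F.subset subgroup.subset[OF fr'(2)] by simp_all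
    have "f ` F <#>\<^bsub>?C\<^esub> f ` H = f ` (F <#>\<^bsub>G\<^esub> H)"
      unfolding set_mult_def using sub by (auto simp: gf image_iff)
    then show "f ` F <#>\<^bsub>?C\<^esub> f ` H = carrier ?C" using fr'(5) by simp
    have "f ` F \<inter> f ` H = f ` (F \<inter> H)"
      by (rule inj_on_image_Int[OF inj F.subset subgroup.subset[OF fr'(2)], symmetric])
    then show "f ` F \<inter> f ` H = {\<one>\<^bsub>?C\<^esub>}" using fr'(6) by simp
    fix y x assume "y \<in> f ` H - {\<one>\<^bsub>?C\<^esub>}" "x \<in> f ` F" "x \<otimes>\<^bsub>?C\<^esub> y = y \<otimes>\<^bsub>?C\<^esub> x"
    then obtain b a where ab: "b \<in> H" "y = f b" "a \<in> F" "x = f a" and "b \<noteq> \<one>\<^bsub>G\<^esub>"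
      by auto
    moreover have "f (a \<otimes>\<^bsub>G\<^esub> b) = f (b \<otimes>\<^bsub>G\<^esub> a)"
      using \<open>x \<otimes>\<^bsub>?C\<^esub> y = y \<otimes>\<^bsub>?C\<^esub> x\<close> ab sub by (simp add: gf)
    ultimately have "b \<in> H" "b \<noteq> \<one>\<^bsub>G\<^esub>" "y = f b" "a \<in> F" "x = f a" "f (a \<otimes>\<^bsub>G\<^esub> b) = f (b \<otimes>\<^bsub>G\<^esub> a)"
      by blast+
    then show "x = \<one>\<^bsub>?C\<^esub>" using fr'(7)[of b a] sub eq by simp
  qed
  show "card (f ` H) = card H"
    using inj sub by (intro card_image) (auto intro: inj_on_subset)
  interpret FG: group "G\<lparr>carrier := F\<rparr>" by (rule G.subgroup_imp_group[OF F.subgroup_axioms])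
  have "subgroup (f ` F) ?C" by (rule group_hom.subgroup_img_is_subgroup[OF h F.subgroup_axioms])
  then have "group (?C\<lparr>carrier := f ` F\<rparr>)" by (rule C.subgroup_imp_group)
  moreover have "f \<in> epi (G\<lparr>carrier := F\<rparr>) (?C\<lparr>carrier := f ` F\<rparr>)"
    using sub by (auto simp: epi_def hom_def gf)
  ultimately show "cyclic_group (?C\<lparr>carrier := f ` F\<rparr>)"
    using FG.cyclic_group_epimorphic_image cyc by blast
qed

lemma (in module) submoduleI_smult:
  assumes "N \<subseteq> carrier M" "\<zero>\<^bsub>M\<^esub> \<in> N" "\<And>a b. a \<in> N \<Longrightarrow> b \<in> N \<Longrightarrow> a \<oplus>\<^bsub>M\<^esub> b \<in> N"
    "\<And>a x. a \<in> carrier R \<Longrightarrow> x \<in> N \<Longrightarrow> a \<odot>\<^bsub>M\<^esub> x \<in> N"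
  shows "submodule N R M"
proof (rule submoduleI)
  show "\<ominus>\<^bsub>M\<^esub> a \<in> N" if "a \<in> N" for a
  proof -
    have "\<ominus>\<^bsub>M\<^esub> a = (\<ominus> \<one>) \<odot>\<^bsub>M\<^esub> a" using that assms(1) by (auto simp: smult_l_minus)
    then show ?thesis using assms(4)[of "\<ominus> \<one>" a] that by simp
  qed
qed (use assms in auto)

lemma lower_central_bracket:
  "x \<in> lower_central K L m \<Longrightarrow> y \<in> carrier L \<Longrightarrow> bracket L x y \<in> lower_central K L (Suc m)"
  by (auto simp: lin_span_def)

lemma foldl_lower_central:
  "x \<in> lower_central K L m \<Longrightarrow> set ys \<subseteq> carrier L \<Longrightarrow> foldl (bracket L) x ys \<in> lower_central K L (m + length ys)"
proof (induction ys arbitrary: x m)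
  case (Cons y ys)
  then show ?case using Cons.IH[of "bracket L x y" "Suc m"] lower_central_bracket[of x K L m y] by simp
qed simp

lemma submodule_closed:
  assumes "submodule N K L"
  shows "\<zero>\<^bsub>L\<^esub> \<in> N" "x \<in> N \<Longrightarrow> y \<in> N \<Longrightarrow> x \<oplus>\<^bsub>L\<^esub> y \<in> N" "a \<in> carrier K \<Longrightarrow> x \<in> N \<Longrightarrow> a \<odot>\<^bsub>L\<^esub> x \<in> N"
  using subgroup.one_closed[OF submodule.axioms(1)[OF assms]] subgroup.m_closed[OF submodule.axioms(1)[OF assms]]
    submodule.smult_closed[OF assms] by auto

text \<open>Given a commutator, take the subalgebra over the prime field that is generated by its entries and the action of the
  finite group \<open>G\<close>, and copy it to the natural numbers. The hypotheses on fixed points are inherited, because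
  the fixed points of the copy are copies of fixed points of \<open>L\<close>.\<close>

theorem bound_for_countable_suffices:
  fixes G :: "'g monoid" and F H :: "'g set"
    and K :: "'k ring" and L :: "('k, 'l) lie_algebra"
  assumes nat_bound: "\<And>(G' :: nat monoid) F' H' (K' :: nat ring) (L' :: (nat, nat) lie_algebra) \<phi>'.
      frobenius_group G' F' H' \<Longrightarrow> cyclic_group (G'\<lparr>carrier := F'\<rparr>) \<Longrightarrow> card H' = q
      \<Longrightarrow> lie_algebra K' L' \<Longrightarrow> acts_by_lie_automorphisms G' K' L' \<phi>'
      \<Longrightarrow> fixed_points L' \<phi>' F' = {\<zero>\<^bsub>L'\<^esub>}
      \<Longrightarrow> nilpotent_class_le K' (L'\<lparr>carrier := fixed_points L' \<phi>' H'\<rparr>) c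
      \<Longrightarrow> nilpotent_class_le K' L' N"
    and fr: "frobenius_group G F H"
    and cyc: "cyclic_group (G\<lparr>carrier := F\<rparr>)" and q: "card H = q"
    and lie: "lie_algebra K L"
    and acts: "acts_by_lie_automorphisms G K L \<phi>"
    and fixF: "fixed_points L \<phi> F = {\<zero>\<^bsub>L\<^esub>}"
    and nil: "nilpotent_class_le K (L\<lparr>carrier := fixed_points L \<phi> H\<rparr>) c"
  shows "nilpotent_class_le K L N"
proof -
  interpret lie_algebra K L by (rule lie)
  interpret G: group G using fr by (simp add: frobenius_group_def)
  interpret A: group_action G "carrier L" \<phi> using acts by (simp add: acts_by_lie_automorphisms_def)
  have hom: "g \<in> carrier G \<Longrightarrow> \<phi> g \<in> lie_hom K L L" for g
    using acts by (simp add: acts_by_lie_automorphisms_def)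
  note ph = lie_homD[OF hom]
  have fin: "finite (carrier G)" using fr by (simp add: frobenius_group_def)
  have FH: "F \<subseteq> carrier G" "H \<subseteq> carrier G"
    using fr normal_imp_subgroup subgroup.subset by (auto simp: frobenius_group_def dest: normal_imp_subgroup subgroup.subset)
  have "foldl (bracket L) x0 ys0 = \<zero>\<^bsub>L\<^esub>"
    if x0: "x0 \<in> carrier L" and ys0: "set ys0 \<subseteq> carrier L" and len: "length ys0 = N" for x0 ys0
  proof -
    define gG where "gG = from_nat_into (carrier G)"
    define fG where "fG = to_nat_on (carrier G)"
    have gfG: "g \<in> carrier G \<Longrightarrow> gG (fG g) = g" for g
      using fin by (simp add: gG_def fG_def countable_finite)
    have gGc: "gG i \<in> carrier G" for i unfolding gG_def by (rule from_nat_into) auto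
    \<comment> \<open>The entries of the commutator, followed by zeros.\<close>
    define gen where "gen i = (if i < Suc N then (x0 # ys0) ! i else \<zero>\<^bsub>L\<^esub>)" for i
    have gen: "gen i \<in> carrier L" for i
    proof -
      have "(x0 # ys0) ! i \<in> set (x0 # ys0)" if "i < Suc N" using that len by (intro nth_mem) simp
      then show ?thesis using x0 ys0 by (auto simp: gen_def)
    qed
    define S where "S = range (field_val K)"
    define T where "T = range (lie_val K L (\<lambda>i. \<phi> (gG i)) gen)"
    have Kc: "field_val K t \<in> carrier K" for t
      by (induction t) (auto simp: field_Units)
    have Lc: "lie_val K L (\<lambda>i. \<phi> (gG i)) gen t \<in> carrier L" for t
      by (induction t) (auto simp: gen Kc bracket_closed ph gGc)
    have S: "S \<subseteq> carrier K" and T: "T \<subseteq> carrier L" using Kc Lc by (auto simp: S_def T_def)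
    have clK: "\<zero>\<^bsub>K\<^esub> \<in> S" "\<one>\<^bsub>K\<^esub> \<in> S" "\<And>x y. x \<in> S \<Longrightarrow> y \<in> S \<Longrightarrow> x \<oplus>\<^bsub>K\<^esub> y \<in> S"
      "\<And>x y. x \<in> S \<Longrightarrow> y \<in> S \<Longrightarrow> x \<otimes>\<^bsub>K\<^esub> y \<in> S" "\<And>x. x \<in> S \<Longrightarrow> \<ominus>\<^bsub>K\<^esub> x \<in> S"
      "\<And>x. x \<in> S \<Longrightarrow> x \<noteq> \<zero>\<^bsub>K\<^esub> \<Longrightarrow> inv\<^bsub>K\<^esub> x \<in> S"
    proof -
      show "\<zero>\<^bsub>K\<^esub> \<in> S" unfolding S_def by (rule range_eqI[of _ _ FZero]) simp
      show "\<one>\<^bsub>K\<^esub> \<in> S" unfolding S_def by (rule range_eqI[of _ _ FOne]) simp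
      fix x assume "x \<in> S"
      then obtain s where s: "x = field_val K s" by (auto simp: S_def)
      show "\<ominus>\<^bsub>K\<^esub> x \<in> S" unfolding S_def by (rule range_eqI[of _ _ "FMinus s"]) (simp add: s)
      show "x \<noteq> \<zero>\<^bsub>K\<^esub> \<Longrightarrow> inv\<^bsub>K\<^esub> x \<in> S" unfolding S_def by (rule range_eqI[of _ _ "FInv s"]) (simp add: s)
      fix y assume "y \<in> S"
      then obtain t where t: "y = field_val K t" by (auto simp: S_def)
      show "x \<oplus>\<^bsub>K\<^esub> y \<in> S" unfolding S_def by (rule range_eqI[of _ _ "FAdd s t"]) (simp add: s t)
      show "x \<otimes>\<^bsub>K\<^esub> y \<in> S" unfolding S_def by (rule range_eqI[of _ _ "FMult s t"]) (simp add: s t)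
    qed
    have clL: "\<zero>\<^bsub>L\<^esub> \<in> T" "\<And>x y. x \<in> T \<Longrightarrow> y \<in> T \<Longrightarrow> x \<oplus>\<^bsub>L\<^esub> y \<in> T"
      "\<And>a x. a \<in> S \<Longrightarrow> x \<in> T \<Longrightarrow> a \<odot>\<^bsub>L\<^esub> x \<in> T" "\<And>x y. x \<in> T \<Longrightarrow> y \<in> T \<Longrightarrow> bracket L x y \<in> T"
      "\<And>i x. x \<in> T \<Longrightarrow> \<phi> (gG i) x \<in> T" "\<And>i. gen i \<in> T"
    proof -
      show "\<zero>\<^bsub>L\<^esub> \<in> T" unfolding T_def by (rule range_eqI[of _ _ LZero]) simp
      show "gen i \<in> T" for i unfolding T_def by (rule range_eqI[of _ _ "LGen i"]) simp
      fix x assume "x \<in> T"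
      then obtain s where s: "x = lie_val K L (\<lambda>i. \<phi> (gG i)) gen s" by (auto simp: T_def)
      show "\<phi> (gG i) x \<in> T" for i unfolding T_def by (rule range_eqI[of _ _ "LAct i s"]) (simp add: s)
      show "a \<odot>\<^bsub>L\<^esub> x \<in> T" if "a \<in> S" for a
      proof -
        obtain u where "a = field_val K u" using \<open>a \<in> S\<close> by (auto simp: S_def)
        then show ?thesis unfolding T_def by (intro range_eqI[of _ _ "LSmult u s"]) (simp add: s)
      qed
      fix y assume "y \<in> T"
      then obtain t where t: "y = lie_val K L (\<lambda>i. \<phi> (gG i)) gen t" by (auto simp: T_def)
      show "x \<oplus>\<^bsub>L\<^esub> y \<in> T" unfolding T_def by (rule range_eqI[of _ _ "LAdd s t"]) (simp add: s t)
      show "bracket L x y \<in> T" unfolding T_def by (rule range_eqI[of _ _ "LBracket s t"]) (simp add: s t)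
    qed
    have actT: "\<phi> g x \<in> T" if "g \<in> carrier G" "x \<in> T" for g x
      using clL(5)[OF that(2), of "fG g"] gfG that(1) by simp
    define fK gK where "fK = to_nat_on S" and "gK = from_nat_into S"
    define fL gL where "fL = to_nat_on T" and "gL = from_nat_into T"
    have gfK: "x \<in> S \<Longrightarrow> gK (fK x) = x" for x unfolding fK_def gK_def S_def by (simp add: countable_image)
    have gfL: "x \<in> T \<Longrightarrow> gL (fL x) = x" for x unfolding fL_def gL_def T_def by (simp add: countable_image)
    let ?G = "copy_group fG gG G" and ?K = "copy_ring fK gK S K" and ?L = "copy_lie fK gK fL gL T L"
    define \<phi>' where "\<phi>' i = (\<lambda>x\<in>fL ` T. fL (\<phi> (gG i) (gL x)))" for i
    note frob = frobenius_group_copy[where f = fG and g = gG, OF fr gfG cyc]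
    have fieldK: "field ?K"
      by (rule field_copy[where f = fK and g = gK, OF K.field_axioms gfK S clK])
    have lieL: "lie_algebra ?K ?L"
      by (rule lie_algebra_copy[where fK = fK and gK = gK and f = fL and g = gL, OF lie fieldK gfK S clK(2-5) gfL T clL(1-4)])
    interpret C: lie_algebra ?K ?L by (rule lieL)
    have sub: "x \<in> T \<Longrightarrow> x \<in> carrier L" "a \<in> S \<Longrightarrow> a \<in> carrier K" for x a using S T by auto
    have phi: "\<phi>' (fG g) (fL x) = fL (\<phi> g x)" if "g \<in> carrier G" "x \<in> T" for g x
      using that by (simp add: \<phi>'_def gfG gfL)
    have acts': "acts_by_lie_automorphisms ?G ?K ?L \<phi>'"
      unfolding acts_by_lie_automorphisms_def
    proof (intro conjI ballI group_action.intro group_hom.intro group_hom_axioms.intro)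
      show "group ?G" by (rule copy_group_iso(1)[where f = fG and g = gG, OF G.is_group gfG])
      show "group (BijGroup (carrier ?L))" by (rule group_BijGroup)
      have bij: "\<phi>' i \<in> Bij (fL ` T)" if i: "i \<in> carrier ?G" for i
      proof -
        obtain g where g: "g \<in> carrier G" "i = fG g" using i by auto
        have inv: "\<phi> (inv\<^bsub>G\<^esub> g) (\<phi> g x) = x" "\<phi> g (\<phi> (inv\<^bsub>G\<^esub> g) x) = x" if "x \<in> T" for x
          using A.composition_rule[of x "inv\<^bsub>G\<^esub> g" g] A.composition_rule[of x g "inv\<^bsub>G\<^esub> g"] g(1) sub(1)[OF that]
            A.id_eq_one by (auto simp: restrict_apply' dest: fun_cong[where x = x])
        have "bij_betw (\<phi>' i) (fL ` T) (fL ` T)"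
          by (rule bij_betw_byWitness[where f' = "\<lambda>x. fL (\<phi> (inv\<^bsub>G\<^esub> g) (gL x))"])
            (use g inv in \<open>auto simp: phi gfL actT\<close>)
        then show ?thesis by (simp add: Bij_def \<phi>'_def)
      qed
      show "\<phi>' \<in> Group.hom ?G (BijGroup (carrier ?L))"
        unfolding Group.hom_def
      proof (intro CollectI conjI ballI)
        show "\<phi>' \<in> carrier ?G \<rightarrow> carrier (BijGroup (carrier ?L))" using bij by (auto simp: BijGroup_def)
        fix i j assume ij: "i \<in> carrier ?G" "j \<in> carrier ?G"
        then obtain g h where gh: "g \<in> carrier G" "i = fG g" "h \<in> carrier G" "j = fG h" by auto
        have "\<phi>' (i \<otimes>\<^bsub>?G\<^esub> j) = compose (fL ` T) (\<phi>' i) (\<phi>' j)"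
        proof
          fix x show "\<phi>' (i \<otimes>\<^bsub>?G\<^esub> j) x = compose (fL ` T) (\<phi>' i) (\<phi>' j) x"
          proof (cases "x \<in> fL ` T")
            case True
            then obtain t where t: "t \<in> T" "x = fL t" by blast
            have "\<phi>' (i \<otimes>\<^bsub>?G\<^esub> j) x = fL (\<phi> g (\<phi> h t))"
              using gh t by (simp add: gfG phi A.composition_rule sub)
            then show ?thesis using True gh t by (simp add: compose_def phi actT)
          qed (simp add: \<phi>'_def compose_def)
        qed
        then show "\<phi>' (i \<otimes>\<^bsub>?G\<^esub> j) = \<phi>' i \<otimes>\<^bsub>BijGroup (carrier ?L)\<^esub> \<phi>' j"
          using bij[OF ij(1)] bij[OF ij(2)] by (simp add: BijGroup_def)
      qed
      show "\<phi>' i \<in> lie_hom ?K ?L ?L" if i: "i \<in> carrier ?G" for i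
      proof -
        obtain g where g: "g \<in> carrier G" "i = fG g" using i by auto
        show ?thesis unfolding lie_hom_def g(2)
          by (auto simp: phi g(1) gfL gfK clL actT sub ph)
      qed
    qed
    have fix_iff: "fL x \<in> fixed_points ?L \<phi>' (fG ` B) \<longleftrightarrow> x \<in> fixed_points L \<phi> B" if "x \<in> T" "B \<subseteq> carrier G" for x B
    proof -
      have "fL (\<phi> b x) = fL x \<longleftrightarrow> \<phi> b x = x" if "b \<in> B" for b
        using gfL[of x] gfL[of "\<phi> b x"] actT[of b x] that \<open>x \<in> T\<close> \<open>B \<subseteq> carrier G\<close> by force
      then show ?thesis using that sub(1)[of x] by (auto simp: fixed_points_def phi subset_iff)
    qed
    have fixF': "fixed_points ?L \<phi>' (fG ` F) = {\<zero>\<^bsub>?L\<^esub>}"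
    proof (intro equalityI subsetI)
      fix y assume y: "y \<in> fixed_points ?L \<phi>' (fG ` F)"
      then have "y \<in> fL ` T" by (simp add: fixed_points_def)
      then obtain x where "x \<in> T" "y = fL x" by blast
      then show "y \<in> {\<zero>\<^bsub>?L\<^esub>}" using fix_iff[of x F] y FH fixF by auto
    next
      fix y assume "y \<in> {\<zero>\<^bsub>?L\<^esub>}"
      moreover have "\<zero>\<^bsub>L\<^esub> \<in> fixed_points L \<phi> F" using fixF by simp
      ultimately show "y \<in> fixed_points ?L \<phi>' (fG ` F)" using fix_iff[OF clL(1) FH(1)] by simp
    qed
    let ?P = "fixed_points ?L \<phi>' (fG ` H)"
    let ?LF' = "?L\<lparr>carrier := ?P\<rparr>" and ?LF = "L\<lparr>carrier := fixed_points L \<phi> H\<rparr>"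
    have P: "\<exists>t. y = fL t \<and> t \<in> T \<and> t \<in> fixed_points L \<phi> H" if "y \<in> ?P" for y
    proof -
      have "y \<in> fL ` T" using that by (simp add: fixed_points_def)
      then obtain x where "x \<in> T" "y = fL x" by blast
      then show ?thesis using fix_iff[of x H] that FH by auto
    qed
    have fixcl: "\<zero>\<^bsub>L\<^esub> \<in> fixed_points L \<phi> H"
      "\<And>x y. x \<in> fixed_points L \<phi> H \<Longrightarrow> y \<in> fixed_points L \<phi> H \<Longrightarrow> x \<oplus>\<^bsub>L\<^esub> y \<in> fixed_points L \<phi> H"
      "\<And>a x. a \<in> carrier K \<Longrightarrow> x \<in> fixed_points L \<phi> H \<Longrightarrow> a \<odot>\<^bsub>L\<^esub> x \<in> fixed_points L \<phi> H"
      "\<And>x y. x \<in> fixed_points L \<phi> H \<Longrightarrow> y \<in> fixed_points L \<phi> H \<Longrightarrow> bracket L x y \<in> fixed_points L \<phi> H"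
      using FH(2) by (auto simp: fixed_points_def ph bracket_closed addf_zero[OF addf_lie_hom[OF hom]] subset_iff)
    have subP: "submodule ?P ?K ?L"
    proof (rule C.submoduleI_smult)
      show "?P \<subseteq> carrier ?L" by (auto simp: fixed_points_def)
      show "\<zero>\<^bsub>?L\<^esub> \<in> ?P" using fix_iff[OF clL(1) FH(2)] fixcl(1) by simp
      show "a \<oplus>\<^bsub>?L\<^esub> b \<in> ?P" if "a \<in> ?P" "b \<in> ?P" for a b
        using P[OF that(1)] P[OF that(2)] fix_iff[OF _ FH(2)] fixcl(2) clL(2) by (auto simp: gfL)
      show "a \<odot>\<^bsub>?L\<^esub> x \<in> ?P" if "a \<in> carrier ?K" "x \<in> ?P" for a x
        using P[OF that(2)] that(1) fix_iff[OF _ FH(2)] fixcl(3) clL(3) sub by (auto simp: gfL gfK)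
    qed
    have modP: "module ?K ?LF'"
      by (rule submodule.submodule_is_module[OF subP C.module_axioms])
    \<comment> \<open>A span over the smaller field lies in the span over the larger one.\<close>
    have low: "lower_central ?K ?LF' m \<subseteq> {x \<in> ?P. gL x \<in> lower_central K ?LF m}" for m
    proof (induction m)
      case 0
      have "gL x \<in> fixed_points L \<phi> H" if "x \<in> ?P" for x using P[OF that] by (auto simp: gfL)
      then show ?case by auto
    next
      case (Suc m)
      show ?case unfolding lower_central.simps lin_span_def[of ?K]
      proof (rule Inter_lower, intro CollectI conjI)
        let ?gens = "{bracket ?LF x y |x y. x \<in> lower_central K ?LF m \<and> y \<in> carrier ?LF}"
        show "submodule {x \<in> ?P. gL x \<in> lin_span K ?LF ?gens} ?K ?LF'"
        proof (rule module.submoduleI_smult[OF modP])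
          show "\<zero>\<^bsub>?LF'\<^esub> \<in> {x \<in> ?P. gL x \<in> lin_span K ?LF ?gens}"
            using submodule_closed(1)[OF subP] submodule_closed(1)[of _ K ?LF]
            by (auto simp: lin_span_def gfL clL)
          show "a \<oplus>\<^bsub>?LF'\<^esub> b \<in> {x \<in> ?P. gL x \<in> lin_span K ?LF ?gens}"
            if "a \<in> {x \<in> ?P. gL x \<in> lin_span K ?LF ?gens}" "b \<in> {x \<in> ?P. gL x \<in> lin_span K ?LF ?gens}" for a b
          proof -
            have "gL (fL (gL a \<oplus>\<^bsub>L\<^esub> gL b)) = gL a \<oplus>\<^bsub>L\<^esub> gL b"
              using P[of a] P[of b] that by (auto simp: gfL clL)
            then show ?thesis using submodule_closed(2)[OF subP, of a b] submodule_closed(2)[of _ K ?LF "gL a" "gL b"] that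
              by (auto simp: lin_span_def)
          qed
          show "a \<odot>\<^bsub>?LF'\<^esub> x \<in> {x \<in> ?P. gL x \<in> lin_span K ?LF ?gens}"
            if "a \<in> carrier ?K" "x \<in> {x \<in> ?P. gL x \<in> lin_span K ?LF ?gens}" for a x
          proof -
            have "gL (fL (gK a \<odot>\<^bsub>L\<^esub> gL x)) = gK a \<odot>\<^bsub>L\<^esub> gL x" "gK a \<in> carrier K"
              using P[of x] that by (auto simp: gfL gfK clL sub)
            then show ?thesis using submodule_closed(3)[OF subP, of a x] submodule_closed(3)[of _ K ?LF "gK a" "gL x"] that
              by (auto simp: lin_span_def)
          qed
        qed auto
        show "{bracket ?LF' x y |x y. x \<in> lower_central ?K ?LF' m \<and> y \<in> carrier ?LF'}
          \<subseteq> {x \<in> ?P. gL x \<in> lin_span K ?LF ?gens}"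
        proof clarify
          fix x y assume "x \<in> lower_central ?K ?LF' m" and y: "y \<in> carrier ?LF'"
          then have x: "x \<in> ?P" "gL x \<in> lower_central K ?LF m" using Suc.IH by auto
          have yP: "y \<in> ?P" using y by simp
          obtain s t where st: "x = fL s" "s \<in> T" "s \<in> fixed_points L \<phi> H" "y = fL t" "t \<in> T" "t \<in> fixed_points L \<phi> H"
            using P[OF x(1)] P[OF yP] by blast
          have b: "bracket ?LF' x y = fL (bracket L s t)" by (simp add: st gfL)
          have "bracket ?LF' x y \<in> ?P"
            unfolding b using fix_iff[OF clL(4) FH(2)] fixcl(4) st by simp
          moreover have "gL (bracket ?LF' x y) = bracket ?LF (gL x) t" unfolding b by (simp add: st gfL clL)
          then have "gL (bracket ?LF' x y) \<in> lin_span K ?LF ?gens"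
            using lower_central_bracket[of "gL x" K ?LF m t] x(2) st(6) by simp
          ultimately show "bracket ?LF' x y \<in> ?P \<and> gL (bracket ?LF' x y) \<in> lin_span K ?LF ?gens" by blast
        qed
      qed
    qed
    have nil': "nilpotent_class_le ?K ?LF' c"
    proof -
      have "lower_central ?K ?LF' c \<subseteq> {\<zero>\<^bsub>?LF'\<^esub>}"
      proof
        fix x assume "x \<in> lower_central ?K ?LF' c"
        then have "x \<in> ?P" "gL x = \<zero>\<^bsub>L\<^esub>" using low[of c] nil by (auto simp: nilpotent_class_le_def)
        then show "x \<in> {\<zero>\<^bsub>?LF'\<^esub>}" using P[of x] by (auto simp: gfL)
      qed
      moreover have "\<zero>\<^bsub>?LF'\<^esub> \<in> lower_central ?K ?LF' c"
        using submodule_closed(1)[OF subP] submodule_closed(1)[of _ ?K ?LF'] by (cases c) (auto simp: lin_span_def)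
      ultimately show ?thesis by (auto simp: nilpotent_class_le_def)
    qed
    have "nilpotent_class_le ?K ?L N"
      by (rule nat_bound[OF frob(1,2) trans[OF frob(3) q] lieL acts' fixF' nil'])
    then have low0: "lower_central ?K ?L N = {fL \<zero>\<^bsub>L\<^esub>}" by (simp add: nilpotent_class_le_def)
    have mem: "z \<in> T" if "z \<in> set (x0 # ys0)" for z
    proof -
      obtain i where "i < length (x0 # ys0)" "(x0 # ys0) ! i = z" using \<open>z \<in> set (x0 # ys0)\<close> by (metis in_set_conv_nth)
      then have "gen i = z" using len by (simp add: gen_def)
      then show ?thesis using clL(6)[of i] by simp
    qed
    have fold: "foldl (bracket ?L) (fL x) (map fL ys) = fL (foldl (bracket L) x ys) \<and> foldl (bracket L) x ys \<in> T"
      if "x \<in> T" "set ys \<subseteq> T" for x ys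
      using that by (induction ys arbitrary: x) (auto simp: gfL clL)
    have T0: "x0 \<in> T" "set ys0 \<subseteq> T" using mem by auto
    have "foldl (bracket ?L) (fL x0) (map fL ys0) \<in> lower_central ?K ?L (0 + length (map fL ys0))"
      by (rule foldl_lower_central) (use T0 in auto)
    then have "fL (foldl (bracket L) x0 ys0) = fL \<zero>\<^bsub>L\<^esub>" using fold[OF T0] low0 len by simp
    then show ?thesis using fold[OF T0] gfL clL(1) by metis
  qed
  then show ?thesis by (rule nilpotent_if_commutators_vanish)
qed

text \<open>The constant \<open>nilpotency_bound\<close> is some function with the property \<open>?P\<close> below; \<open>nil_bound\<close> is such a function by \<open>frobenius_nilpotent\<close>, so \<open>?P\<close> does
  hold of \<open>nilpotency_bound\<close>, and countable algebras determine the general case.\<close>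

theorem theorem5p1:
  fixes G :: "'g monoid" and F H :: "'g set"
    and K :: "'k ring" and L :: "('k, 'l) lie_algebra"
    and \<phi> :: "'g \<Rightarrow> 'l \<Rightarrow> 'l" and n q c :: nat
  assumes "frobenius_group G F H"
    and "cyclic_group (G\<lparr>carrier := F\<rparr>)" and "card F = n" and "card H = q"
    and "lie_algebra K L"
    and "acts_by_lie_automorphisms G K L \<phi>"
    and "fixed_points L \<phi> F = {\<zero>\<^bsub>L\<^esub>}"
    and "nilpotent_class_le K (L\<lparr>carrier := fixed_points L \<phi> H\<rparr>) c"
  shows "nilpotent_class_le K L (nilpotency_bound c q)"
proof -
  let ?P = "\<lambda>\<beta>. \<forall>(G :: nat monoid) F H (K :: nat ring) (L :: (nat, nat) lie_algebra) \<phi> c q.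
      frobenius_group G F H \<and> cyclic_group (G\<lparr>carrier := F\<rparr>) \<and> card H = q
      \<and> lie_algebra K L \<and> acts_by_lie_automorphisms G K L \<phi>
      \<and> fixed_points L \<phi> F = {\<zero>\<^bsub>L\<^esub>}
      \<and> nilpotent_class_le K (L\<lparr>carrier := fixed_points L \<phi> H\<rparr>) c
      \<longrightarrow> nilpotent_class_le K L (\<beta> c q)"
  have "?P nil_bound" by (intro allI impI) (elim conjE, rule frobenius_nilpotent)
  then have P: "?P nilpotency_bound" unfolding nilpotency_bound_def by (rule someI[where P = ?P])
  show ?thesis
    by (rule bound_for_countable_suffices[OF _ assms(1,2,4-8)]) (use P in blast)
qed

end
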